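(* Let $(\Omega,\mathcal F,\mathbb P)$ be a probability space, $f_1,f_2,\dots$ real-valued measurable functions on it, and $\mathcal T=\bigcap_{n\in\mathbb N}\sigma(f_n,f_{n+1},\dots)$ their tail $\sigma$-algebra. The following are equivalent: (i) There exist real-valued $\mathcal T$-measurable functions $D_1,D_2,\dots$ with $\mathbb P(|D_N|\le N\ \forall N\in\mathbb N)=1$ and a subsequence $(f_{k_n})_n$ such that, along $(f_{k_n})_n$ and along every subsequence $(f_{m_n})_n$ of it, $\frac1N\sum_{n=1}^N f_{m_n}-D_N\to0$ in $\mathbb P$-probability as $N\to\infty$. (i)$'$ There exist real-valued $\mathcal T$-measurable $D_1,D_2,\dots$ with $\mathbb P(|D_N|\le N\ \forall N)=1$ and a subsequence $(f_{k_n})_n$ such that, along it and along every subsequence $(f_{m_n})_n$ of it, for every $\varepsilon>0$, $\mathbb P\big(\big|\frac1N\sum_{n=1}^N f_{m_n}-D_N\big|>\varepsilon\,\big|\,\mathcal T\big)\to0$ in $\mathbb P$-probability as $N\to\infty$. (ii) $(f_n)$ contains a determining subsequence $(f_{k_n})_n$ whose limiting random probability measure $\boldsymbol\mu$ satisfies, in $\mathbb P$-probability, $\lim_{N\to\infty} N\,\boldsymbol\mu\big(\mathbb R\setminus[-N,N]\big)=0$ and $\lim_{N\to\infty}\frac1N\int_{[-N,N]}x^2\,\boldsymbol\mu(dx,\cdot)=0$. Moreover, each $D_N$ in (i), (i)$'$ can be taken as the weak-$L^2$ limit, as $n\to\infty$, of $\mathbb E\big(f_{k_n}\mathbf 1_{\{|f_{k_n}|\le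 N\}}\,\big|\,\mathcal T\big)$; and $D_N/\sqrt N\to0$ in $\mathbb P$-probability as $N\to\infty$.
   Context: A subsequence $(f_{k_n})_n$ is called determining if there are a countable dense set $\mathbf D\subset\mathbb R$ and a function $\mathbf H:\mathbb R\times\Omega\to[0,1]$ which, for $\mathbb P$-a.e. $\omega$, is a probability distribution function in $x$, such that $\lim_{n\to\infty}\mathbb P(f_{k_n}\le x,\,B)=\int_B\mathbf H(x,\omega)\,\mathbb P(d\omega)$ for all $B\in\mathcal F$ and all $x\in\mathbf D$ (stable convergence). The limiting random probability measure $\boldsymbol\mu_\omega=\boldsymbol\mu(\cdot,\omega)$ is the Borel probability measure on $\mathbb R$ with distribution function $\mathbf H(\cdot,\omega)$; $\omega\mapsto\boldsymbol\mu_\omega$ is measurable with respect to the tail $\sigma$-algebra $\mathcal T$. *)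

theory Defs
  imports "HOL-Probability.Probability"
begin

definition tail_algebra :: "'a measure \<Rightarrow> (nat \<Rightarrow> 'a \<Rightarrow> real) \<Rightarrow> 'a measure" where
  "tail_algebra M f =
     sigma (space M) (prob_space.tail_events M (\<lambda>i. sets (vimage_algebra (space M) (f i) borel)))"

text \<open>Convergence in probability of X N to 0 as N tends to infinity.  The probability of the
  exceptional event is taken in the completion of M (for measurable X this is the usual
  probability); this makes the notion meaningful also for functions that are only defined
  up to null sets, such as functionals of a random measure given only almost everywhere.\<close>
definition conv_in_prob :: "'a measure \<Rightarrow> (nat \<Rightarrow> 'a \<Rightarrow> real) \<Rightarrow> bool" where
  "conv_in_prob M X \<longleftrightarrow>
     (\<forall>\<epsilon>>0. (\<lambda>N. measure (completion M) {\<omega> \<in> space M. \<epsilon> < \<bar>X N \<omega>\<bar>}) \<longlonglongrightarrow> 0)"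

definition distribution_function :: "(real \<Rightarrow> real) \<Rightarrow> bool" where
  "distribution_function F \<longleftrightarrow> mono F \<and> (\<forall>x. continuous (at_right x) F)
     \<and> (F \<longlongrightarrow> 0) at_bot \<and> (F \<longlongrightarrow> 1) at_top"

definition determining_with ::
  "'a measure \<Rightarrow> (nat \<Rightarrow> 'a \<Rightarrow> real) \<Rightarrow> (nat \<Rightarrow> nat) \<Rightarrow> real set \<Rightarrow> (real \<Rightarrow> 'a \<Rightarrow> real) \<Rightarrow> bool"
  where
  "determining_with M f k D H \<longleftrightarrow>
     countable D \<and> closure D = UNIV \<and>
     (\<forall>x. H x \<in> borel_measurable M) \<and> (\<forall>x. \<forall>\<omega>\<in>space M. 0 \<le> H x \<omega> \<and> H x \<omega> \<le> 1) \<and>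
     (AE \<omega> in M. distribution_function (\<lambda>x. H x \<omega>)) \<and>
     (\<forall>B\<in>sets M. \<forall>x\<in>D.
        (\<lambda>n. measure M ({\<omega>\<in>space M. f (k n) \<omega> \<le> x} \<inter> B)) \<longlonglongrightarrow> (\<integral>\<omega>\<in>B. H x \<omega> \<partial>M))"

definition random_measure :: "(real \<Rightarrow> 'a \<Rightarrow> real) \<Rightarrow> 'a \<Rightarrow> real measure" where
  "random_measure H \<omega> = interval_measure (\<lambda>x. H x \<omega>)"

definition weak_L2_limit :: "'a measure \<Rightarrow> (nat \<Rightarrow> 'a \<Rightarrow> real) \<Rightarrow> ('a \<Rightarrow> real) \<Rightarrow> bool" where
  "weak_L2_limit M Y Z \<longleftrightarrow>
     Z \<in> borel_measurable M \<and> integrable M (\<lambda>\<omega>. (Z \<omega>)\<^sup>2) \<and>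
     (\<forall>g\<in>borel_measurable M. integrable M (\<lambda>\<omega>. (g \<omega>)\<^sup>2) \<longrightarrow>
        (\<lambda>n. \<integral>\<omega>. Y n \<omega> * g \<omega> \<partial>M) \<longlonglongrightarrow> (\<integral>\<omega>. Z \<omega> * g \<omega> \<partial>M))"

definition avg :: "(nat \<Rightarrow> 'a \<Rightarrow> real) \<Rightarrow> (nat \<Rightarrow> nat) \<Rightarrow> nat \<Rightarrow> 'a \<Rightarrow> real" where
  "avg f k N \<omega> = (\<Sum>n<N. f (k n) \<omega>) / real N"

definition cond_i :: "'a measure \<Rightarrow> (nat \<Rightarrow> 'a \<Rightarrow> real) \<Rightarrow> (nat \<Rightarrow> nat) \<Rightarrow> (nat \<Rightarrow> 'a \<Rightarrow> real) \<Rightarrow> bool" where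
  "cond_i M f k D \<longleftrightarrow>
     strict_mono k \<and> (\<forall>N. D N \<in> borel_measurable (tail_algebra M f)) \<and>
     (AE \<omega> in M. \<forall>N\<ge>1. \<bar>D N \<omega>\<bar> \<le> real N) \<and>
     (\<forall>m. strict_mono m \<longrightarrow> conv_in_prob M (\<lambda>N \<omega>. avg f (k \<circ> m) N \<omega> - D N \<omega>))"

definition cond_i' :: "'a measure \<Rightarrow> (nat \<Rightarrow> 'a \<Rightarrow> real) \<Rightarrow> (nat \<Rightarrow> nat) \<Rightarrow> (nat \<Rightarrow> 'a \<Rightarrow> real) \<Rightarrow> bool" where
  "cond_i' M f k D \<longleftrightarrow>
     strict_mono k \<and> (\<forall>N. D N \<in> borel_measurable (tail_algebra M f)) \<and>
     (AE \<omega> in M. \<forall>N\<ge>1. \<bar>D N \<omega>\<bar> \<le> real N) \<and>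
     (\<forall>m. strict_mono m \<longrightarrow> (\<forall>\<epsilon>>0. conv_in_prob M (\<lambda>N.
        real_cond_exp M (tail_algebra M f)
          (indicator {\<omega>\<in>space M. \<epsilon> < \<bar>avg f (k \<circ> m) N \<omega> - D N \<omega>\<bar>}))))"

definition cond_ii :: "'a measure \<Rightarrow> (nat \<Rightarrow> 'a \<Rightarrow> real) \<Rightarrow> bool" where
  "cond_ii M f \<longleftrightarrow>
     (\<exists>k D H. strict_mono k \<and> determining_with M f k D H \<and>
        conv_in_prob M (\<lambda>N \<omega>. real N * measure (random_measure H \<omega>) (UNIV - {- real N .. real N})) \<and>
        conv_in_prob M (\<lambda>N \<omega>. (\<integral>x\<in>{- real N .. real N}. x\<^sup>2 \<partial>random_measure H \<omega>) / real N))"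

end

theory Submission
  imports Defs "HOL-Library.Diagonal_Subsequence"
begin

text \<open>
Put \<open>h\<^sub>N(x) = min(x\<^sup>2, N\<^sup>2) / N\<close>. Then \<open>G\<^sub>N = \<integral> h\<^sub>N d\<mu>\<close> is the sum of the two quantities in (ii),
so (ii) says that \<open>G\<^sub>N\<close> tends to 0 in probability. Since conditional probabilities are bounded and
average to probabilities, (i) and (i)' are equivalent for each choice of subsequence and centering.

For (ii) \<open>\<Longrightarrow>\<close> (i), pass to a subsequence along which all truncations \<open>f 1(|f| \<le> N)\<close> converge
weakly to some \<open>D\<^sub>N\<close>; then \<open>D\<^sub>N\<^sup>2 \<le> N G\<^sub>N\<close>, which gives \<open>D\<^sub>N / \<surd>N \<rightarrow> 0\<close>. On the event \<open>G\<^sub>N \<le> 1\<close>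
the truncated and centered variables have second moments of order \<open>N G\<^sub>N\<close>, and choosing the indices
sparsely makes them almost orthogonal, so Chebyshev's inequality applies. A slowly growing number of
initial terms, for which the choice gives no control, is negligible by tightness.

For (i) \<open>\<Longrightarrow>\<close> (ii), the weak law for all subsequences is automatically uniform over subsequences starting
late enough (a gliding hump). Applying it to two halves of an index tuple cancels \<open>D\<^sub>N\<close>, and letting the
indices tend to infinity one after the other replaces \<open>exp(i t f / N)\<close> by the characteristic function
\<open>\<phi>\<close> of \<open>\<mu>\<close>. Hence the expectation of \<open>1 - |\<phi>(t/N)|\<^sup>2\<^sup>N\<close> tends to 0 uniformly for bounded \<open>t\<close>, and integrating
over \<open>t\<close> bounds \<open>G\<^sub>N\<close>.
\<close>

subsection \<open>Weak convergence of random variables\<close>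

text \<open>Three obstacles shape the proof. \<open>M\<close> need not be separable, so weak
  compactness is obtained on a sigma-algebra generated by countably many events and carried to all
  of \<open>M\<close> by conditioning the test set. The truncation jumps at N and -N, where \<mu>
  may have atoms, so stable convergence alone does not give its weak limits, while the continuous
  \<open>h\<^sub>N\<close> has the limit \<open>G\<^sub>N\<close> directly. The centering therefore
  comes from compactness, and its tail measurability is a separate matter. In the converse direction
  neither moments nor independence are available. Here \<open>|\<phi>|\<^sup>2\<close> is the
  characteristic function of the difference of two independent copies of \<mu>, and integrating 1 -
  cos over frequencies yields truncated second moments of that difference. Undoing this
  symmetrization costs a factor and an error of order \<open>L\<^sup>2 / N\<close>, where [-L, L]
  carries half of the mass. The indices tend to infinity while N stays fixed, which is why the weak
  law has to be uniform over late index sequences.\<close>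

definition wk_conv :: "'a measure \<Rightarrow> (nat \<Rightarrow> 'a \<Rightarrow> 'b::{banach, second_countable_topology}) \<Rightarrow> ('a \<Rightarrow> 'b) \<Rightarrow> bool"
  where "wk_conv M X Y \<longleftrightarrow> (\<forall>B\<in>sets M. (\<lambda>n. \<integral>\<omega>\<in>B. X n \<omega> \<partial>M) \<longlonglongrightarrow> (\<integral>\<omega>\<in>B. Y \<omega> \<partial>M))"

lemma wk_convD:
  "wk_conv M X Y \<Longrightarrow> B \<in> sets M \<Longrightarrow> (\<lambda>n. \<integral>\<omega>\<in>B. X n \<omega> \<partial>M) \<longlonglongrightarrow> (\<integral>\<omega>\<in>B. Y \<omega> \<partial>M)"
  by (simp add: wk_conv_def)

lemma wk_conv_subseq:
  assumes "wk_conv M X Y" "strict_mono r" shows "wk_conv M (\<lambda>n. X (r n)) Y"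
  unfolding wk_conv_def
proof
  fix B assume "B \<in> sets M"
  from LIMSEQ_subseq_LIMSEQ[OF wk_convD[OF assms(1) this] assms(2)]
  show "(\<lambda>n. \<integral>\<omega>\<in>B. X (r n) \<omega> \<partial>M) \<longlonglongrightarrow> (\<integral>\<omega>\<in>B. Y \<omega> \<partial>M)" by (simp add: o_def)
qed

context prob_space
begin

lemma integrable_scaleR_bdd:
  fixes Z :: "'a \<Rightarrow> real" and X :: "'a \<Rightarrow> 'b::{banach, second_countable_topology}"
  assumes Z: "integrable M Z" and X[measurable]: "X \<in> borel_measurable M"
    and b: "\<And>\<omega>. \<omega> \<in> space M \<Longrightarrow> norm (X \<omega>) \<le> C"
  shows "integrable M (\<lambda>\<omega>. Z \<omega> *\<^sub>R X \<omega>)"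
proof (rule Bochner_Integration.integrable_bound[of M "\<lambda>\<omega>. C * Z \<omega>"])
  show "integrable M (\<lambda>\<omega>. C * Z \<omega>)" using Z by simp
  have [measurable]: "Z \<in> borel_measurable M" using Z by simp
  show "(\<lambda>\<omega>. Z \<omega> *\<^sub>R X \<omega>) \<in> borel_measurable M" by measurable
  show "AE \<omega> in M. norm (Z \<omega> *\<^sub>R X \<omega>) \<le> norm (C * Z \<omega>)"
  proof (rule AE_I2)
    fix \<omega> assume "\<omega> \<in> space M"
    with b[OF this] have "norm (X \<omega>) \<le> \<bar>C\<bar>" by linarith
    then show "norm (Z \<omega> *\<^sub>R X \<omega>) \<le> norm (C * Z \<omega>)"
      by (simp add: abs_mult mult.commute[of "\<bar>C\<bar>"] mult_left_mono)
  qed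
qed

lemma integrable_mult_bdd:
  fixes Z X :: "'a \<Rightarrow> real"
  assumes "integrable M Z" "X \<in> borel_measurable M" "\<And>\<omega>. \<omega> \<in> space M \<Longrightarrow> \<bar>X \<omega>\<bar> \<le> C"
  shows "integrable M (\<lambda>\<omega>. Z \<omega> * X \<omega>)"
  using integrable_scaleR_bdd[of Z X C] assms by simp

lemma norm_integral_scaleR_le:
  fixes Z :: "'a \<Rightarrow> real" and X :: "'a \<Rightarrow> 'b::{banach, second_countable_topology}"
  assumes Z: "integrable M Z" and X: "X \<in> borel_measurable M"
    and b: "\<And>\<omega>. \<omega> \<in> space M \<Longrightarrow> norm (X \<omega>) \<le> C"
  shows "norm (\<integral>\<omega>. Z \<omega> *\<^sub>R X \<omega> \<partial>M) \<le> C * (\<integral>\<omega>. \<bar>Z \<omega>\<bar> \<partial>M)"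
proof -
  have "norm (\<integral>\<omega>. Z \<omega> *\<^sub>R X \<omega> \<partial>M) \<le> (\<integral>\<omega>. norm (Z \<omega> *\<^sub>R X \<omega>) \<partial>M)"
    by (rule integral_norm_bound)
  also have "\<dots> \<le> (\<integral>\<omega>. C * \<bar>Z \<omega>\<bar> \<partial>M)"
  proof (rule integral_mono)
    show "integrable M (\<lambda>\<omega>. norm (Z \<omega> *\<^sub>R X \<omega>))"
      using integrable_scaleR_bdd[OF assms] by (rule integrable_norm)
    show "integrable M (\<lambda>\<omega>. C * \<bar>Z \<omega>\<bar>)" using Z by simp
    fix \<omega> assume "\<omega> \<in> space M"
    from b[OF this] show "norm (Z \<omega> *\<^sub>R X \<omega>) \<le> C * \<bar>Z \<omega>\<bar>"
      by (simp add: mult.commute[of C] mult_left_mono)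
  qed
  finally show ?thesis by simp
qed

text \<open>Convergence against indicators extends to integrable weights because indicators generate
  them under sums and L1 limits, and the common bound \<open>C\<close> makes an L1 error in the
  weight harmless uniformly in n. The values lie in a Banach space so that real and complex
  sequences are covered at once.\<close>

lemma wk_conv_integral:
  fixes Z :: "'a \<Rightarrow> real" and X :: "nat \<Rightarrow> 'a \<Rightarrow> 'b::{banach, second_countable_topology}"
  assumes w: "wk_conv M X Y" and Z: "integrable M Z"
    and X[measurable]: "\<And>n. X n \<in> borel_measurable M"
    and Y[measurable]: "Y \<in> borel_measurable M"
    and bX: "\<And>n \<omega>. \<omega> \<in> space M \<Longrightarrow> norm (X n \<omega>) \<le> C"
    and bY: "\<And>\<omega>. \<omega> \<in> space M \<Longrightarrow> norm (Y \<omega>) \<le> C"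
  shows "(\<lambda>n. \<integral>\<omega>. Z \<omega> *\<^sub>R X n \<omega> \<partial>M) \<longlonglongrightarrow> (\<integral>\<omega>. Z \<omega> *\<^sub>R Y \<omega> \<partial>M)"
  using Z
proof induct
  case (base A c)
  have "(\<lambda>n. c *\<^sub>R (\<integral>\<omega>\<in>A. X n \<omega> \<partial>M)) \<longlonglongrightarrow> c *\<^sub>R (\<integral>\<omega>\<in>A. Y \<omega> \<partial>M)"
    by (intro tendsto_intros wk_convD[OF w] base)
  moreover have "(\<integral>\<omega>. (indicator A \<omega> *\<^sub>R c) *\<^sub>R W \<omega> \<partial>M) = c *\<^sub>R (\<integral>\<omega>\<in>A. W \<omega> \<partial>M)" for W :: "'a \<Rightarrow> 'b"
  proof -
    have "(\<integral>\<omega>. (indicator A \<omega> *\<^sub>R c) *\<^sub>R W \<omega> \<partial>M) = (\<integral>\<omega>. c *\<^sub>R (indicator A \<omega> *\<^sub>R W \<omega>) \<partial>M)"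
      by (intro Bochner_Integration.integral_cong) (auto simp: indicator_def)
    also have "\<dots> = c *\<^sub>R (\<integral>\<omega>\<in>A. W \<omega> \<partial>M)"
      unfolding set_lebesgue_integral_def by (rule integral_scaleR_right)
    finally show ?thesis .
  qed
  ultimately show ?case by simp
next
  case (add f g)
  have e: "(\<integral>\<omega>. (f \<omega> + g \<omega>) *\<^sub>R W \<omega> \<partial>M) = (\<integral>\<omega>. f \<omega> *\<^sub>R W \<omega> \<partial>M) + (\<integral>\<omega>. g \<omega> *\<^sub>R W \<omega> \<partial>M)"
    if "W \<in> borel_measurable M" "\<And>\<omega>. \<omega> \<in> space M \<Longrightarrow> norm (W \<omega>) \<le> C" for W :: "'a \<Rightarrow> 'b"
    unfolding scaleR_add_left
    using integrable_scaleR_bdd[of f W C] integrable_scaleR_bdd[of g W C] add(1,3) that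
    by (intro Bochner_Integration.integral_add) auto
  show ?case
    using tendsto_add[OF add(2) add(4)] by (simp add: e bX bY)
next
  case (lim f s)
  have C: "0 \<le> C"
  proof -
    obtain \<omega> where "\<omega> \<in> space M" using not_empty by auto
    from bY[OF this] show ?thesis by (meson norm_ge_zero order_trans)
  qed
  have [measurable]: "f \<in> borel_measurable M" "\<And>i. s i \<in> borel_measurable M" using lim by auto
  \<comment> \<open>The approximating simple functions satisfy
    \<open>norm (s i x) \<le> 2 * norm (f x)\<close>, hence the dominating function
    \<open>3 * \<bar>f \<omega>\<bar>\<close>.\<close>
  have L: "(\<lambda>i. \<integral>\<omega>. \<bar>f \<omega> - s i \<omega>\<bar> \<partial>M) \<longlonglongrightarrow> (\<integral>\<omega>. 0 \<partial>M)"
  proof (rule integral_dominated_convergence[where w="\<lambda>\<omega>. 3 * \<bar>f \<omega>\<bar>"])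
    show "integrable M (\<lambda>\<omega>. 3 * \<bar>f \<omega>\<bar>)" using lim by simp
    show "AE \<omega> in M. (\<lambda>i. \<bar>f \<omega> - s i \<omega>\<bar>) \<longlonglongrightarrow> 0"
      using lim(3) by (intro AE_I2 tendsto_rabs_zero) (auto intro!: tendsto_eq_intros)
    fix i
    show "AE \<omega> in M. norm \<bar>f \<omega> - s i \<omega>\<bar> \<le> 3 * \<bar>f \<omega>\<bar>"
    proof (rule AE_I2)
      fix \<omega> assume "\<omega> \<in> space M"
      from lim(4)[OF this, of i] show "norm \<bar>f \<omega> - s i \<omega>\<bar> \<le> 3 * \<bar>f \<omega>\<bar>" by simp
    qed
  qed simp_all
  have diff: "norm ((\<integral>\<omega>. f \<omega> *\<^sub>R W \<omega> \<partial>M) - (\<integral>\<omega>. s i \<omega> *\<^sub>R W \<omega> \<partial>M)) \<le> C * (\<integral>\<omega>. \<bar>f \<omega> - s i \<omega>\<bar> \<partial>M)"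
    if "W \<in> borel_measurable M" "\<And>\<omega>. \<omega> \<in> space M \<Longrightarrow> norm (W \<omega>) \<le> C" for W :: "'a \<Rightarrow> 'b" and i
  proof -
    have "(\<integral>\<omega>. f \<omega> *\<^sub>R W \<omega> \<partial>M) - (\<integral>\<omega>. s i \<omega> *\<^sub>R W \<omega> \<partial>M) = (\<integral>\<omega>. (f \<omega> - s i \<omega>) *\<^sub>R W \<omega> \<partial>M)"
      unfolding scaleR_diff_left
      using integrable_scaleR_bdd[of f W C] integrable_scaleR_bdd[of "s i" W C] lim that
      by (intro Bochner_Integration.integral_diff[symmetric]) auto
    then show ?thesis using norm_integral_scaleR_le[of "\<lambda>\<omega>. f \<omega> - s i \<omega>" W C] lim that by simp
  qed
  show ?case
  proof (rule LIMSEQ_I)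
    fix e :: real assume e: "0 < e"
    \<comment> \<open>\<open>C + 1\<close> instead of \<open>C\<close>, since \<open>C\<close> may
      be 0.\<close>
    then have "0 < e / (3 * (C + 1))" using C by simp
    from LIMSEQ_D[OF L this] obtain i where i: "(\<integral>\<omega>. \<bar>f \<omega> - s i \<omega>\<bar> \<partial>M) < e / (3 * (C + 1))"
      by auto
    have "C * (\<integral>\<omega>. \<bar>f \<omega> - s i \<omega>\<bar> \<partial>M) \<le> (C + 1) * (\<integral>\<omega>. \<bar>f \<omega> - s i \<omega>\<bar> \<partial>M)"
      by (intro mult_right_mono) auto
    also have "\<dots> < e / 3" using i C by (simp add: field_simps)
    finally have i': "C * (\<integral>\<omega>. \<bar>f \<omega> - s i \<omega>\<bar> \<partial>M) < e / 3" .
    from LIMSEQ_D[OF lim(2)[of i], of "e / 3"] e obtain n0 where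
      n0: "\<And>n. n \<ge> n0 \<Longrightarrow> norm ((\<integral>\<omega>. s i \<omega> *\<^sub>R X n \<omega> \<partial>M) - (\<integral>\<omega>. s i \<omega> *\<^sub>R Y \<omega> \<partial>M)) < e / 3" by auto
    show "\<exists>no. \<forall>n\<ge>no. norm ((\<integral>\<omega>. f \<omega> *\<^sub>R X n \<omega> \<partial>M) - (\<integral>\<omega>. f \<omega> *\<^sub>R Y \<omega> \<partial>M)) < e"
    proof (intro exI allI impI)
      fix n assume "n0 \<le> n"
      note n1 = n0[OF this]
      have n2: "norm ((\<integral>\<omega>. f \<omega> *\<^sub>R X n \<omega> \<partial>M) - (\<integral>\<omega>. s i \<omega> *\<^sub>R X n \<omega> \<partial>M)) < e / 3"
        using diff[of "X n" i] bX i' by simp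
      have n3: "norm ((\<integral>\<omega>. s i \<omega> *\<^sub>R Y \<omega> \<partial>M) - (\<integral>\<omega>. f \<omega> *\<^sub>R Y \<omega> \<partial>M)) < e / 3"
        using diff[of Y i] bY i' by (simp add: norm_minus_commute)
      have tri: "norm (a - d) \<le> norm (a - b) + norm (b - c) + norm (c - d)" for a b c d :: 'b
        using norm_triangle_ineq[of "a - b" "b - c"] norm_triangle_ineq[of "a - c" "c - d"] by simp
      show "norm ((\<integral>\<omega>. f \<omega> *\<^sub>R X n \<omega> \<partial>M) - (\<integral>\<omega>. f \<omega> *\<^sub>R Y \<omega> \<partial>M)) < e"
        using n1 n2 n3 tri[of "\<integral>\<omega>. f \<omega> *\<^sub>R X n \<omega> \<partial>M" "\<integral>\<omega>. f \<omega> *\<^sub>R Y \<omega> \<partial>M"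
          "\<integral>\<omega>. s i \<omega> *\<^sub>R X n \<omega> \<partial>M" "\<integral>\<omega>. s i \<omega> *\<^sub>R Y \<omega> \<partial>M"] by linarith
    qed
  qed
qed

subsection \<open>Convergence in probability\<close>

lemma conv_in_prob_iff:
  assumes [measurable]: "\<And>N. X N \<in> borel_measurable M"
  shows "conv_in_prob M X \<longleftrightarrow> (\<forall>\<epsilon>>0. (\<lambda>N. prob {\<omega> \<in> space M. \<epsilon> < \<bar>X N \<omega>\<bar>}) \<longlonglongrightarrow> 0)"
  by (simp add: conv_in_prob_def)

lemma conv_in_probI:
  assumes [measurable]: "\<And>N. X N \<in> borel_measurable M"
    and "\<And>\<epsilon> \<delta>. 0 < \<epsilon> \<Longrightarrow> 0 < \<delta> \<Longrightarrow> eventually (\<lambda>N. prob {\<omega> \<in> space M. \<epsilon> < \<bar>X N \<omega>\<bar>} \<le> \<delta>) sequentially"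
  shows "conv_in_prob M X"
  unfolding conv_in_prob_iff[OF assms(1)]
proof (intro allI impI)
  fix \<epsilon> :: real assume \<epsilon>: "0 < \<epsilon>"
  show "(\<lambda>N. prob {\<omega> \<in> space M. \<epsilon> < \<bar>X N \<omega>\<bar>}) \<longlonglongrightarrow> 0"
  proof (rule tendstoI)
    fix e :: real assume "0 < e"
    then have "0 < e / 2" by simp
    from assms(2)[OF \<epsilon> this] show "\<forall>\<^sub>F N in sequentially. dist (prob {\<omega> \<in> space M. \<epsilon> < \<bar>X N \<omega>\<bar>}) 0 < e"
      by eventually_elim (use \<open>0 < e\<close> in \<open>auto simp: dist_real_def\<close>)
  qed
qed

lemma conv_in_probD:
  assumes "conv_in_prob M X" and [measurable]: "\<And>N. X N \<in> borel_measurable M" and "0 < \<epsilon>" "0 < \<delta>"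
  shows "eventually (\<lambda>N. prob {\<omega> \<in> space M. \<epsilon> < \<bar>X N \<omega>\<bar>} < \<delta>) sequentially"
proof -
  have "(\<lambda>N. prob {\<omega> \<in> space M. \<epsilon> < \<bar>X N \<omega>\<bar>}) \<longlonglongrightarrow> 0"
    using assms conv_in_prob_iff by blast
  from order_tendstoD(2)[OF this \<open>0 < \<delta>\<close>] show ?thesis .
qed

text \<open>Y need not be measurable: its exceptional events are measured in the completion.\<close>

lemma conv_in_prob_AE_cong:
  assumes X[measurable]: "\<And>N. X N \<in> borel_measurable M"
    and eq: "\<And>N. 1 \<le> N \<Longrightarrow> AE \<omega> in M. X N \<omega> = Y N \<omega>"
  shows "conv_in_prob M Y \<longleftrightarrow> conv_in_prob M X"
proof -
  have "measure (completion M) {\<omega> \<in> space M. \<epsilon> < \<bar>Y N \<omega>\<bar>} = measure (completion M) {\<omega> \<in> space M. \<epsilon> < \<bar>X N \<omega>\<bar>}"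
    if "1 \<le> N" for N \<epsilon>
  proof (rule measure_eq_AE)
    show "AE \<omega> in completion M. (\<omega> \<in> {\<omega> \<in> space M. \<epsilon> < \<bar>Y N \<omega>\<bar>}) = (\<omega> \<in> {\<omega> \<in> space M. \<epsilon> < \<bar>X N \<omega>\<bar>})"
      using AE_completion[OF eq[OF that]] by eventually_elim auto
    show A: "{\<omega> \<in> space M. \<epsilon> < \<bar>X N \<omega>\<bar>} \<in> sets (completion M)"
      by (intro sets_completionI_sets) measurable
    from AE_completion[OF eq[OF that]] have "AE \<omega> in M. X N \<omega> = Y N \<omega>"
      using eq[OF that] by simp
    then obtain S where S: "S \<in> null_sets M" "{\<omega>\<in>space M. X N \<omega> \<noteq> Y N \<omega>} \<subseteq> S"
      by (auto elim!: AE_E simp: null_sets_def)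
    \<comment> \<open>The events of \<open>Y\<close> and \<open>X\<close> differ only inside the
      null set \<open>S\<close>, all of whose subsets are measurable in the completion.\<close>
    have sub: "B \<in> sets (completion M)" if "B \<subseteq> S" for B
      by (rule sets_completionI_sub[OF S(1) that])
    have "{\<omega> \<in> space M. \<epsilon> < \<bar>Y N \<omega>\<bar>} = ({\<omega> \<in> space M. \<epsilon> < \<bar>X N \<omega>\<bar>} - S) \<union> ({\<omega> \<in> space M. \<epsilon> < \<bar>Y N \<omega>\<bar>} \<inter> S)"
      using S(2) by auto
    also have "\<dots> \<in> sets (completion M)"
      using A sub by (intro sets.Un sets.Diff) auto
    finally show "{\<omega> \<in> space M. \<epsilon> < \<bar>Y N \<omega>\<bar>} \<in> sets (completion M)" .
  qed
  then have "(\<lambda>N. measure (completion M) {\<omega> \<in> space M. \<epsilon> < \<bar>Y N \<omega>\<bar>}) \<longlonglongrightarrow> 0 \<longleftrightarrow>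
    (\<lambda>N. measure (completion M) {\<omega> \<in> space M. \<epsilon> < \<bar>X N \<omega>\<bar>}) \<longlonglongrightarrow> 0" for \<epsilon>
    by (intro tendsto_cong eventually_sequentiallyI[of 1]) auto
  then show ?thesis by (simp add: conv_in_prob_def)
qed

text \<open>The comparison starts at N = 1 because the quantities it is applied to involve division
  by N, and finitely many indices do not influence the limit.\<close>

lemma conv_in_prob_bound:
  assumes X[measurable]: "\<And>N. X N \<in> borel_measurable M" and Y[measurable]: "\<And>N. Y N \<in> borel_measurable M"
    and c: "conv_in_prob M Y"
    and le: "\<And>N. 1 \<le> N \<Longrightarrow> AE \<omega> in M. \<bar>X N \<omega>\<bar> \<le> \<bar>Y N \<omega>\<bar>"
  shows "conv_in_prob M X"
proof (rule conv_in_probI)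
  fix \<epsilon> \<delta> :: real assume p: "0 < \<epsilon>" "0 < \<delta>"
  show "\<forall>\<^sub>F N in sequentially. prob {\<omega> \<in> space M. \<epsilon> < \<bar>X N \<omega>\<bar>} \<le> \<delta>"
    using conv_in_probD[OF c Y p] eventually_ge_at_top[of 1]
  proof eventually_elim
    case (elim N)
    have "prob {\<omega> \<in> space M. \<epsilon> < \<bar>X N \<omega>\<bar>} \<le> prob {\<omega> \<in> space M. \<epsilon> < \<bar>Y N \<omega>\<bar>}"
      using le[OF elim(2)] by (intro finite_measure_mono_AE) (auto elim: eventually_mono)
    with elim show ?case by simp
  qed
qed fact

text \<open>Splitting at level e / 2, small values contribute at most e / 2 and large ones at most
  \<open>C\<close> times their probability. Together with the converse by Markov's inequality below,
  convergence in probability of uniformly bounded variables is convergence in L1, which is how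
  probabilities and conditional probabilities are exchanged.\<close>

lemma conv_in_prob_integral_bounded:
  assumes X[measurable]: "\<And>N. X N \<in> borel_measurable M"
    and b: "\<And>N \<omega>. \<omega> \<in> space M \<Longrightarrow> \<bar>X N \<omega>\<bar> \<le> C" and c: "conv_in_prob M X"
  shows "(\<lambda>N. \<integral>\<omega>. \<bar>X N \<omega>\<bar> \<partial>M) \<longlonglongrightarrow> 0"
proof (rule tendstoI)
  fix e :: real assume e: "0 < e"
  have C: "0 \<le> C" using b not_empty by (meson abs_ge_zero all_not_in_conv order_trans)
  have p: "0 < e / 2" "0 < e / (2 * (C + 1))" using e C by auto
  show "\<forall>\<^sub>F N in sequentially. dist (\<integral>\<omega>. \<bar>X N \<omega>\<bar> \<partial>M) 0 < e"
    using conv_in_probD[OF c X p]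
  proof eventually_elim
    case (elim N)
    let ?A = "{\<omega> \<in> space M. e / 2 < \<bar>X N \<omega>\<bar>}"
    have "(\<integral>\<omega>. \<bar>X N \<omega>\<bar> \<partial>M) \<le> (\<integral>\<omega>. e / 2 + C * indicator ?A \<omega> \<partial>M)"
    proof (intro integral_mono)
      show "integrable M (\<lambda>\<omega>. \<bar>X N \<omega>\<bar>)"
        using b by (intro integrable_const_bound[where B=C]) auto
      show "integrable M (\<lambda>\<omega>. e / 2 + C * indicator ?A \<omega>)" by (simp add: emeasure_eq_measure)
      fix \<omega> assume "\<omega> \<in> space M"
      with b[of \<omega> N] C e show "\<bar>X N \<omega>\<bar> \<le> e / 2 + C * indicator ?A \<omega>"
        by (auto simp: indicator_def)
    qed
    also have "\<dots> = e / 2 + C * prob ?A"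
      by (subst Bochner_Integration.integral_add) (auto simp: prob_space emeasure_eq_measure)
    also have "C * prob ?A \<le> (C + 1) * prob ?A" by (intro mult_right_mono) auto
    also have "(C + 1) * prob ?A < e / 2" using elim C by (simp add: field_simps)
    finally show ?case by (simp add: dist_real_def)
  qed
qed

lemma conv_in_prob_integral:
  assumes X[measurable]: "\<And>N. X N \<in> borel_measurable M" and i: "\<And>N. integrable M (X N)"
    and c: "(\<lambda>N. \<integral>\<omega>. \<bar>X N \<omega>\<bar> \<partial>M) \<longlonglongrightarrow> 0"
  shows "conv_in_prob M X"
proof (rule conv_in_probI)
  fix \<epsilon> \<delta> :: real assume p: "0 < \<epsilon>" "0 < \<delta>"
  then have "0 < \<epsilon> * \<delta>" by simp
  from order_tendstoD(2)[OF c this]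
  show "\<forall>\<^sub>F N in sequentially. prob {\<omega> \<in> space M. \<epsilon> < \<bar>X N \<omega>\<bar>} \<le> \<delta>"
  proof eventually_elim
    case (elim N)
    have "prob {\<omega> \<in> space M. \<epsilon> < \<bar>X N \<omega>\<bar>} \<le> prob {\<omega> \<in> space M. \<epsilon> \<le> \<bar>X N \<omega>\<bar>}"
      by (intro finite_measure_mono) auto
    also have "\<dots> \<le> (\<integral>\<omega>. \<bar>X N \<omega>\<bar> \<partial>M) / \<epsilon>"
      using integral_Markov_inequality_measure[of M "\<lambda>\<omega>. \<bar>X N \<omega>\<bar>" "space M" \<epsilon>] i p by simp
    also have "\<dots> \<le> \<delta>" using elim p by (simp add: field_simps)
    finally show ?case .
  qed
qed fact

end

subsection \<open>Weak sequential compactness\<close>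

text \<open>Cantor's diagonal argument: each row has a convergent subsequence by compactness of
  \<open>{-C..C}\<close>, and convergence is inherited by further subsequences.\<close>

lemma bounded_imp_convergent_diagonal:
  fixes a :: "nat \<Rightarrow> nat \<Rightarrow> real"
  assumes b: "\<And>i n. \<bar>a i n\<bar> \<le> C"
  obtains r :: "nat \<Rightarrow> nat" where "strict_mono r" "\<And>i. convergent (\<lambda>n. a i (r n))"
proof -
  interpret nat: subseqs "\<lambda>i s. convergent (\<lambda>n. a i (s n))"
  proof
    fix i and s :: "nat \<Rightarrow> nat"
    have "\<forall>n. a i (s n) \<in> {-C..C}" using b by (auto simp: abs_le_iff minus_le_iff)
    then obtain l r where "strict_mono r" "((\<lambda>n. a i (s n)) \<circ> r) \<longlonglongrightarrow> l"
      using compact_Icc[of "-C" C] compact_imp_seq_compact seq_compactE by metis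
    then show "\<exists>r. strict_mono r \<and> convergent (\<lambda>n. a i ((s \<circ> r) n))"
      by (auto simp: convergent_def o_def)
  qed
  show ?thesis
  proof (rule that[OF nat.subseq_diagseq])
    fix i
    have "convergent (\<lambda>n. a i ((nat.diagseq \<circ> (+) (Suc i)) n))"
    proof (rule nat.diagseq_holds)
      fix r s :: "nat \<Rightarrow> nat" and n
      assume "strict_mono r" "convergent (\<lambda>k. a n (s k))"
      then show "convergent (\<lambda>k. a n ((s \<circ> r) k))"
        using convergent_subseq_convergent[of "\<lambda>k. a n (s k)" r] by (simp add: o_def)
    qed
    \<comment> \<open>The diagonal is a subsequence of the i-th selection only from index
      \<open>Suc i\<close> on, which convergence does not notice.\<close>
    then have "convergent (\<lambda>n. a i (nat.diagseq (n + Suc i)))" by (simp add: o_def add.commute)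
    then show "convergent (\<lambda>n. a i (nat.diagseq n))"
      using convergent_ignore_initial_segment[of "\<lambda>n. a i (nat.diagseq n)" "Suc i"] by simp
  qed
qed

context prob_space
begin

text \<open>The weights against which the integrals of \<open>X\<close> converge form an L1-closed
  set. The limit functional is not identified yet, so the argument runs through Cauchy
  sequences.\<close>

lemma convergent_integral_L1_limit:
  fixes X :: "nat \<Rightarrow> 'a \<Rightarrow> real"
  assumes X[measurable]: "\<And>n. X n \<in> borel_measurable M"
    and b: "\<And>n \<omega>. \<omega> \<in> space M \<Longrightarrow> \<bar>X n \<omega>\<bar> \<le> 1"
    and s: "\<And>i. integrable M (s i)" and f: "integrable M f"
    and L: "(\<lambda>i. \<integral>\<omega>. \<bar>f \<omega> - s i \<omega>\<bar> \<partial>M) \<longlonglongrightarrow> 0"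
    and c: "\<And>i. convergent (\<lambda>n. \<integral>\<omega>. s i \<omega> * X n \<omega> \<partial>M)"
  shows "convergent (\<lambda>n. \<integral>\<omega>. f \<omega> * X n \<omega> \<partial>M)"
proof (rule Cauchy_convergent, rule metric_CauchyI)
  fix e :: real assume e: "0 < e"
  then have "0 < e / 3" by simp
  from LIMSEQ_D[OF L this] obtain i where i: "(\<integral>\<omega>. \<bar>f \<omega> - s i \<omega>\<bar> \<partial>M) < e / 3" by auto
  have d: "\<bar>(\<integral>\<omega>. f \<omega> * X n \<omega> \<partial>M) - (\<integral>\<omega>. s i \<omega> * X n \<omega> \<partial>M)\<bar> < e / 3" for n
  proof -
    have I: "integrable M (\<lambda>\<omega>. f \<omega> * X n \<omega>)" "integrable M (\<lambda>\<omega>. s i \<omega> * X n \<omega>)"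
      using integrable_scaleR_bdd[of _ "X n" 1] f s b X by auto
    have "(\<integral>\<omega>. f \<omega> * X n \<omega> \<partial>M) - (\<integral>\<omega>. s i \<omega> * X n \<omega> \<partial>M) = (\<integral>\<omega>. (f \<omega> - s i \<omega>) * X n \<omega> \<partial>M)"
      unfolding left_diff_distrib by (rule Bochner_Integration.integral_diff[symmetric]) fact+
    also have "\<bar>\<dots>\<bar> \<le> (\<integral>\<omega>. \<bar>f \<omega> - s i \<omega>\<bar> \<partial>M)"
      using norm_integral_scaleR_le[of "\<lambda>\<omega>. f \<omega> - s i \<omega>" "X n" 1] f s b by simp
    finally show ?thesis using i by simp
  qed
  have "Cauchy (\<lambda>n. \<integral>\<omega>. s i \<omega> * X n \<omega> \<partial>M)" using c by (simp add: convergent_Cauchy)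
  from metric_CauchyD[OF this \<open>0 < e / 3\<close>] obtain n0 where
    n0: "\<And>m n. n0 \<le> m \<Longrightarrow> n0 \<le> n \<Longrightarrow> \<bar>(\<integral>\<omega>. s i \<omega> * X m \<omega> \<partial>M) - (\<integral>\<omega>. s i \<omega> * X n \<omega> \<partial>M)\<bar> < e / 3"
    by (auto simp: dist_real_def)
  show "\<exists>n0. \<forall>m\<ge>n0. \<forall>n\<ge>n0. dist (\<integral>\<omega>. f \<omega> * X m \<omega> \<partial>M) (\<integral>\<omega>. f \<omega> * X n \<omega> \<partial>M) < e"
  proof (intro exI allI impI)
    fix m n assume "n0 \<le> m" "n0 \<le> n"
    from n0[OF this] d[of m] d[of n]
    show "dist (\<integral>\<omega>. f \<omega> * X m \<omega> \<partial>M) (\<integral>\<omega>. f \<omega> * X n \<omega> \<partial>M) < e"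
      unfolding dist_real_def by linarith
  qed
qed

text \<open>A Dynkin class argument: the sets with convergent integrals are closed under complements
  and countable disjoint unions, the latter because a countable union is an L1 limit of its finite
  parts. Complements are taken relative to \<open>space M\<close>, whose integral converges because
  it belongs to the generator.\<close>

lemma convergent_set_integral_sigma_sets:
  fixes X :: "nat \<Rightarrow> 'a \<Rightarrow> real"
  assumes X[measurable]: "\<And>n. X n \<in> borel_measurable M"
    and b: "\<And>n \<omega>. \<omega> \<in> space M \<Longrightarrow> \<bar>X n \<omega>\<bar> \<le> 1"
    and G: "Int_stable G" "G \<subseteq> sets M" "space M \<in> G"
    and c: "\<And>A. A \<in> G \<Longrightarrow> convergent (\<lambda>n. \<integral>\<omega>. indicator A \<omega> * X n \<omega> \<partial>M)"
    and A: "A \<in> sigma_sets (space M) G"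
  shows "convergent (\<lambda>n. \<integral>\<omega>. indicator A \<omega> * X n \<omega> \<partial>M)"
proof -
  have GP: "G \<subseteq> Pow (space M)" using G(2) sets.space_closed by blast
  have sG: "sigma_sets (space M) G \<subseteq> sets M" using G(2) by (rule sets.sigma_sets_subset)
  have Ii: "integrable M (indicat_real A)" if "A \<in> sets M" for A
    using that by (simp add: emeasure_eq_measure)
  have IX: "integrable M (\<lambda>\<omega>. indicat_real A \<omega> * X n \<omega>)" if "A \<in> sets M" for A n
    using integrable_mult_bdd[OF Ii[OF that] X b, of n] by simp
  show ?thesis using G(1) GP A
  proof (induct rule: sigma_sets_induct_disjoint)
    case (compl A)
    then have [measurable]: "A \<in> sets M" using sG by auto
    have "(\<integral>\<omega>. indicator (space M - A) \<omega> * X n \<omega> \<partial>M) =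
      (\<integral>\<omega>. indicator (space M) \<omega> * X n \<omega> \<partial>M) - (\<integral>\<omega>. indicator A \<omega> * X n \<omega> \<partial>M)" for n
    proof -
      have "(\<integral>\<omega>. indicator (space M - A) \<omega> * X n \<omega> \<partial>M) = (\<integral>\<omega>. indicator (space M) \<omega> * X n \<omega> - indicator A \<omega> * X n \<omega> \<partial>M)"
        by (intro Bochner_Integration.integral_cong) (auto simp: indicator_def)
      then show ?thesis using Bochner_Integration.integral_diff[OF IX IX] by simp
    qed
    then show ?case using c[OF G(3)] compl by (simp add: convergent_diff)
  next
    case (union A)
    have A[measurable]: "\<And>i. A i \<in> sets M" using union sG by auto
    have c1: "convergent (\<lambda>n. \<integral>\<omega>. indicator (\<Union>i<k. A i) \<omega> * X n \<omega> \<partial>M)" for k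
    proof -
      have "(\<integral>\<omega>. indicator (\<Union>i<k. A i) \<omega> * X n \<omega> \<partial>M) = (\<Sum>i<k. \<integral>\<omega>. indicator (A i) \<omega> * X n \<omega> \<partial>M)" for n
      proof -
        have d: "disjoint_family_on A {..<k}" using union(1) by (rule disjoint_family_on_mono[rotated]) simp
        have *: "indicat_real (\<Union>i<k. A i) \<omega> = (\<Sum>i<k. indicator (A i) \<omega>)" for \<omega>
          by (rule indicator_UN_disjoint) (use d in auto)
        then show ?thesis
          unfolding * sum_distrib_right by (intro Bochner_Integration.integral_sum IX A)
      qed
      moreover have "convergent (\<lambda>n. \<Sum>i<k. \<integral>\<omega>. indicator (A i) \<omega> * X n \<omega> \<partial>M)"
        by (intro convergent_sum union)
      ultimately show ?thesis by simp
    qed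
    show ?case
    proof (rule convergent_integral_L1_limit[where s="\<lambda>k. indicator (\<Union>i<k. A i)"])
      have "(\<lambda>k. prob (\<Union>i<k. A i)) \<longlonglongrightarrow> prob (\<Union>k. \<Union>i<k. A i)"
        by (rule finite_Lim_measure_incseq) (auto simp: incseq_def intro: less_le_trans)
      moreover have "(\<Union>k. \<Union>i<k. A i) = (\<Union>i. A i)" by auto
      ultimately have "(\<lambda>k. prob (\<Union>i. A i) - prob (\<Union>i<k. A i)) \<longlonglongrightarrow> 0"
        by (auto intro!: tendsto_eq_intros)
      moreover have "(\<integral>\<omega>. \<bar>indicat_real (\<Union>i. A i) \<omega> - indicator (\<Union>i<k. A i) \<omega>\<bar> \<partial>M) = prob (\<Union>i. A i) - prob (\<Union>i<k. A i)" for k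
      proof -
        have "(\<integral>\<omega>. \<bar>indicat_real (\<Union>i. A i) \<omega> - indicator (\<Union>i<k. A i) \<omega>\<bar> \<partial>M) =
          (\<integral>\<omega>. indicat_real (\<Union>i. A i) \<omega> - indicator (\<Union>i<k. A i) \<omega> \<partial>M)"
          by (intro Bochner_Integration.integral_cong) (auto simp: indicator_def)
        also have "\<dots> = prob (\<Union>i. A i) - prob (\<Union>i<k. A i)"
          by (subst Bochner_Integration.integral_diff) (auto intro!: Ii)
        finally show ?thesis .
      qed
      ultimately show "(\<lambda>k. \<integral>\<omega>. \<bar>indicat_real (\<Union>i. A i) \<omega> - indicator (\<Union>i<k. A i) \<omega>\<bar> \<partial>M) \<longlonglongrightarrow> 0"
        by simp
    qed (use b c1 in \<open>auto intro!: Ii\<close>)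
  qed (use c in \<open>auto simp: convergent_const\<close>)
qed

text \<open>Since \<open>X n\<close> is \<open>F\<close>-measurable, an arbitrary event
  \<open>B\<close> can be replaced by its conditional probability given \<open>F\<close>, an
  integrable \<open>F\<close>-measurable weight. Thus convergence on the events of a small
  sub-algebra reaches all events of \<open>M\<close>.\<close>

lemma convergent_set_integral_all:
  fixes X :: "nat \<Rightarrow> 'a \<Rightarrow> real"
  assumes F: "subalgebra M F" and X: "\<And>n. X n \<in> borel_measurable F"
    and b: "\<And>n \<omega>. \<omega> \<in> space M \<Longrightarrow> \<bar>X n \<omega>\<bar> \<le> 1"
    and c: "\<And>A. A \<in> sets F \<Longrightarrow> convergent (\<lambda>n. \<integral>\<omega>. indicator A \<omega> * X n \<omega> \<partial>M)"
    and B: "B \<in> sets M"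
  shows "convergent (\<lambda>n. \<integral>\<omega>. indicator B \<omega> * X n \<omega> \<partial>M)"
proof -
  interpret F: finite_measure_subalgebra M F by unfold_locales (rule F)
  have XM[measurable]: "X n \<in> borel_measurable M" for n
    using X by (rule measurable_from_subalg[OF F])
  have *: "convergent (\<lambda>n. \<integral>\<omega>. Z \<omega> * X n \<omega> \<partial>M)" if "integrable (restr_to_subalg M F) Z" for Z
    using that
  proof induct
    case (base A c')
    then have "A \<in> sets F" using F by (simp add: sets_restr_to_subalg)
    then have "convergent (\<lambda>n. c' * (\<integral>\<omega>. indicator A \<omega> * X n \<omega> \<partial>M))"
      by (intro convergent_mult convergent_const c)
    moreover have "(\<integral>\<omega>. (indicator A \<omega> *\<^sub>R c') * X n \<omega> \<partial>M) = c' * (\<integral>\<omega>. indicator A \<omega> * X n \<omega> \<partial>M)" for n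
    proof -
      have "(\<integral>\<omega>. (indicator A \<omega> *\<^sub>R c') * X n \<omega> \<partial>M) = (\<integral>\<omega>. c' * (indicator A \<omega> * X n \<omega>) \<partial>M)"
        by (intro Bochner_Integration.integral_cong) (auto simp: indicator_def)
      then show ?thesis by simp
    qed
    ultimately show ?case by simp
  next
    case (add f g)
    then have I: "integrable M f" "integrable M g" using integrable_from_subalg[OF F] by auto
    have "(\<integral>\<omega>. (f \<omega> + g \<omega>) * X n \<omega> \<partial>M) = (\<integral>\<omega>. f \<omega> * X n \<omega> \<partial>M) + (\<integral>\<omega>. g \<omega> * X n \<omega> \<partial>M)" for n
      unfolding distrib_right
      using integrable_mult_bdd[OF I(1) XM b] integrable_mult_bdd[OF I(2) XM b]
      by (rule Bochner_Integration.integral_add)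
    then show ?case using add by (simp add: convergent_add)
  next
    case (lim f s)
    then have I: "integrable M f" "\<And>i. integrable M (s i)" using integrable_from_subalg[OF F] by blast+
    then have [measurable]: "f \<in> borel_measurable M" "\<And>i. s i \<in> borel_measurable M" by auto
    have sp: "space (restr_to_subalg M F) = space M" by (simp add: space_restr_to_subalg)
    have "(\<lambda>i. \<integral>\<omega>. \<bar>f \<omega> - s i \<omega>\<bar> \<partial>M) \<longlonglongrightarrow> (\<integral>\<omega>. 0 \<partial>M)"
    proof (rule integral_dominated_convergence[where w="\<lambda>\<omega>. 3 * \<bar>f \<omega>\<bar>"])
      show "integrable M (\<lambda>\<omega>. 3 * \<bar>f \<omega>\<bar>)" using I by simp
      show "AE \<omega> in M. (\<lambda>i. \<bar>f \<omega> - s i \<omega>\<bar>) \<longlonglongrightarrow> 0"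
        using lim(3) sp by (intro AE_I2 tendsto_rabs_zero) (auto intro!: tendsto_eq_intros)
      fix i
      show "AE \<omega> in M. norm \<bar>f \<omega> - s i \<omega>\<bar> \<le> 3 * \<bar>f \<omega>\<bar>"
      proof (rule AE_I2)
        fix \<omega> assume "\<omega> \<in> space M"
        with lim(4)[of \<omega> i] sp show "norm \<bar>f \<omega> - s i \<omega>\<bar> \<le> 3 * \<bar>f \<omega>\<bar>" by simp
      qed
    qed simp_all
    then show ?case using lim(2) by (intro convergent_integral_L1_limit[OF XM b I(2,1)]) auto
  qed
  have IB: "integrable M (indicat_real B)" using B by (simp add: emeasure_eq_measure)
  let ?g = "real_cond_exp M F (indicator B)"
  have "integrable (restr_to_subalg M F) ?g"
    by (rule integrable_in_subalg[OF F]) (auto intro: F.real_cond_exp_int(1) IB)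
  from *[OF this] have "convergent (\<lambda>n. \<integral>\<omega>. ?g \<omega> * X n \<omega> \<partial>M)" .
  moreover have "(\<integral>\<omega>. ?g \<omega> * X n \<omega> \<partial>M) = (\<integral>\<omega>. indicator B \<omega> * X n \<omega> \<partial>M)" for n
    using F.real_cond_exp_intg(2)[of "X n" "indicator B"] X B integrable_mult_bdd[OF IB XM b, of n]
    by (simp add: mult.commute)
  ultimately show ?thesis by simp
qed

section \<open>Weak limits as Radon-Nikodym densities\<close>

lemma AE_le_of_set_integral_le:
  fixes X Y :: "'a \<Rightarrow> real"
  assumes "integrable M X" "integrable M Y"
    and "\<And>B. B \<in> sets M \<Longrightarrow> (\<integral>\<omega>\<in>B. X \<omega> \<partial>M) \<le> (\<integral>\<omega>\<in>B. Y \<omega> \<partial>M)"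
  shows "AE \<omega> in M. X \<omega> \<le> Y \<omega>"
proof -
  have "AE \<omega> in M. 0 \<le> Y \<omega> - X \<omega>"
  proof (rule density_nonneg)
    fix B assume "B \<in> sets M"
    then have "set_integrable M B X" "set_integrable M B Y"
      using assms(1,2) unfolding set_integrable_def by (blast intro: integrable_mult_indicator)+
    then show "0 \<le> (\<integral>\<omega>\<in>B. Y \<omega> - X \<omega> \<partial>M)"
      using assms(3)[OF \<open>B \<in> sets M\<close>] by (simp add: set_integral_diff)
  qed (use assms in auto)
  then show ?thesis by simp
qed

text \<open>The limits of the integrals over \<open>B\<close> form a set function \<open>L\<close>
  with \<open>0 \<le> L B \<le> prob B\<close>. This domination gives continuity at the empty set,
  hence countable additivity, and absolute continuity; the Radon-Nikodym density of \<open>L\<close>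
  is the weak limit.\<close>

lemma weak_limit_exists:
  fixes X :: "nat \<Rightarrow> 'a \<Rightarrow> real"
  assumes X[measurable]: "\<And>n. X n \<in> borel_measurable M"
    and b: "\<And>n \<omega>. \<omega> \<in> space M \<Longrightarrow> 0 \<le> X n \<omega> \<and> X n \<omega> \<le> 1"
    and c: "\<And>B. B \<in> sets M \<Longrightarrow> convergent (\<lambda>n. \<integral>\<omega>. indicator B \<omega> * X n \<omega> \<partial>M)"
  obtains Y where "Y \<in> borel_measurable M" "\<And>\<omega>. 0 \<le> Y \<omega> \<and> Y \<omega> \<le> 1" "wk_conv M X Y"
proof -
  define L where "L B = lim (\<lambda>n. \<integral>\<omega>. indicator B \<omega> * X n \<omega> \<partial>M)" for B
  have L: "(\<lambda>n. \<integral>\<omega>. indicator B \<omega> * X n \<omega> \<partial>M) \<longlonglongrightarrow> L B" if "B \<in> sets M" for B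
    unfolding L_def using c[OF that] by (simp add: convergent_LIMSEQ_iff)
  have Ii: "integrable M (indicat_real A)" if "A \<in> sets M" for A
    using that by (simp add: emeasure_eq_measure)
  have IX: "integrable M (\<lambda>\<omega>. indicat_real A \<omega> * X n \<omega>)" if "A \<in> sets M" for A n
    using integrable_mult_bdd[OF Ii[OF that] X, of n 1] b by (simp add: abs_le_iff)
  have L0: "0 \<le> L B" if "B \<in> sets M" for B
    using L[OF that] by (rule LIMSEQ_le_const) (use b in \<open>auto intro!: Bochner_Integration.integral_nonneg\<close>)
  have L1: "L B \<le> prob B" if "B \<in> sets M" for B
    using L[OF that]
  proof (rule LIMSEQ_le_const2, intro exI allI impI)
    fix n
    have "(\<integral>\<omega>. indicator B \<omega> * X n \<omega> \<partial>M) \<le> (\<integral>\<omega>. indicator B \<omega> \<partial>M)"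
      by (intro integral_mono IX Ii that) (use b in \<open>auto simp: indicator_def\<close>)
    then show "(\<integral>\<omega>. indicator B \<omega> * X n \<omega> \<partial>M) \<le> prob B" using that by simp
  qed
  have Ladd: "L (A \<union> B) = L A + L B" if "A \<in> sets M" "B \<in> sets M" "A \<inter> B = {}" for A B
  proof (rule LIMSEQ_unique)
    show "(\<lambda>n. \<integral>\<omega>. indicator (A \<union> B) \<omega> * X n \<omega> \<partial>M) \<longlonglongrightarrow> L (A \<union> B)" using that by (intro L) auto
    have "(\<integral>\<omega>. indicator (A \<union> B) \<omega> * X n \<omega> \<partial>M) =
       (\<integral>\<omega>. indicator A \<omega> * X n \<omega> \<partial>M) + (\<integral>\<omega>. indicator B \<omega> * X n \<omega> \<partial>M)" for n
    proof -
      have "(\<integral>\<omega>. indicator (A \<union> B) \<omega> * X n \<omega> \<partial>M) = (\<integral>\<omega>. indicator A \<omega> * X n \<omega> + indicator B \<omega> * X n \<omega> \<partial>M)"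
        by (intro Bochner_Integration.integral_cong) (use that in \<open>auto simp: indicator_def\<close>)
      then show ?thesis using Bochner_Integration.integral_add[OF IX IX] that by simp
    qed
    then show "(\<lambda>n. \<integral>\<omega>. indicator (A \<union> B) \<omega> * X n \<omega> \<partial>M) \<longlonglongrightarrow> L A + L B"
      using that by (simp add: tendsto_add L)
  qed
  define N where "N = measure_of (space M) (sets M) (\<lambda>B. ennreal (L B))"
  have "countably_additive (sets M) (\<lambda>B. ennreal (L B))"
  proof (rule sets.empty_continuous_imp_countably_additive)
    have "L {} = 0" using L0[of "{}"] L1[of "{}"] by simp
    then show "positive (sets M) (\<lambda>B. ennreal (L B))" by (simp add: positive_def)
    show "additive (sets M) (\<lambda>B. ennreal (L B))"
      unfolding additive_def by (auto simp: Ladd L0 simp flip: ennreal_plus)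
    fix A :: "nat \<Rightarrow> 'a set" assume A: "range A \<subseteq> sets M" "decseq A" "(\<Inter>i. A i) = {}"
    have "(\<lambda>i. prob (A i)) \<longlonglongrightarrow> prob (\<Inter>i. A i)" using A by (intro finite_Lim_measure_decseq) auto
    then have "(\<lambda>i. prob (A i)) \<longlonglongrightarrow> 0" using A by simp
    moreover have "\<bar>L (A i)\<bar> \<le> prob (A i)" for i using L0[of "A i"] L1[of "A i"] A by auto
    ultimately have "(\<lambda>i. L (A i)) \<longlonglongrightarrow> 0"
      by (intro Lim_null_comparison[of "\<lambda>i. L (A i)" "\<lambda>i. prob (A i)"]) auto
    then show "(\<lambda>i. ennreal (L (A i))) \<longlonglongrightarrow> 0" using tendsto_ennrealI by fastforce
  qed simp
  then have N: "emeasure N B = ennreal (L B)" if "B \<in> sets M" for B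
    unfolding N_def using that L0[of "{}"] L1[of "{}"]
    by (subst emeasure_measure_of_sigma) (auto simp: positive_def sets.sigma_algebra_axioms)
  have sN[simp]: "sets N = sets M" by (simp add: N_def)
  have "absolutely_continuous M N"
    unfolding absolutely_continuous_def
  proof
    fix B assume "B \<in> null_sets M"
    then have "B \<in> sets M" "prob B = 0" by (auto simp: null_sets_def measure_eq_emeasure_eq_ennreal measure_def)
    then show "B \<in> null_sets N" using L0[of B] L1[of B] N[of B] by (simp add: null_sets_def)
  qed
  from Radon_Nikodym[OF this sN] obtain h where h[measurable]: "h \<in> borel_measurable M" and hN: "density M h = N"
    by blast
  have hB: "(\<integral>\<^sup>+\<omega>. h \<omega> * indicator B \<omega> \<partial>M) = ennreal (L B)" if "B \<in> sets M" for B
    using emeasure_density[OF h that] N[OF that] hN by simp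
  have fin: "(\<integral>\<^sup>+\<omega>. h \<omega> \<partial>M) = ennreal (L (space M))"
    using hB[of "space M"] by (simp cong: nn_integral_cong)
  have AEfin: "AE \<omega> in M. h \<omega> \<noteq> \<infinity>" by (rule nn_integral_noteq_infinite) (auto simp: fin)
  define Y0 where "Y0 \<omega> = enn2real (h \<omega>)" for \<omega>
  have [measurable]: "Y0 \<in> borel_measurable M" unfolding Y0_def by measurable
  have eq: "AE \<omega> in M. ennreal (Y0 \<omega>) = h \<omega>"
    using AEfin by eventually_elim (simp add: Y0_def less_top)
  have "(\<integral>\<^sup>+\<omega>. ennreal (Y0 \<omega>) \<partial>M) = ennreal (L (space M))"
    using eq fin by (subst nn_integral_cong_AE[of _ h]) auto
  then have IY0: "integrable M Y0"
    by (intro integrableI_bounded) (auto simp: Y0_def)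
  have Y0B: "(\<integral>\<omega>\<in>B. Y0 \<omega> \<partial>M) = L B" if B[measurable]: "B \<in> sets M" for B
  proof -
    have "(\<integral>\<omega>\<in>B. Y0 \<omega> \<partial>M) = enn2real (\<integral>\<^sup>+\<omega>. ennreal (indicator B \<omega> * Y0 \<omega>) \<partial>M)"
      unfolding set_lebesgue_integral_def real_scaleR_def
      by (rule integral_eq_nn_integral) (auto simp: Y0_def)
    also have "(\<integral>\<^sup>+\<omega>. ennreal (indicator B \<omega> * Y0 \<omega>) \<partial>M) = (\<integral>\<^sup>+\<omega>. h \<omega> * indicator B \<omega> \<partial>M)"
      by (rule nn_integral_cong_AE) (use eq in eventually_elim, auto simp: indicator_def)
    finally show ?thesis using hB[OF B] L0[OF B] by simp
  qed
  have "AE \<omega> in M. Y0 \<omega> \<le> 1"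
  proof (rule AE_le_of_set_integral_le[OF IY0])
    fix B assume "B \<in> sets M"
    then show "(\<integral>\<omega>\<in>B. Y0 \<omega> \<partial>M) \<le> (\<integral>\<omega>\<in>B. 1 \<partial>M)"
      using L1[of B] Y0B[of B] by (simp add: set_lebesgue_integral_def)
  qed simp
  \<comment> \<open>The density is at most 1 only almost everywhere; capping it makes the bound hold
    at every point.\<close>
  then have AEeq: "AE \<omega> in M. min 1 (Y0 \<omega>) = Y0 \<omega>" by eventually_elim auto
  show thesis
  proof (rule that[of "\<lambda>\<omega>. min 1 (Y0 \<omega>)"])
    show "wk_conv M X (\<lambda>\<omega>. min 1 (Y0 \<omega>))"
      unfolding wk_conv_def
    proof
      fix B assume B: "B \<in> sets M"
      have "(\<integral>\<omega>\<in>B. min 1 (Y0 \<omega>) \<partial>M) = (\<integral>\<omega>\<in>B. Y0 \<omega> \<partial>M)"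
        using AEeq B by (intro set_lebesgue_integral_cong_AE) (auto elim: eventually_mono)
      then show "(\<lambda>n. \<integral>\<omega>\<in>B. X n \<omega> \<partial>M) \<longlonglongrightarrow> (\<integral>\<omega>\<in>B. min 1 (Y0 \<omega>) \<partial>M)"
        using L[OF B] Y0B[OF B] by (simp add: set_lebesgue_integral_def)
    qed
  qed (auto simp: Y0_def)
qed

text \<open>The test sets are the finite intersections of the \<open>E j\<close>, a countable
  pi-system generating the algebra on which all \<open>X i n\<close> are measurable. Diagonal
  extraction makes the integrals over all of them converge for all families i at once, and the
  preceding lemmas extend this to every event.\<close>

lemma weak_sequential_compactness:
  fixes X :: "nat \<Rightarrow> nat \<Rightarrow> 'a \<Rightarrow> real" and E :: "nat \<Rightarrow> 'a set"
  assumes E: "range E \<subseteq> sets M"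
    and X: "\<And>i n. X i n \<in> borel_measurable (sigma (space M) (range E))"
    and C: "\<And>i. 0 < C i" and b: "\<And>i n \<omega>. \<omega> \<in> space M \<Longrightarrow> \<bar>X i n \<omega>\<bar> \<le> C i"
  obtains r Y where "strict_mono r" "\<And>i. Y i \<in> borel_measurable M" "\<And>i \<omega>. \<bar>Y i \<omega>\<bar> \<le> C i"
    "\<And>i. wk_conv M (\<lambda>n. X i (r n)) (Y i)"
proof -
  let ?F = "sigma (space M) (range E)"
  have EP: "range E \<subseteq> Pow (space M)" using E sets.space_closed by blast
  have sF: "sets ?F = sigma_sets (space M) (range E)" using EP by simp
  have F: "subalgebra M ?F"
    unfolding subalgebra_def sF using sets.sigma_sets_subset[OF E] by (simp add: space_measure_of_conv)
  \<comment> \<open>Intersecting with \<open>space M\<close> gives \<open>G {} = space M\<close>,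
    the element that the Dynkin argument asks for.\<close>
  define G where "G J = space M \<inter> (\<Inter>j\<in>J. E j)" for J
  have Gi: "G J \<inter> G K = G (J \<union> K)" for J K by (auto simp: G_def)
  have IS: "Int_stable (G ` {J. finite J})"
    unfolding Int_stable_def by (auto simp: Gi)
  have GF: "G J \<in> sigma_sets (space M) (range E)" if "finite J" for J
    using that
  proof (induct J)
    case (insert j J)
    have "G (insert j J) = G J \<inter> E j" by (auto simp: G_def)
    moreover have "E j \<in> sets ?F" unfolding sF by auto
    ultimately show ?case using insert sets.Int[of "G J" ?F "E j"] by (simp add: sF)
  qed (auto simp: G_def sigma_sets_top)
  have GE: "sigma_sets (space M) (G ` {J. finite J}) = sigma_sets (space M) (range E)"
  proof (rule sigma_sets_eqI)
    fix a assume "a \<in> range E"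
    then obtain j where j: "a = E j" by auto
    then have "a = G {j}" using EP by (auto simp: G_def)
    then show "a \<in> sigma_sets (space M) (G ` {J. finite J})" by auto
  qed (use GF in auto)
  have GM: "G ` {J. finite J} \<subseteq> sets M" using GF sets.sigma_sets_subset[OF E] by auto
  have XM[measurable]: "X i n \<in> borel_measurable M" for i n
    by (rule measurable_from_subalg[OF F X])
  \<comment> \<open>An affine rescaling to [0, 1], because the limit is built as the density of a
    positive measure.\<close>
  define U where "U i n \<omega> = (X i n \<omega> / C i + 1) / 2" for i n \<omega>
  have UF: "U i n \<in> borel_measurable ?F" for i n
    using X[of i n] unfolding U_def by measurable
  have UM[measurable]: "U i n \<in> borel_measurable M" for i n unfolding U_def by measurable
  have Ub: "0 \<le> U i n \<omega> \<and> U i n \<omega> \<le> 1" if "\<omega> \<in> space M" for i n \<omega>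
    using b[OF that, of i n] C[of i] by (auto simp: U_def field_simps abs_le_iff)
  have Ub': "\<bar>U i n \<omega>\<bar> \<le> 1" if "\<omega> \<in> space M" for i n \<omega> using Ub[OF that, of i n] by auto
  \<comment> \<open>Pairs of a family and a finite set of events are listed as one sequence; finite
    sets are represented by lists so that \<open>from_nat\<close> can decode them.\<close>
  define a where "a l n = (case from_nat l of (i, J) \<Rightarrow> \<integral>\<omega>. indicator (G (set J)) \<omega> * U i n \<omega> \<partial>M)"
    for l n
  have "\<bar>a l n\<bar> \<le> 1" for l n
  proof -
    obtain i J where l: "from_nat l = (i::nat, J::nat list)" by (cases "from_nat l :: nat \<times> nat list")
    have G1: "G (set J) \<in> sets M" using GM by auto
    have "\<bar>\<integral>\<omega>. indicator (G (set J)) \<omega> * U i n \<omega> \<partial>M\<bar> \<le> 1 * (\<integral>\<omega>. \<bar>indicator (G (set J)) \<omega>\<bar> \<partial>M)"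
      using norm_integral_scaleR_le[of "indicator (G (set J))" "U i n" 1] Ub' G1 by (simp add: emeasure_eq_measure)
    also have "\<dots> \<le> 1" using G1 by simp
    finally show ?thesis by (simp add: a_def l)
  qed
  then obtain r where r: "strict_mono r" "\<And>l. convergent (\<lambda>n. a l (r n))"
    using bounded_imp_convergent_diagonal[of a 1] by auto
  have conv: "convergent (\<lambda>n. \<integral>\<omega>. indicator B \<omega> * U i (r n) \<omega> \<partial>M)" if B: "B \<in> sets M" for B i
  proof (rule convergent_set_integral_all[OF F UF Ub' _ B])
    fix A assume "A \<in> sets ?F"
    then have "A \<in> sigma_sets (space M) (G ` {J. finite J})" by (simp only: sF GE)
    then have A: "A \<in> sigma_sets (space M) (G ` {J. finite J})" .
    have sp: "space M \<in> G ` {J. finite J}" by (auto simp: G_def intro!: image_eqI[of _ _ "{}"])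
    have cc: "convergent (\<lambda>n. \<integral>\<omega>. indicator A \<omega> * U i (r n) \<omega> \<partial>M)" if "A \<in> G ` {J. finite J}" for A
    proof -
      from that
      obtain J where "finite J" "A = G J" by auto
      then obtain J' where "A = G (set J')" using finite_list by metis
      then show "convergent (\<lambda>n. \<integral>\<omega>. indicator A \<omega> * U i (r n) \<omega> \<partial>M)"
        using r(2)[of "to_nat (i, J')"] by (simp add: a_def)
    qed
    show "convergent (\<lambda>n. \<integral>\<omega>. indicator A \<omega> * U i (r n) \<omega> \<partial>M)"
      by (rule convergent_set_integral_sigma_sets[OF UM Ub' IS GM sp cc A])
  qed
  have "\<exists>V. V \<in> borel_measurable M \<and> (\<forall>\<omega>. 0 \<le> V \<omega> \<and> V \<omega> \<le> 1) \<and> wk_conv M (\<lambda>n. U i (r n)) V" for i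
    using weak_limit_exists[of "\<lambda>n. U i (r n)", OF UM Ub conv] by metis
  then obtain V where V[measurable]: "\<And>i. V i \<in> borel_measurable M"
    and Vb: "\<And>i \<omega>. 0 \<le> V i \<omega> \<and> V i \<omega> \<le> 1" and Vw: "\<And>i. wk_conv M (\<lambda>n. U i (r n)) (V i)"
    by metis
  show thesis
  proof (rule that[of r "\<lambda>i \<omega>. (2 * V i \<omega> - 1) * C i"])
    show "\<bar>(2 * V i \<omega> - 1) * C i\<bar> \<le> C i" for i \<omega>
    proof -
      have "\<bar>2 * V i \<omega> - 1\<bar> * C i \<le> 1 * C i"
        using Vb[of i \<omega>] C[of i] by (intro mult_right_mono) auto
      then show ?thesis using C[of i] by (simp add: abs_mult)
    qed
    show "wk_conv M (\<lambda>n. X i (r n)) (\<lambda>\<omega>. (2 * V i \<omega> - 1) * C i)" for i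
      unfolding wk_conv_def
    proof
      fix B assume B[measurable]: "B \<in> sets M"
      have e: "(\<integral>\<omega>\<in>B. (2 * W \<omega> - 1) * C i \<partial>M) = 2 * C i * (\<integral>\<omega>\<in>B. W \<omega> \<partial>M) - C i * prob B"
        if [measurable]: "W \<in> borel_measurable M" and "\<And>\<omega>. \<omega> \<in> space M \<Longrightarrow> 0 \<le> W \<omega> \<and> W \<omega> \<le> 1" for W
      proof -
        have I: "integrable M (\<lambda>\<omega>. indicator B \<omega> * W \<omega>)"
          using that by (intro integrable_const_bound[where B=1]) (auto simp: indicator_def abs_le_iff)
        have "(\<integral>\<omega>\<in>B. (2 * W \<omega> - 1) * C i \<partial>M) = (\<integral>\<omega>. 2 * C i * (indicator B \<omega> * W \<omega>) - C i * indicator B \<omega> \<partial>M)"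
          unfolding set_lebesgue_integral_def by (intro Bochner_Integration.integral_cong) (auto simp: algebra_simps)
        also have "\<dots> = 2 * C i * (\<integral>\<omega>. indicator B \<omega> * W \<omega> \<partial>M) - C i * prob B"
          using I by (subst Bochner_Integration.integral_diff) (auto simp: emeasure_eq_measure)
        finally show ?thesis by (simp add: set_lebesgue_integral_def)
      qed
      have XU: "X i n = (\<lambda>\<omega>. (2 * U i n \<omega> - 1) * C i)" for n
        using C[of i] by (auto simp: U_def fun_eq_iff field_simps)
      have "(\<lambda>n. 2 * C i * (\<integral>\<omega>\<in>B. U i (r n) \<omega> \<partial>M) - C i * prob B) \<longlonglongrightarrow> 2 * C i * (\<integral>\<omega>\<in>B. V i \<omega> \<partial>M) - C i * prob B"
        by (intro tendsto_intros wk_convD[OF Vw B])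
      then show "(\<lambda>n. \<integral>\<omega>\<in>B. X i (r n) \<omega> \<partial>M) \<longlonglongrightarrow> (\<integral>\<omega>\<in>B. (2 * V i \<omega> - 1) * C i \<partial>M)"
        by (simp only: XU e[OF UM Ub] e[OF V Vb])
    qed
  qed (use r in auto)
qed

end

subsection \<open>The tail algebra\<close>

definition future_algebra :: "'a measure \<Rightarrow> (nat \<Rightarrow> 'a \<Rightarrow> real) \<Rightarrow> nat \<Rightarrow> 'a measure" where
  "future_algebra M f n = sigma (space M) (\<Union>i\<in>{n..}. sets (vimage_algebra (space M) (f i) borel))"

lemma space_future_algebra[simp]: "space (future_algebra M f n) = space M"
  by (simp add: future_algebra_def space_measure_of_conv)

lemma space_tail_algebra[simp]: "space (tail_algebra M f) = space M"
  by (simp add: tail_algebra_def space_measure_of_conv)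

lemma sets_future_algebra:
  "sets (future_algebra M f n) = sigma_sets (space M) (\<Union>i\<in>{n..}. sets (vimage_algebra (space M) (f i) borel))"
  unfolding future_algebra_def
  by (rule sets_measure_of) (use sets.space_closed[of "vimage_algebra (space M) (f _) borel"] in force)

lemma sets_vimage_algebra_subset:
  "f \<in> borel_measurable M \<Longrightarrow> sets (vimage_algebra (space M) f borel) \<subseteq> sets M"
  by (auto simp: sets_vimage_algebra2)

lemma subalgebra_future_algebra:
  assumes "\<And>n. f n \<in> borel_measurable M" shows "subalgebra M (future_algebra M f n)"
  unfolding subalgebra_def sets_future_algebra
  using sets_vimage_algebra_subset[OF assms] by (auto intro!: sets.sigma_sets_subset)

lemma measurable_future_algebra:
  assumes "n \<le> i" shows "f i \<in> borel_measurable (future_algebra M f n)"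
proof (rule measurableI)
  fix A :: "real set" assume "A \<in> sets borel"
  then have "f i -` A \<inter> space M \<in> sets (vimage_algebra (space M) (f i) borel)"
    by (auto simp: sets_vimage_algebra2)
  then show "f i -` A \<inter> space (future_algebra M f n) \<in> sets (future_algebra M f n)"
    using assms by (auto simp: sets_future_algebra)
qed simp

context prob_space
begin

text \<open>The tail events are themselves a sigma-algebra, so generating from them returns exactly
  the intersection of the future algebras.\<close>

lemma sets_tail_algebra:
  assumes "\<And>n. f n \<in> borel_measurable M"
  shows "sets (tail_algebra M f) = (\<Inter>n. sets (future_algebra M f n))"
proof -
  let ?A = "\<lambda>i. sets (vimage_algebra (space M) (f i) borel)"
  have "sigma_algebra (space M) (tail_events ?A)"
    by (rule sigma_algebra_tail_events) (use sets.sigma_algebra_axioms[of "vimage_algebra (space M) (f _) borel"] in simp)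
  then have "sets (tail_algebra M f) = tail_events ?A"
    unfolding tail_algebra_def by (rule sigma_algebra.sets_measure_of_eq)
  then show ?thesis by (simp add: tail_events_def sets_future_algebra)
qed

lemma subalgebra_tail_algebra:
  assumes "\<And>n. f n \<in> borel_measurable M" shows "subalgebra M (tail_algebra M f)"
proof -
  have "sets (future_algebra M f 0) \<subseteq> sets M"
    using subalgebra_future_algebra[where f=f and M=M and n=0, OF assms] by (simp add: subalgebra_def)
  then show ?thesis unfolding subalgebra_def sets_tail_algebra[OF assms] by auto
qed

lemma measurable_tail_algebraI:
  fixes Y :: "'a \<Rightarrow> real"
  assumes "\<And>n. f n \<in> borel_measurable M" "\<And>n. Y \<in> borel_measurable (future_algebra M f n)"
  shows "Y \<in> borel_measurable (tail_algebra M f)"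
  using assms(2) unfolding measurable_def by (auto simp: sets_tail_algebra[OF assms(1)])

text \<open>The limit agrees almost surely with its conditional expectation given every future algebra, and the
pointwise limit of these conditional expectations is tail measurable.\<close>

lemma weak_limit_tail_measurable:
  fixes X :: "nat \<Rightarrow> 'a \<Rightarrow> real"
  assumes f: "\<And>n. f n \<in> borel_measurable M"
    and X: "\<And>n. X n \<in> borel_measurable (future_algebra M f n)"
    and Y[measurable]: "Y \<in> borel_measurable M"
    and bX: "\<And>n \<omega>. \<omega> \<in> space M \<Longrightarrow> \<bar>X n \<omega>\<bar> \<le> C" and bY: "\<And>\<omega>. \<omega> \<in> space M \<Longrightarrow> \<bar>Y \<omega>\<bar> \<le> C"
    and w: "wk_conv M X Y"
  obtains Y' where "Y' \<in> borel_measurable (tail_algebra M f)" "\<And>\<omega>. \<omega> \<in> space M \<Longrightarrow> \<bar>Y' \<omega>\<bar> \<le> C"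
    "AE \<omega> in M. Y' \<omega> = Y \<omega>"
proof -
  note sub = subalgebra_future_algebra[where f=f and M=M, OF f]
  have XM[measurable]: "X n \<in> borel_measurable M" for n by (rule measurable_from_subalg[OF sub X])
  have IY: "integrable M Y" using bY by (intro integrable_const_bound[where B=C]) auto
  have IX: "integrable M (X n)" for n using bX by (intro integrable_const_bound[where B=C]) auto
  define Z where "Z m = real_cond_exp M (future_algebra M f m) Y" for m
  have eq: "AE \<omega> in M. Z m \<omega> = Y \<omega>" for m
  proof -
    interpret F: finite_measure_subalgebra M "future_algebra M f m" by unfold_locales (rule sub)
    have IZ: "integrable M (Z m)" unfolding Z_def by (rule F.real_cond_exp_int(1)[OF IY])
    show ?thesis
    proof (rule density_unique_real[OF IZ IY])
      fix B assume B[measurable]: "B \<in> sets M"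
      have IB: "integrable M (indicat_real B)" by (simp add: emeasure_eq_measure)
      let ?g = "real_cond_exp M (future_algebra M f m) (indicator B)"
      have Ig: "integrable M ?g" by (rule F.real_cond_exp_int(1)[OF IB])
      have Z_F: "Z m \<in> borel_measurable (future_algebra M f m)" unfolding Z_def by simp
      have IZB: "integrable M (\<lambda>\<omega>. Z m \<omega> * indicator B \<omega>)"
        using integrable_mult_bdd[OF IZ, of "indicator B" 1] by (simp add: indicator_def)
      have IgY: "integrable M (\<lambda>\<omega>. ?g \<omega> * Y \<omega>)" by (rule integrable_mult_bdd[OF Ig Y bY])
      \<comment> \<open>Conditional expectation is self-adjoint, so it can be moved from
        \<open>Y\<close> to the test set.\<close>
      have "(\<integral>\<omega>\<in>B. Z m \<omega> \<partial>M) = (\<integral>\<omega>. Z m \<omega> * indicator B \<omega> \<partial>M)"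
        by (simp add: set_lebesgue_integral_def mult.commute)
      also have "\<dots> = (\<integral>\<omega>. Z m \<omega> * ?g \<omega> \<partial>M)"
        by (rule F.real_cond_exp_intg(2)[symmetric, OF IZB Z_F]) simp
      also have "\<dots> = (\<integral>\<omega>. ?g \<omega> * Z m \<omega> \<partial>M)" by (simp add: mult.commute)
      also have "\<dots> = (\<integral>\<omega>. ?g \<omega> * Y \<omega> \<partial>M)"
        unfolding Z_def by (rule F.real_cond_exp_intg(2)[OF IgY]) simp_all
      finally have 1: "(\<integral>\<omega>\<in>B. Z m \<omega> \<partial>M) = (\<integral>\<omega>. ?g \<omega> * Y \<omega> \<partial>M)" .
      have 2: "(\<lambda>n. \<integral>\<omega>. ?g \<omega> * X n \<omega> \<partial>M) \<longlonglongrightarrow> (\<integral>\<omega>. ?g \<omega> * Y \<omega> \<partial>M)"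
        using wk_conv_integral[OF w Ig XM Y, of C] bX bY by simp
      \<comment> \<open>From n = m on, \<open>X n\<close> is measurable for the m-th future algebra
        and does not distinguish \<open>B\<close> from its conditional probability.\<close>
      have "(\<integral>\<omega>. ?g \<omega> * X n \<omega> \<partial>M) = (\<integral>\<omega>\<in>B. X n \<omega> \<partial>M)" if "m \<le> n" for n
      proof -
        have XF: "X n \<in> borel_measurable (future_algebra M f m)"
        proof (rule measurable_from_subalg[OF _ X[of n]])
          show "subalgebra (future_algebra M f m) (future_algebra M f n)"
            using that unfolding subalgebra_def sets_future_algebra space_future_algebra
            by (intro conjI sigma_sets_mono' UN_mono) auto
        qed
        have I: "integrable M (\<lambda>\<omega>. X n \<omega> * indicator B \<omega>)"
          using integrable_mult_bdd[OF IX, of "indicator B" 1] by (simp add: indicator_def)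
        have "(\<integral>\<omega>. ?g \<omega> * X n \<omega> \<partial>M) = (\<integral>\<omega>. X n \<omega> * ?g \<omega> \<partial>M)" by (simp add: mult.commute)
        also have "\<dots> = (\<integral>\<omega>. X n \<omega> * indicator B \<omega> \<partial>M)"
          by (rule F.real_cond_exp_intg(2)[OF I XF]) simp
        finally show ?thesis by (simp add: set_lebesgue_integral_def mult.commute)
      qed
      then have "(\<lambda>n. \<integral>\<omega>. ?g \<omega> * X n \<omega> \<partial>M) \<longlonglongrightarrow> (\<integral>\<omega>\<in>B. Y \<omega> \<partial>M)"
        by (intro Lim_transform_eventually[OF wk_convD[OF w B]] eventually_sequentiallyI[of m]) simp
      from LIMSEQ_unique[OF 2 this] 1 show "(\<integral>\<omega>\<in>B. Z m \<omega> \<partial>M) = (\<integral>\<omega>\<in>B. Y \<omega> \<partial>M)" by simp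
    qed
  qed
  \<comment> \<open>\<open>lim\<close> is an arbitrary value where the sequence diverges; the clamp
    keeps the bound \<open>C\<close> at every point.\<close>
  define Y' where "Y' \<omega> = max (- C) (min C (lim (\<lambda>m. Z m \<omega>)))" for \<omega>
  have C: "0 \<le> C" using bY not_empty by (meson abs_ge_zero all_not_in_conv order_trans)
  show thesis
  proof (rule that[of Y'])
    show "Y' \<in> borel_measurable (tail_algebra M f)"
    proof (rule measurable_tail_algebraI[OF f])
      fix n
      have [measurable]: "Z (m + n) \<in> borel_measurable (future_algebra M f n)" for m
      proof (rule measurable_from_subalg)
        show "subalgebra (future_algebra M f n) (future_algebra M f (m + n))"
          unfolding subalgebra_def sets_future_algebra space_future_algebra by (intro conjI sigma_sets_mono' UN_mono) auto
      qed (simp add: Z_def)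
      \<comment> \<open>Dropping the first n terms leaves the set of limits unchanged, so the
        equation holds also where the sequence diverges.\<close>
      have "lim (\<lambda>m. Z m \<omega>) = lim (\<lambda>m. Z (m + n) \<omega>)" for \<omega>
      proof -
        have "(\<lambda>m. Z m \<omega>) \<longlonglongrightarrow> L \<longleftrightarrow> (\<lambda>m. Z (m + n) \<omega>) \<longlonglongrightarrow> L" for L
          by (rule iffI[OF LIMSEQ_ignore_initial_segment[of "\<lambda>m. Z m \<omega>" L n] LIMSEQ_offset[of "\<lambda>m. Z m \<omega>" n L]])
        then show ?thesis unfolding lim_def by simp
      qed
      then have "Y' = (\<lambda>\<omega>. max (- C) (min C (lim (\<lambda>m. Z (m + n) \<omega>))))"
        unfolding Y'_def by presburger
      also have "\<dots> \<in> borel_measurable (future_algebra M f n)" by measurable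
      finally show "Y' \<in> borel_measurable (future_algebra M f n)" .
    qed
    show "\<bar>Y' \<omega>\<bar> \<le> C" for \<omega> using C by (auto simp: Y'_def)
    have "AE \<omega> in M. \<forall>m. Z m \<omega> = Y \<omega>" using eq by (simp add: AE_all_countable)
    then show "AE \<omega> in M. Y' \<omega> = Y \<omega>"
      using AE_space
    proof eventually_elim
      case (elim \<omega>)
      with bY[of \<omega>] show ?case by (auto simp: Y'_def)
    qed
  qed
qed

text \<open>All \<open>f i\<close>, and hence all functions of them, are measurable for the
  sigma-algebra generated by the countably many events \<open>f i \<le> q\<close> with q rational;
  this is the countably generated algebra that compactness asks for.\<close>

lemma weak_sequential_compactness_functions:
  fixes f :: "nat \<Rightarrow> 'a \<Rightarrow> real" and u :: "nat \<Rightarrow> real \<Rightarrow> real"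
  assumes f[measurable]: "\<And>n. f n \<in> borel_measurable M"
    and u[measurable]: "\<And>i. u i \<in> borel_measurable borel"
    and C: "\<And>i. 0 < C i" and b: "\<And>i x. \<bar>u i x\<bar> \<le> C i"
  obtains r Y where "strict_mono r" "\<And>i. Y i \<in> borel_measurable M" "\<And>i \<omega>. \<bar>Y i \<omega>\<bar> \<le> C i"
    "\<And>i. wk_conv M (\<lambda>n \<omega>. u i (f (r n) \<omega>)) (Y i)"
proof -
  define E where "E j = (case from_nat j of (i::nat, q) \<Rightarrow> {\<omega>\<in>space M. f i \<omega> \<le> real_of_rat q})" for j
  have E: "range E \<subseteq> sets M"
    by (auto simp: E_def split: prod.split)
  have EP: "range E \<subseteq> Pow (space M)" using E sets.space_closed by blast
  let ?F = "sigma (space M) (range E)"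
  have fF: "f i \<in> borel_measurable ?F" for i
  proof (rule borel_measurableI_le)
    fix a :: real
    have "{\<omega> \<in> space ?F. f i \<omega> \<le> a} = space ?F \<inter> (\<Inter>q\<in>{q. a \<le> real_of_rat q}. E (to_nat (i, q)))" (is "?L = ?R")
    proof
      show "?L \<subseteq> ?R" using EP by (auto simp: E_def space_measure_of_conv)
      show "?R \<subseteq> ?L"
      proof
        fix \<omega> assume R: "\<omega> \<in> ?R"
        have "f i \<omega> \<le> a"
        proof (rule ccontr)
          assume "\<not> f i \<omega> \<le> a"
          then obtain q where q: "a < real_of_rat q" "real_of_rat q < f i \<omega>"
            using of_rat_dense[of a "f i \<omega>"] by auto
          then have "\<omega> \<in> E (to_nat (i, q))" using R by auto
          then show False using q by (simp add: E_def)
        qed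
        then show "\<omega> \<in> ?L" using R by simp
      qed
    qed
    also have "\<dots> \<in> sets ?F"
    proof (intro sets.Int sets.top sets.countable_INT')
      obtain q where "a < real_of_rat q" using of_rat_dense[of a "a + 1"] by auto
      then show "{q. a \<le> real_of_rat q} \<noteq> {}" by (auto intro!: exI[of _ q])
      show "(\<lambda>q. E (to_nat (i, q))) ` {q. a \<le> real_of_rat q} \<subseteq> sets ?F" using EP by auto
    qed auto
    finally show "{\<omega> \<in> space ?F. f i \<omega> \<le> a} \<in> sets ?F" .
  qed
  have X: "(\<lambda>\<omega>. u i (f n \<omega>)) \<in> borel_measurable ?F" for i n
    by (rule measurable_compose[OF fF u])
  obtain r Y where rY: "strict_mono r" "\<And>i. Y i \<in> borel_measurable M" "\<And>i \<omega>. \<bar>Y i \<omega>\<bar> \<le> C i"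
    "\<And>i. wk_conv M (\<lambda>n \<omega>. u i (f (r n) \<omega>)) (Y i)"
    using weak_sequential_compactness[of E "\<lambda>i n \<omega>. u i (f n \<omega>)" C, OF E X C b] by metis
  show thesis by (rule that[OF rY])
qed

end

subsection \<open>Random measures and stable convergence\<close>

lemma dense_real_between:
  fixes D :: "real set"
  assumes "closure D = UNIV" "a < b" obtains d where "d \<in> D" "a < d" "d < b"
proof -
  have "{a<..<b} \<inter> closure D \<noteq> {}" using assms by auto
  then have "{a<..<b} \<inter> D \<noteq> {}" using open_Int_closure_eq_empty[of "{a<..<b}" D] by simp
  with that show ?thesis by auto
qed

lemma real_distribution_of_distribution_function:
  assumes "distribution_function F"
  shows "real_distribution (interval_measure F)" "cdf (interval_measure F) = F"
  using assms unfolding distribution_function_def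
  by (auto intro!: real_distribution_interval_measure cdf_interval_measure dest: monoD)

lemma distribution_function_indicator: "distribution_function (indicator {0::real..})"
proof -
  have "real_distribution (return borel (0::real))"
    by (intro real_distribution.intro prob_space_return real_distribution_axioms.intro) auto
  then interpret real_distribution "return borel (0::real)" .
  have "cdf (return borel (0::real)) = indicator {0..}"
    by (auto simp: cdf_def measure_return indicator_def fun_eq_iff)
  then show ?thesis
    using cdf_nondecreasing cdf_is_right_cont cdf_lim_at_bot cdf_lim_at_top_prob
    unfolding distribution_function_def by (auto intro: monoI)
qed

text \<open>\<open>P \<bind> K\<close> is the mixture of the measures \<open>K \<omega>\<close>; it
  is the limit law when weak convergence is tested on a single event.\<close>

lemma integral_bind_bounded:
  fixes u :: "real \<Rightarrow> real"
  assumes P: "prob_space P" and K[measurable]: "K \<in> measurable P (subprob_algebra borel)"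
    and u[measurable]: "u \<in> borel_measurable borel" and b: "\<And>x. \<bar>u x\<bar> \<le> C"
  shows "(\<integral>x. u x \<partial>(P \<bind> K)) = (\<integral>\<omega>. \<integral>x. u x \<partial>K \<omega> \<partial>P)"
proof -
  interpret P: prob_space P by fact
  have ne: "space P \<noteq> {}" by (rule P.not_empty)
  have "(\<integral>x. u x \<partial>(P \<bind> K)) = (\<integral>x. u x \<partial>join (distr P (subprob_algebra borel) K))"
    by (subst bind_nonempty''[OF K ne]) simp
  also have "\<dots> = (\<integral>M'. \<integral>x. u x \<partial>M' \<partial>distr P (subprob_algebra borel) K)"
  proof (rule integral_join[where B=C and B'=1])
    show "finite_measure (distr P (subprob_algebra borel) K)" by (intro P.finite_measure_distr) simp
    show "AE M' in distr P (subprob_algebra borel) K. emeasure M' (space M') \<le> ennreal 1"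
    proof (rule AE_I2)
      fix M' assume "M' \<in> space (distr P (subprob_algebra (borel::real measure)) K)"
      then have "subprob_space M'" by (simp add: space_subprob_algebra)
      then show "emeasure M' (space M') \<le> ennreal 1" by (simp add: subprob_space.emeasure_space_le_1)
    qed
  qed (use b in auto)
  also have "\<dots> = (\<integral>\<omega>. \<integral>x. u x \<partial>K \<omega> \<partial>P)"
    by (subst integral_distr) auto
  finally show ?thesis .
qed

context prob_space
begin

lemma integral_uniform_measure_eq:
  fixes u :: "'a \<Rightarrow> real"
  assumes B[measurable]: "B \<in> sets M" and u[measurable]: "u \<in> borel_measurable M"
  shows "(\<integral>\<omega>. u \<omega> \<partial>uniform_measure M B) = (\<integral>\<omega>\<in>B. u \<omega> \<partial>M) / prob B"
proof (cases "prob B = 0")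
  case True
  \<comment> \<open>For a null event the density of \<open>uniform_measure\<close> is infinite on
    \<open>B\<close> and 0 elsewhere, so the measure vanishes; the right-hand side is a division by
    0, that is 0.\<close>
  then have "emeasure M B = 0" by (simp add: emeasure_eq_measure)
  then have "uniform_measure M B = density M (\<lambda>x. indicator B x * \<infinity>)"
    by (simp add: uniform_measure_def divide_ennreal_def)
  moreover have "density M (\<lambda>x. indicator B x * \<infinity>) = density M (\<lambda>x. 0)"
    using True by (intro density_cong) (auto simp: indicator_def emeasure_eq_measure AE_iff_measurable[OF B] intro!: AE_I'[of B])
  ultimately show ?thesis using True by (simp add: integral_density[where g="\<lambda>x. 0", simplified])
next
  case False
  then have p: "0 < prob B" using measure_nonneg[of M B] by linarith
  have "indicator B x / emeasure M B = ennreal (indicator B x / prob B)" for x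
    using p by (auto simp: indicator_def emeasure_eq_measure ennreal_1[symmetric] divide_ennreal simp del: ennreal_1)
  then have "uniform_measure M B = density M (\<lambda>x. ennreal (indicator B x / prob B))"
    by (simp add: uniform_measure_def)
  then have "(\<integral>\<omega>. u \<omega> \<partial>uniform_measure M B) = (\<integral>\<omega>. (indicator B \<omega> / prob B) *\<^sub>R u \<omega> \<partial>M)"
    using p by (simp add: integral_density)
  also have "\<dots> = (\<integral>\<omega>. (indicator B \<omega> *\<^sub>R u \<omega>) / prob B \<partial>M)"
    by (intro Bochner_Integration.integral_cong) auto
  finally show ?thesis by (simp add: set_lebesgue_integral_def)
qed

text \<open>On the exceptional null set, where \<open>random_measure\<close> is arbitrary, the kernel is the point mass at 0.\<close>

lemma kernel_of_distribution_functions: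
  assumes H[measurable]: "\<And>x. H x \<in> borel_measurable M"
    and ae: "AE \<omega> in M. distribution_function (\<lambda>x. H x \<omega>)"
  obtains K where "K \<in> measurable M (subprob_algebra borel)"
    "\<And>\<omega>. \<omega> \<in> space M \<Longrightarrow> real_distribution (K \<omega>)"
    "AE \<omega> in M. K \<omega> = random_measure H \<omega> \<and> (\<forall>x. measure (K \<omega>) {..x} = H x \<omega>)"
proof -
  from ae obtain S where S: "S \<in> null_sets M" "{\<omega>\<in>space M. \<not> distribution_function (\<lambda>x. H x \<omega>)} \<subseteq> S"
    by (auto elim!: AE_E simp: null_sets_def)
  then have [measurable]: "S \<in> sets M" by auto
  define G where "G \<omega> = (\<lambda>x. if \<omega> \<in> S then indicator {0..} x else H x \<omega>)" for \<omega>
  have G: "distribution_function (G \<omega>)" if "\<omega> \<in> space M" for \<omega>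
    using S that distribution_function_indicator by (cases "\<omega> \<in> S") (auto simp: G_def)
  note R = real_distribution_of_distribution_function[OF G]
  have meas: "measure (interval_measure (G \<omega>)) {..x} = G \<omega> x" if "\<omega> \<in> space M" for x \<omega>
    using R(2)[OF that] by (simp add: cdf_def fun_eq_iff)
  define K where "K \<omega> = interval_measure (G \<omega>)" for \<omega>
  show thesis
  proof (rule that[of K])
    \<comment> \<open>Measurability is checked on the half-lines, an intersection-stable generator
      on which \<open>K\<close> is given by the distribution functions.\<close>
    show "K \<in> measurable M (subprob_algebra borel)"
    proof (rule measurable_subprob_algebra_generated[where \<Omega>=UNIV and G="range (\<lambda>a::real. {..a})"])
      show "sets borel = sigma_sets UNIV (range (\<lambda>a::real. {..a}))"
        unfolding borel_eq_atMost by simp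
      show "Int_stable (range (\<lambda>a::real. {..a}))"
        by (auto simp: Int_stable_def)
      fix \<omega> assume w: "\<omega> \<in> space M"
      interpret K: real_distribution "K \<omega>" unfolding K_def by (rule R(1)[OF w])
      show "subprob_space (K \<omega>)" by (rule K.subprob_space_axioms)
    next
      have "(\<lambda>\<omega>. emeasure (K \<omega>) UNIV) \<in> borel_measurable M \<longleftrightarrow> (\<lambda>\<omega>. 1 :: ennreal) \<in> borel_measurable M"
      proof (rule measurable_cong)
        fix \<omega> assume w: "\<omega> \<in> space M"
        interpret K: real_distribution "K \<omega>" unfolding K_def by (rule R(1)[OF w])
        show "emeasure (K \<omega>) UNIV = 1" using K.emeasure_space_1 by simp
      qed
      then show "(\<lambda>\<omega>. emeasure (K \<omega>) UNIV) \<in> borel_measurable M" by simp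
    next
      fix A assume "A \<in> range (\<lambda>a::real. {..a})"
      then obtain a where A: "A = {..a}" by auto
      have "(\<lambda>\<omega>. emeasure (K \<omega>) A) \<in> borel_measurable M \<longleftrightarrow> (\<lambda>\<omega>. ennreal (G \<omega> a)) \<in> borel_measurable M"
      proof (rule measurable_cong)
        fix \<omega> assume w: "\<omega> \<in> space M"
        interpret K: real_distribution "K \<omega>" unfolding K_def by (rule R(1)[OF w])
        show "emeasure (K \<omega>) A = ennreal (G \<omega> a)"
          using meas[OF w] by (simp add: A K.emeasure_eq_measure) (simp add: K_def)
      qed
      moreover have "(\<lambda>\<omega>. ennreal (G \<omega> a)) \<in> borel_measurable M" unfolding G_def by measurable
      ultimately show "(\<lambda>\<omega>. emeasure (K \<omega>) A) \<in> borel_measurable M" by simp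
    qed (auto simp: K_def)
    show "real_distribution (K \<omega>)" if "\<omega> \<in> space M" for \<omega> using R(1)[OF that] by (simp add: K_def)
    show "AE \<omega> in M. K \<omega> = random_measure H \<omega> \<and> (\<forall>x. measure (K \<omega>) {..x} = H x \<omega>)"
      using AE_not_in[OF S(1)] AE_space
      by eventually_elim (auto simp: K_def random_measure_def meas, auto simp: G_def)
  qed
qed

text \<open>Conditioning on an event \<open>B\<close> turns stable convergence into ordinary weak
  convergence: under \<open>P\<close> the laws of \<open>f (k n)\<close> converge to the mixture of
  the \<open>K \<omega>\<close>. Multiplying by \<open>prob B\<close> at the end recovers the
  integrals over \<open>B\<close>.\<close>

lemma wk_conv_kernel_real:
  fixes u :: "real \<Rightarrow> real"
  assumes f[measurable]: "\<And>n. f n \<in> borel_measurable M"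
    and det: "determining_with M f k D H" and K[measurable]: "K \<in> measurable M (subprob_algebra borel)"
    and RK: "\<And>\<omega>. \<omega> \<in> space M \<Longrightarrow> real_distribution (K \<omega>)"
    and KH: "AE \<omega> in M. \<forall>x. measure (K \<omega>) {..x} = H x \<omega>"
    and u: "\<And>x. isCont u x" and b: "\<And>x. \<bar>u x\<bar> \<le> C"
  shows "wk_conv M (\<lambda>n \<omega>. u (f (k n) \<omega>)) (\<lambda>\<omega>. \<integral>x. u x \<partial>K \<omega>)"
  unfolding wk_conv_def
proof
  have u_m[measurable]: "u \<in> borel_measurable borel"
    using u by (intro borel_measurable_continuous_onI continuous_at_imp_continuous_on) auto
  have H[measurable]: "\<And>x. H x \<in> borel_measurable M" and Dc: "closure D = UNIV"
    and conv: "\<And>B x. B \<in> sets M \<Longrightarrow> x \<in> D \<Longrightarrow>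
        (\<lambda>n. prob ({\<omega>\<in>space M. f (k n) \<omega> \<le> x} \<inter> B)) \<longlonglongrightarrow> (\<integral>\<omega>\<in>B. H x \<omega> \<partial>M)"
    using det by (auto simp: determining_with_def)
  fix B assume B[measurable]: "B \<in> sets M"
  show "(\<lambda>n. \<integral>\<omega>\<in>B. u (f (k n) \<omega>) \<partial>M) \<longlonglongrightarrow> (\<integral>\<omega>\<in>B. (\<integral>x. u x \<partial>K \<omega>) \<partial>M)"
  proof (cases "prob B = 0")
    case True
    then have "AE \<omega> in M. \<omega> \<notin> B" by (intro AE_not_in) (simp add: null_sets_def emeasure_eq_measure)
    then have z: "(\<integral>\<omega>\<in>B. W \<omega> \<partial>M) = 0" for W :: "'a \<Rightarrow> real"
      unfolding set_lebesgue_integral_def by (intro integral_eq_zero_AE) (auto elim: eventually_mono)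
    show ?thesis by (simp add: z)
  next
    case False
    then have p: "0 < prob B" using measure_nonneg[of M B] by linarith
    define P where "P = uniform_measure M B"
    have [measurable_cong, simp]: "sets P = sets M" and [simp]: "space P = space M" by (auto simp: P_def)
    interpret P: prob_space P
      unfolding P_def using p by (intro prob_space_uniform_measure) (auto simp: emeasure_eq_measure)
    have KP: "K \<in> measurable P (subprob_algebra borel)" by measurable
    have PI: "(\<integral>\<omega>. W \<omega> \<partial>P) = (\<integral>\<omega>\<in>B. W \<omega> \<partial>M) / prob B" if "W \<in> borel_measurable M" for W :: "'a \<Rightarrow> real"
      unfolding P_def by (rule integral_uniform_measure_eq[OF B that])
    define \<mu> where "\<mu> n = distr P borel (f (k n))" for n
    define \<nu> where "\<nu> = P \<bind> K"
    have R\<mu>: "real_distribution (\<mu> n)" for n unfolding \<mu>_def by (rule P.real_distribution_distr) measurable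
    have s\<nu>: "sets \<nu> = sets borel" unfolding \<nu>_def by (rule sets_bind[OF _ P.not_empty]) (use sets_kernel[OF KP] in auto)
    have R\<nu>: "real_distribution \<nu>"
    proof (intro real_distribution.intro real_distribution_axioms.intro s\<nu> prob_spaceI)
      have "space \<nu> = UNIV" using sets_eq_imp_space_eq[OF s\<nu>] by simp
      then have "emeasure \<nu> (space \<nu>) = (\<integral>\<^sup>+\<omega>. emeasure (K \<omega>) UNIV \<partial>P)"
        unfolding \<nu>_def using emeasure_bind[OF P.not_empty KP, of UNIV] by simp
      also have "\<dots> = (\<integral>\<^sup>+\<omega>. 1 \<partial>P)"
      proof (rule nn_integral_cong)
        fix \<omega> assume "\<omega> \<in> space P"
        then interpret K: real_distribution "K \<omega>" using RK by simp
        show "emeasure (K \<omega>) UNIV = 1" using K.emeasure_space_1 by simp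
      qed
      also have "\<dots> = 1" using P.emeasure_space_1 by simp
      finally show "emeasure \<nu> (space \<nu>) = 1" .
    qed
    interpret R\<nu>: real_distribution \<nu> by fact
    have cdf\<mu>: "cdf (\<mu> n) x = prob ({\<omega>\<in>space M. f (k n) \<omega> \<le> x} \<inter> B) / prob B" for n x
    proof -
      have "cdf (\<mu> n) x = P.prob {\<omega>\<in>space M. f (k n) \<omega> \<le> x}"
        unfolding cdf_def \<mu>_def by (subst measure_distr) (auto intro!: arg_cong[where f="measure P"])
      also have "\<dots> = prob (B \<inter> {\<omega>\<in>space M. f (k n) \<omega> \<le> x}) / prob B"
        unfolding P_def using p by (intro measure_uniform_measure) (auto simp: emeasure_eq_measure)
      finally show ?thesis by (simp add: Int_commute)
    qed
    have cdf\<nu>: "cdf \<nu> x = (\<integral>\<omega>\<in>B. H x \<omega> \<partial>M) / prob B" for x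
    proof -
      have "cdf \<nu> x = (\<integral>y. indicator {..x} y \<partial>\<nu>)" by (simp add: cdf_def)
      also have "\<dots> = (\<integral>\<omega>. \<integral>y. indicator {..x} y \<partial>K \<omega> \<partial>P)"
        unfolding \<nu>_def by (rule integral_bind_bounded[OF P.prob_space_axioms KP, of _ 1]) (auto simp: indicator_def)
      also have "\<dots> = (\<integral>\<omega>\<in>B. (\<integral>y. indicator {..x} y \<partial>K \<omega>) \<partial>M) / prob B" by (rule PI) measurable
      also have "(\<integral>\<omega>\<in>B. (\<integral>y. indicator {..x} y \<partial>K \<omega>) \<partial>M) = (\<integral>\<omega>\<in>B. H x \<omega> \<partial>M)"
      proof (rule set_lebesgue_integral_cong_AE)
        show "AE \<omega>\<in>B in M. (\<integral>y. indicator {..x} y \<partial>K \<omega>) = H x \<omega>"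
          using KH AE_space
        proof eventually_elim
          case (elim \<omega>)
          then interpret K: real_distribution "K \<omega>" using RK by simp
          show ?case using elim by simp
        qed
      qed measurable
      finally show ?thesis .
    qed
    have "weak_conv_m \<mu> \<nu>"
      unfolding weak_conv_m_def weak_conv_def
    proof (intro allI impI)
      fix x assume cont: "isCont (cdf \<nu>) x"
      have dconv: "(\<lambda>n. cdf (\<mu> n) d) \<longlonglongrightarrow> cdf \<nu> d" if "d \<in> D" for d
        unfolding cdf\<mu> cdf\<nu> by (intro tendsto_divide tendsto_const conv B that) (use p in auto)
      \<comment> \<open>Convergence is known on the dense set \<open>D\<close> only; a continuity
        point x is squeezed between two points of \<open>D\<close> where the limit distribution
        function is within e / 2 of its value at x.\<close>
      show "(\<lambda>n. cdf (\<mu> n) x) \<longlonglongrightarrow> cdf \<nu> x"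
      proof (rule tendstoI)
        fix e :: real assume e: "0 < e"
        then have "0 < e / 2" by simp
        with cont obtain \<delta> where \<delta>: "0 < \<delta>" "\<And>y. \<bar>y - x\<bar> < \<delta> \<Longrightarrow> \<bar>cdf \<nu> y - cdf \<nu> x\<bar> < e / 2"
          unfolding continuous_at_eps_delta dist_real_def by blast
        obtain d1 where d1: "d1 \<in> D" "x - \<delta> < d1" "d1 < x" using dense_real_between[OF Dc, of "x - \<delta>" x] \<delta> by auto
        obtain d2 where d2: "d2 \<in> D" "x < d2" "d2 < x + \<delta>" using dense_real_between[OF Dc, of x "x + \<delta>"] \<delta> by auto
        have "cdf \<nu> x - e / 2 < cdf \<nu> d1" "cdf \<nu> d2 < cdf \<nu> x + e / 2"
          using \<delta>(2)[of d1] \<delta>(2)[of d2] d1 d2 unfolding abs_less_iff by linarith+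
        note ev = order_tendstoD(1)[OF dconv[OF d1(1)] this(1)] order_tendstoD(2)[OF dconv[OF d2(1)] this(2)]
        show "\<forall>\<^sub>F n in sequentially. dist (cdf (\<mu> n) x) (cdf \<nu> x) < e"
          using ev
        proof eventually_elim
          case (elim n)
          interpret r: real_distribution "\<mu> n" by (rule R\<mu>)
          have "cdf (\<mu> n) d1 \<le> cdf (\<mu> n) x" "cdf (\<mu> n) x \<le> cdf (\<mu> n) d2"
            using d1 d2 by (auto intro: r.cdf_nondecreasing)
          with elim e show ?case unfolding dist_real_def by linarith
        qed
      qed
    qed
    from weak_conv_imp_integral_bdd_continuous_conv[OF R\<mu> R\<nu> this u, of C] b
    have "(\<lambda>n. \<integral>x. u x \<partial>\<mu> n) \<longlonglongrightarrow> (\<integral>x. u x \<partial>\<nu>)" by simp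
    moreover have "(\<integral>x. u x \<partial>\<mu> n) = (\<integral>\<omega>\<in>B. u (f (k n) \<omega>) \<partial>M) / prob B" for n
      unfolding \<mu>_def by (subst integral_distr) (auto intro!: PI)
    moreover have "(\<integral>x. u x \<partial>\<nu>) = (\<integral>\<omega>\<in>B. (\<integral>x. u x \<partial>K \<omega>) \<partial>M) / prob B"
      unfolding \<nu>_def by (subst integral_bind_bounded[OF P.prob_space_axioms KP u_m b]) (intro PI, measurable)
    ultimately have "(\<lambda>n. (\<integral>\<omega>\<in>B. u (f (k n) \<omega>) \<partial>M) / prob B * prob B) \<longlonglongrightarrow> (\<integral>\<omega>\<in>B. (\<integral>x. u x \<partial>K \<omega>) \<partial>M) / prob B * prob B"
      by (intro tendsto_mult tendsto_const) simp
    then show ?thesis using p by simp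
  qed
qed

lemma wk_conv_complexI:
  fixes X :: "nat \<Rightarrow> 'a \<Rightarrow> complex"
  assumes "\<And>n. integrable M (X n)" "integrable M Y"
    and "wk_conv M (\<lambda>n \<omega>. Re (X n \<omega>)) (\<lambda>\<omega>. Re (Y \<omega>))" "wk_conv M (\<lambda>n \<omega>. Im (X n \<omega>)) (\<lambda>\<omega>. Im (Y \<omega>))"
  shows "wk_conv M X Y"
  unfolding wk_conv_def
proof
  fix B assume B: "B \<in> sets M"
  have e: "Re (\<integral>\<omega>\<in>B. W \<omega> \<partial>M) = (\<integral>\<omega>\<in>B. Re (W \<omega>) \<partial>M)" "Im (\<integral>\<omega>\<in>B. W \<omega> \<partial>M) = (\<integral>\<omega>\<in>B. Im (W \<omega>) \<partial>M)"
    if "integrable M W" for W :: "'a \<Rightarrow> complex"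
    using integral_Re[OF integrable_mult_indicator[OF B that]] integral_Im[OF integrable_mult_indicator[OF B that]]
    by (simp_all add: set_lebesgue_integral_def)
  show "(\<lambda>n. \<integral>\<omega>\<in>B. X n \<omega> \<partial>M) \<longlonglongrightarrow> (\<integral>\<omega>\<in>B. Y \<omega> \<partial>M)"
    unfolding tendsto_complex_iff e[OF assms(1)] e[OF assms(2)]
    using wk_convD[OF assms(3) B] wk_convD[OF assms(4) B] by simp
qed

end

subsection \<open>Tight sequences have determining subsequences\<close>

lemma tendsto_at_bot_of_INF:
  fixes F :: "real \<Rightarrow> real"
  assumes m: "mono F" and n: "\<And>x. 0 \<le> F x" and I: "(INF n::nat. F (- real n)) = 0"
  shows "(F \<longlongrightarrow> 0) at_bot"
proof (rule tendstoI)
  fix e :: real assume "0 < e"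
  then have "(INF n::nat. F (- real n)) < e" using I by simp
  then obtain k :: nat where k: "F (- real k) < e"
    using n by (subst (asm) cINF_less_iff) (auto intro!: bdd_belowI[of _ 0])
  show "\<forall>\<^sub>F x in at_bot. dist (F x) 0 < e"
    unfolding eventually_at_bot_linorder
    using k n monoD[OF m] by (intro exI[of _ "- real k"]) (auto simp: dist_real_def intro: le_less_trans)
qed

text \<open>A monotone function has countably many discontinuities while intervals are uncountable,
  so a continuity point can be chosen between any two rationals.\<close>

lemma countable_dense_continuity_points:
  fixes F :: "real \<Rightarrow> real"
  assumes "mono F" obtains D where "countable D" "closure D = UNIV" "\<And>x. x \<in> D \<Longrightarrow> isCont F x"
proof -
  have ex: "\<exists>x. p < x \<and> x < q \<and> isCont F x" if "p < q" for p q :: real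
  proof (rule ccontr)
    assume "\<not> ?thesis"
    then have "{p<..<q} \<subseteq> {x. \<not> isCont F x}" by auto
    then have "countable {p<..<q}" using mono_ctble_discont[OF assms] countable_subset by blast
    then show False using uncountable_open_interval[of p q] that by simp
  qed
  define c where "c p q = (SOME x. p < x \<and> x < q \<and> isCont F x)" for p q :: real
  have c: "p < c p q" "c p q < q" "isCont F (c p q)" if "p < q" for p q
    using someI_ex[OF ex[OF that]] unfolding c_def by auto
  define D where "D = (\<lambda>(p, q). c (of_rat p) (of_rat q)) ` {(p, q). p < q}"
  show thesis
  proof (rule that[of D])
    show "countable D" unfolding D_def by (intro countable_image) auto
    show "isCont F x" if "x \<in> D" for x using that c(3) by (auto simp: D_def of_rat_less)
    have "x \<in> closure D" for x
      unfolding closure_approachable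
    proof (intro allI impI)
      fix e :: real assume e: "0 < e"
      obtain p where p: "x - e < of_rat p" "of_rat p < x" using of_rat_dense[of "x - e" x] e by auto
      obtain q where q: "x < of_rat q" "of_rat q < x + e" using of_rat_dense[of x "x + e"] e by auto
      have pq: "real_of_rat p < of_rat q" using p q by simp
      then have "c (of_rat p) (of_rat q) \<in> D" by (auto simp: D_def of_rat_less)
      moreover have "dist (c (of_rat p) (of_rat q)) x < e"
        using c(1,2)[OF pq] p q by (auto simp: dist_real_def abs_less_iff)
      ultimately show "\<exists>y\<in>D. dist y x < e" by blast
    qed
    then show "closure D = UNIV" by auto
  qed
qed

context prob_space
begin

text \<open>Helly's selection theorem for random distribution functions. Weak limits
  \<open>h q\<close> of the indicators of \<open>f \<le> q\<close> at rational q take the place of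
  pointwise limits; right-continuous regularization turns them into distribution functions, and
  tightness prevents mass from escaping to infinity.\<close>

lemma tight_imp_determining:
  fixes f :: "nat \<Rightarrow> 'a \<Rightarrow> real"
  assumes f[measurable]: "\<And>n. f n \<in> borel_measurable M"
    and tight: "\<And>\<epsilon>. 0 < \<epsilon> \<Longrightarrow> \<exists>L. \<forall>n. prob {\<omega>\<in>space M. L < \<bar>f n \<omega>\<bar>} \<le> \<epsilon>"
  obtains r D H where "strict_mono r" "determining_with M f r D H"
proof -
  define u :: "nat \<Rightarrow> real \<Rightarrow> real" where "u i = indicator {..of_rat (from_nat i)}" for i
  obtain r Y where r: "strict_mono r" and Y[measurable]: "\<And>i. Y i \<in> borel_measurable M"
    and Yb: "\<And>i \<omega>. \<bar>Y i \<omega>\<bar> \<le> 1" and Yw: "\<And>i. wk_conv M (\<lambda>n \<omega>. u i (f (r n) \<omega>)) (Y i)"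
  proof -
    have "u i \<in> borel_measurable borel" "\<bar>u i x\<bar> \<le> 1" for i x by (auto simp: u_def indicator_def)
    from weak_sequential_compactness_functions[where f=f and u=u and C="\<lambda>_. 1", OF f this(1) _ this(2)]
    show thesis using that by (metis zero_less_one)
  qed
  define h where "h q = Y (to_nat q)" for q :: rat
  have [measurable]: "h q \<in> borel_measurable M" for q by (simp add: h_def)
  have Ih: "integrable M (h q)" for q
    unfolding h_def using Yb by (intro integrable_const_bound[where B=1]) auto
  have hlim: "(\<lambda>n. prob ({\<omega>\<in>space M. f (r n) \<omega> \<le> of_rat q} \<inter> B)) \<longlonglongrightarrow> (\<integral>\<omega>\<in>B. h q \<omega> \<partial>M)"
    if B[measurable]: "B \<in> sets M" for q B
  proof -
    have "(\<integral>\<omega>\<in>B. u (to_nat q) (f (r n) \<omega>) \<partial>M) = prob ({\<omega>\<in>space M. f (r n) \<omega> \<le> of_rat q} \<inter> B)" for n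
    proof -
      have "(\<integral>\<omega>\<in>B. u (to_nat q) (f (r n) \<omega>) \<partial>M) = (\<integral>\<omega>. indicator ({\<omega>\<in>space M. f (r n) \<omega> \<le> of_rat q} \<inter> B) \<omega> \<partial>M)"
        unfolding set_lebesgue_integral_def by (intro Bochner_Integration.integral_cong) (auto simp: u_def indicator_def)
      then show ?thesis by simp
    qed
    then show ?thesis using wk_convD[OF Yw B, of "to_nat q"] by (simp add: h_def)
  qed
  have h0: "AE \<omega> in M. 0 \<le> h q \<omega>" for q
  proof (rule AE_le_of_set_integral_le[OF _ Ih])
    fix B assume "B \<in> sets M"
    then have "0 \<le> (\<integral>\<omega>\<in>B. h q \<omega> \<partial>M)" by (intro LIMSEQ_le_const[OF hlim]) auto
    then show "(\<integral>\<omega>\<in>B. 0 \<partial>M) \<le> (\<integral>\<omega>\<in>B. h q \<omega> \<partial>M)" by (simp add: set_lebesgue_integral_def)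
  qed simp
  have hmono: "AE \<omega> in M. h p \<omega> \<le> h q \<omega>" if "p \<le> q" for p q
  proof (rule AE_le_of_set_integral_le[OF Ih Ih])
    fix B assume B[measurable]: "B \<in> sets M"
    show "(\<integral>\<omega>\<in>B. h p \<omega> \<partial>M) \<le> (\<integral>\<omega>\<in>B. h q \<omega> \<partial>M)"
    proof (rule LIMSEQ_le[OF hlim[OF B] hlim[OF B]], intro exI allI impI)
      fix n
      have "real_of_rat p \<le> of_rat q" using that by (simp add: of_rat_less_eq)
      then show "prob ({\<omega>\<in>space M. f (r n) \<omega> \<le> of_rat p} \<inter> B) \<le> prob ({\<omega>\<in>space M. f (r n) \<omega> \<le> of_rat q} \<inter> B)"
        by (intro finite_measure_mono) auto
    qed
  qed
  have hAE: "AE \<omega> in M. (\<forall>q. 0 \<le> h q \<omega>) \<and> (\<forall>p q. p \<le> q \<longrightarrow> h p \<omega> \<le> h q \<omega>)"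
    using h0 hmono by (simp add: AE_all_countable AE_conj_iff)
  have hb: "\<bar>h q \<omega>\<bar> \<le> 1" for q \<omega> using Yb by (simp add: h_def)
  \<comment> \<open>Strictly larger rationals, so that the infimum over them is
    right-continuous.\<close>
  define Q where "Q x = {q. x < real_of_rat q}" for x
  have Qne: "Q x \<noteq> {}" for x using of_rat_dense[of x "x + 1"] by (auto simp: Q_def)
  \<comment> \<open>\<open>h q\<close> is nonnegative only almost everywhere; \<open>max 0\<close>
    bounds the family below at every point, as the infimum requires.\<close>
  define H where "H x \<omega> = (INF q\<in>Q x. max 0 (h q \<omega>))" for x \<omega>
  have bdd: "bdd_below ((\<lambda>q. max 0 (h q \<omega>)) ` A)" for A \<omega> by (rule bdd_belowI[of _ 0]) auto
  have Hm[measurable]: "H x \<in> borel_measurable M" for x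
    unfolding H_def by (rule borel_measurable_cINF) (auto simp: bdd)
  have H0: "0 \<le> H x \<omega>" for x \<omega>
    unfolding H_def by (rule cINF_greatest[OF Qne]) auto
  have Hle: "H x \<omega> \<le> max 0 (h q \<omega>)" if "x < of_rat q" for x q \<omega>
    unfolding H_def using that by (intro cINF_lower bdd) (auto simp: Q_def)
  have H1: "H x \<omega> \<le> 1" for x \<omega>
  proof -
    obtain q where "q \<in> Q x" using Qne by blast
    then show ?thesis using Hle[of x q \<omega>] hb[of q \<omega>] by (auto simp: Q_def)
  qed
  have Hmono: "mono (\<lambda>x. H x \<omega>)" for \<omega>
    unfolding mono_def H_def
    by (intro allI impI cINF_superset_mono Qne bdd) (auto simp: Q_def)
  have Hrc: "continuous (at_right x) (\<lambda>x. H x \<omega>)" for x \<omega>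
  proof (subst continuous_at_right_real_increasing)
    show "\<forall>e>0. \<exists>d>0. H (x + d) \<omega> - H x \<omega> < e"
    proof (intro allI impI)
      fix e :: real assume "0 < e"
      then have "(INF q\<in>Q x. max 0 (h q \<omega>)) < H x \<omega> + e" by (simp add: H_def)
      then obtain q where q: "q \<in> Q x" "max 0 (h q \<omega>) < H x \<omega> + e"
        by (subst (asm) cINF_less_iff[OF Qne bdd]) auto
      show "\<exists>d>0. H (x + d) \<omega> - H x \<omega> < e"
      proof (intro exI[of _ "(of_rat q - x) / 2"] conjI)
        have "H (x + (of_rat q - x) / 2) \<omega> \<le> max 0 (h q \<omega>)"
          using q(1) by (intro Hle) (simp add: Q_def field_simps)
        then show "H (x + (of_rat q - x) / 2) \<omega> - H x \<omega> < e" using q(2) by linarith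
      qed (use q in \<open>simp add: Q_def\<close>)
    qed
  qed (use monoD[OF Hmono] in auto)
  have IH: "integrable M (H x)" for x
    using H0 H1 by (intro integrable_const_bound[where B=1]) auto
  have hH: "AE \<omega> in M. h q \<omega> \<le> H x \<omega>" if "of_rat q \<le> x" for q x
    using hAE
  proof eventually_elim
    case (elim \<omega>)
    show ?case unfolding H_def
    proof (rule cINF_greatest[OF Qne])
      fix p assume "p \<in> Q x"
      then have "q \<le> p" using that by (simp add: Q_def flip: of_rat_less_eq[where 'a=real])
      then show "h q \<omega> \<le> max 0 (h p \<omega>)" using elim by (simp add: max.coboundedI2)
    qed
  qed
  have Hh: "AE \<omega> in M. H x \<omega> \<le> h q \<omega>" if "x < of_rat q" for q x
    using hAE
  proof eventually_elim
    case (elim \<omega>)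
    then have "max 0 (h q \<omega>) = h q \<omega>" by simp
    with Hle[OF that, of \<omega>] show ?case by simp
  qed
  have Eh: "(\<lambda>n. prob {\<omega>\<in>space M. f (r n) \<omega> \<le> of_rat q}) \<longlonglongrightarrow> expectation (h q)" for q
  proof -
    have "{\<omega>\<in>space M. f (r n) \<omega> \<le> of_rat q} \<inter> space M = {\<omega>\<in>space M. f (r n) \<omega> \<le> of_rat q}" for n by auto
    then show ?thesis using hlim[OF sets.top, of q] set_integral_space[OF Ih] by simp
  qed
  have EH_low: "\<exists>n::nat. expectation (H (- real n)) \<le> \<epsilon>" if "0 < \<epsilon>" for \<epsilon>
  proof -
    from tight[OF that] obtain L where L: "\<And>n. prob {\<omega>\<in>space M. L < \<bar>f n \<omega>\<bar>} \<le> \<epsilon>" by blast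
    obtain n :: nat where n: "\<bar>L\<bar> + 2 < real n" using reals_Archimedean2 by blast
    \<comment> \<open>A rational strictly above -n, as comparing \<open>H (- real n)\<close> with
      \<open>h\<close> demands; values below it still exceed L in modulus, since
      \<open>\<bar>L\<bar> + 2 < n\<close>.\<close>
    let ?q = "1 - of_nat n :: rat"
    have q: "real_of_rat ?q = 1 - real n" by (simp add: of_rat_diff)
    have "expectation (H (- real n)) \<le> expectation (h ?q)"
      by (intro integral_mono_AE IH Ih Hh) (simp add: q)
    also have "\<dots> \<le> \<epsilon>"
    proof (rule LIMSEQ_le_const2[OF Eh], intro exI allI impI)
      fix j
      have "prob {\<omega>\<in>space M. f (r j) \<omega> \<le> of_rat ?q} \<le> prob {\<omega>\<in>space M. L < \<bar>f (r j) \<omega>\<bar>}"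
        using n by (intro finite_measure_mono) (auto simp: q)
      also have "\<dots> \<le> \<epsilon>" by (rule L)
      finally show "prob {\<omega>\<in>space M. f (r j) \<omega> \<le> of_rat ?q} \<le> \<epsilon>" .
    qed
    finally show ?thesis by blast
  qed
  have EH_up: "\<exists>n::nat. 1 - expectation (H (real n)) \<le> \<epsilon>" if "0 < \<epsilon>" for \<epsilon>
  proof -
    from tight[OF that] obtain L where L: "\<And>n. prob {\<omega>\<in>space M. L < \<bar>f n \<omega>\<bar>} \<le> \<epsilon>" by blast
    obtain n :: nat where n: "\<bar>L\<bar> < real n" using reals_Archimedean2 by blast
    let ?q = "of_nat n :: rat"
    have "1 - \<epsilon> \<le> expectation (h ?q)"
    proof (rule LIMSEQ_le_const[OF Eh], intro exI allI impI)
      fix j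
      have "prob (space M - {\<omega>\<in>space M. f (r j) \<omega> \<le> of_rat ?q}) \<le> prob {\<omega>\<in>space M. L < \<bar>f (r j) \<omega>\<bar>}"
        using n by (intro finite_measure_mono) auto
      also have "\<dots> \<le> \<epsilon>" by (rule L)
      finally show "1 - \<epsilon> \<le> prob {\<omega>\<in>space M. f (r j) \<omega> \<le> of_rat ?q}"
        by (simp add: prob_compl)
    qed
    also have "\<dots> \<le> expectation (H (real n))"
      by (intro integral_mono_AE IH Ih hH) simp
    finally show ?thesis by (intro exI[of _ n]) simp
  qed
  \<comment> \<open>A nonnegative infimum whose expectation is below every \<epsilon> vanishes
    almost surely. This gives the limits of \<open>H\<close> at both ends.\<close>
  have INF0: "AE \<omega> in M. (INF n::nat. g n \<omega>) = 0"
    if g[measurable]: "\<And>n. g n \<in> borel_measurable M" and gb: "\<And>n \<omega>. 0 \<le> g n \<omega> \<and> g n \<omega> \<le> (1::real)"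
      and e: "\<And>\<epsilon>. 0 < \<epsilon> \<Longrightarrow> \<exists>n. expectation (g n) \<le> \<epsilon>" for g :: "nat \<Rightarrow> 'a \<Rightarrow> real"
  proof -
    have bd: "bdd_below (range (\<lambda>n. g n \<omega>))" for \<omega> using gb by (intro bdd_belowI[of _ 0]) auto
    have m[measurable]: "(\<lambda>\<omega>. INF n. g n \<omega>) \<in> borel_measurable M"
      by (rule borel_measurable_cINF) (auto simp: bd)
    have i0: "0 \<le> (INF n. g n \<omega>)" for \<omega> using gb by (intro cINF_greatest) auto
    have le: "(INF n. g n \<omega>) \<le> g n \<omega>" for n \<omega> by (intro cINF_lower bd) auto
    have I: "integrable M (\<lambda>\<omega>. INF n. g n \<omega>)"
    proof (intro integrable_const_bound[where B=1] AE_I2)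
      show "norm (INF n. g n \<omega>) \<le> 1" for \<omega>
        using i0[of \<omega>] le[of \<omega> 0] gb[of 0 \<omega>] by simp
    qed measurable
    have Ig: "integrable M (g n)" for n using gb by (intro integrable_const_bound[where B=1]) auto
    have "expectation (\<lambda>\<omega>. INF n. g n \<omega>) \<le> \<epsilon>" if "0 < \<epsilon>" for \<epsilon>
    proof -
      from e[OF that] obtain n where "expectation (g n) \<le> \<epsilon>" by blast
      moreover have "expectation (\<lambda>\<omega>. INF n. g n \<omega>) \<le> expectation (g n)"
        by (intro integral_mono I Ig le)
      ultimately show ?thesis by simp
    qed
    then have "expectation (\<lambda>\<omega>. INF n. g n \<omega>) \<le> 0"
      using field_le_epsilon[of "expectation (\<lambda>\<omega>. INF n. g n \<omega>)" 0] by simp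
    moreover have "0 \<le> expectation (\<lambda>\<omega>. INF n. g n \<omega>)" using i0 by simp
    ultimately have "expectation (\<lambda>\<omega>. INF n. g n \<omega>) = 0" by simp
    then show ?thesis using integral_nonneg_eq_0_iff_AE[OF I] i0 by simp
  qed
  have low: "AE \<omega> in M. (INF n::nat. H (- real n) \<omega>) = 0"
    by (rule INF0) (use H0 H1 EH_low in auto)
  have up: "AE \<omega> in M. (INF n::nat. 1 - H (real n) \<omega>) = 0"
  proof (rule INF0)
    fix \<epsilon> :: real assume "0 < \<epsilon>"
    from EH_up[OF this] show "\<exists>n. expectation (\<lambda>\<omega>. 1 - H (real n) \<omega>) \<le> \<epsilon>"
      using IH by (simp add: prob_space)
  qed (use H0 H1 in auto)
  have df: "AE \<omega> in M. distribution_function (\<lambda>x. H x \<omega>)"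
    using low up
  proof eventually_elim
    case (elim \<omega>)
    have "((\<lambda>x. H x \<omega>) \<longlongrightarrow> 0) at_bot" by (rule tendsto_at_bot_of_INF[OF Hmono H0 elim(1)])
    moreover have "((\<lambda>x. H x \<omega>) \<longlongrightarrow> 1) at_top"
    proof -
      have "((\<lambda>x. 1 - H (- x) \<omega>) \<longlongrightarrow> 0) at_bot"
        using H1 monoD[OF Hmono] elim(2) by (intro tendsto_at_bot_of_INF) (auto simp: mono_def)
      then have "((\<lambda>x. 1 - (1 - H (- x) \<omega>)) \<longlongrightarrow> 1 - 0) at_bot" by (intro tendsto_intros)
      then show ?thesis by (simp add: filterlim_at_top_mirror)
    qed
    ultimately show ?case using Hmono Hrc by (simp add: distribution_function_def)
  qed
  have EHmono: "mono (\<lambda>x. expectation (H x))"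
    unfolding mono_def using monoD[OF Hmono] by (auto intro!: integral_mono IH)
  \<comment> \<open>Continuity of the expected distribution function works for every event at once:
    increments are nonnegative, so their integral over \<open>B\<close> is at most their
    expectation. Hence a single set \<open>D\<close> serves all \<open>B\<close>.\<close>
  obtain D where D: "countable D" "closure D = UNIV" "\<And>x. x \<in> D \<Longrightarrow> isCont (\<lambda>x. expectation (H x)) x"
    using countable_dense_continuity_points[OF EHmono] by blast
  have SI: "set_integrable M B W" if "B \<in> sets M" "integrable M W" for B and W :: "'a \<Rightarrow> real"
    using that unfolding set_integrable_def by (rule integrable_mult_indicator)
  have Sle: "(\<integral>\<omega>\<in>B. W \<omega> \<partial>M) \<le> (\<integral>\<omega>\<in>B. V \<omega> \<partial>M)"
    if "B \<in> sets M" "integrable M W" "integrable M V" "AE \<omega> in M. W \<omega> \<le> V \<omega>" for B and W V :: "'a \<Rightarrow> real"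
    using that SI by (intro set_integral_mono_AE) (auto elim: eventually_mono)
  have conv: "(\<lambda>n. prob ({\<omega>\<in>space M. f (r n) \<omega> \<le> x} \<inter> B)) \<longlonglongrightarrow> (\<integral>\<omega>\<in>B. H x \<omega> \<partial>M)"
    if B[measurable]: "B \<in> sets M" and x: "x \<in> D" for B x
  proof (rule tendstoI)
    fix e :: real assume e: "0 < e"
    then have "0 < e / 4" by simp
    with D(3)[OF x] obtain \<delta> where \<delta>: "0 < \<delta>"
      "\<And>y. \<bar>y - x\<bar> < \<delta> \<Longrightarrow> \<bar>expectation (H y) - expectation (H x)\<bar> < e / 4"
      unfolding continuous_at_eps_delta dist_real_def by blast
    obtain p where p: "x - \<delta> / 2 < of_rat p" "of_rat p < x" using of_rat_dense[of "x - \<delta> / 2" x] \<delta> by auto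
    obtain q where q: "x < of_rat q" "of_rat q < x + \<delta> / 2" using of_rat_dense[of x "x + \<delta> / 2"] \<delta> by auto
    have pq: "p \<le> q" using p q by (simp flip: of_rat_less_eq[where 'a=real])
    have "(\<integral>\<omega>\<in>B. h q \<omega> \<partial>M) - (\<integral>\<omega>\<in>B. h p \<omega> \<partial>M) = (\<integral>\<omega>\<in>B. h q \<omega> - h p \<omega> \<partial>M)"
      using SI[OF B Ih] by (simp add: set_integral_diff)
    also have "\<dots> \<le> expectation (\<lambda>\<omega>. h q \<omega> - h p \<omega>)"
      unfolding set_lebesgue_integral_def
    proof (rule integral_mono_AE)
      show "integrable M (\<lambda>\<omega>. indicator B \<omega> *\<^sub>R (h q \<omega> - h p \<omega>))"
        using integrable_mult_indicator[OF B, of "\<lambda>\<omega>. h q \<omega> - h p \<omega>"] Ih by simp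
      show "AE \<omega> in M. indicator B \<omega> *\<^sub>R (h q \<omega> - h p \<omega>) \<le> h q \<omega> - h p \<omega>"
        using hmono[OF pq] by eventually_elim (auto simp: indicator_def)
    qed (use Ih in auto)
    also have "\<dots> = expectation (h q) - expectation (h p)" using Ih by simp
    \<comment> \<open>\<open>h q\<close> lies below \<open>H\<close> at q, and \<open>h p\<close>
      lies above \<open>H\<close> at any point strictly less than p, here x - \<delta> / 2.\<close>
    also have "\<dots> \<le> expectation (H (of_rat q)) - expectation (H (x - \<delta> / 2))"
      using p by (intro diff_mono integral_mono_AE IH Ih hH Hh) auto
    also have "\<dots> < e / 2"
      using \<delta>(2)[of "of_rat q"] \<delta>(2)[of "x - \<delta> / 2"] q \<delta>(1) unfolding abs_less_iff by (auto simp: abs_less_iff)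
    finally have d: "(\<integral>\<omega>\<in>B. h q \<omega> \<partial>M) - (\<integral>\<omega>\<in>B. h p \<omega> \<partial>M) < e / 2" .
    have s: "(\<integral>\<omega>\<in>B. h p \<omega> \<partial>M) \<le> (\<integral>\<omega>\<in>B. H x \<omega> \<partial>M)" "(\<integral>\<omega>\<in>B. H x \<omega> \<partial>M) \<le> (\<integral>\<omega>\<in>B. h q \<omega> \<partial>M)"
      using p q by (auto intro!: Sle B IH Ih hH Hh)
    have "(\<integral>\<omega>\<in>B. h p \<omega> \<partial>M) - e / 2 < (\<integral>\<omega>\<in>B. h p \<omega> \<partial>M)" "(\<integral>\<omega>\<in>B. h q \<omega> \<partial>M) < (\<integral>\<omega>\<in>B. h q \<omega> \<partial>M) + e / 2"
      using e by auto
    note ev = order_tendstoD(1)[OF hlim[OF B] this(1)] order_tendstoD(2)[OF hlim[OF B] this(2)]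
    show "\<forall>\<^sub>F n in sequentially. dist (prob ({\<omega>\<in>space M. f (r n) \<omega> \<le> x} \<inter> B)) (\<integral>\<omega>\<in>B. H x \<omega> \<partial>M) < e"
      using ev
    proof eventually_elim
      case (elim n)
      have "prob ({\<omega>\<in>space M. f (r n) \<omega> \<le> of_rat p} \<inter> B) \<le> prob ({\<omega>\<in>space M. f (r n) \<omega> \<le> x} \<inter> B)"
        "prob ({\<omega>\<in>space M. f (r n) \<omega> \<le> x} \<inter> B) \<le> prob ({\<omega>\<in>space M. f (r n) \<omega> \<le> of_rat q} \<inter> B)"
        using p q by (auto intro!: finite_measure_mono)
      with elim d s show ?case unfolding dist_real_def abs_less_iff by linarith
    qed
  qed
  show thesis
    by (rule that[OF r, of D H]) (use D Hm H0 H1 df conv in \<open>auto simp: determining_with_def\<close>)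
qed

end

subsection \<open>From truncated second moments to the weak law\<close>

text \<open>In contrast to the square set to 0 beyond N this function is continuous, so stable
  convergence applies to it. Division by 0 makes it vanish for N = 0.\<close>

definition trunc_sq :: "nat \<Rightarrow> real \<Rightarrow> real" where
  "trunc_sq N x = min (x\<^sup>2) ((real N)\<^sup>2) / real N"

definition truncation :: "nat \<Rightarrow> real \<Rightarrow> real" where
  "truncation N x = x * indicator {x. \<bar>x\<bar> \<le> real N} x"

lemma trunc_sq_nonneg: "0 \<le> trunc_sq N x"
  by (simp add: trunc_sq_def)

lemma trunc_sq_le: "trunc_sq N x \<le> real N"
  by (cases "N = 0") (auto simp: trunc_sq_def power2_eq_square field_simps)

lemma abs_trunc_sq_le: "\<bar>trunc_sq N x\<bar> \<le> real N"
  using trunc_sq_nonneg trunc_sq_le by simp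

lemma trunc_sq_measurable[measurable]: "trunc_sq N \<in> borel_measurable borel"
  unfolding trunc_sq_def by measurable

lemma isCont_trunc_sq: "isCont (trunc_sq N) x"
  unfolding trunc_sq_def by (cases "N = 0") (auto intro!: continuous_intros)

lemma truncation_measurable[measurable]: "truncation N \<in> borel_measurable borel"
  unfolding truncation_def by measurable

lemma abs_truncation_le: "\<bar>truncation N x\<bar> \<le> real N"
  by (auto simp: truncation_def indicator_def)

lemma truncation_sq_le: "1 \<le> N \<Longrightarrow> (truncation N x)\<^sup>2 \<le> real N * trunc_sq N x"
  using abs_le_square_iff[of x "real N"] by (auto simp: truncation_def trunc_sq_def indicator_def min_def)

lemma indicator_gt_le_trunc_sq:
  assumes "1 \<le> N" shows "indicator {x. real N < \<bar>x\<bar>} x \<le> trunc_sq N x / real N"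
proof (cases "real N < \<bar>x\<bar>")
  case True
  then have "(real N)\<^sup>2 \<le> x\<^sup>2" using abs_le_square_iff[of "real N" x] by simp
  then show ?thesis using assms by (simp add: trunc_sq_def min_def power2_eq_square)
qed (simp add: trunc_sq_nonneg)

text \<open>\<open>p N\<close> is the largest q \<le> N whose threshold \<open>K q\<close> has been
  passed at N. It grows as slowly as the thresholds dictate, so that the property of stage
  \<open>p N\<close> is in force at N.\<close>

lemma ex_slow_sequence:
  fixes Q :: "nat \<Rightarrow> nat \<Rightarrow> bool"
  assumes "\<And>q. eventually (Q q) sequentially"
  obtains p where "filterlim p at_top sequentially" "eventually (\<lambda>N. Q (p N) N) sequentially"
proof -
  have "\<forall>q. \<exists>K. \<forall>N\<ge>K. Q q N" using assms by (simp add: eventually_sequentially)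
  then obtain K where K: "\<And>q N. K q \<le> N \<Longrightarrow> Q q N" by metis
  define S where "S N = {q. q \<le> N \<and> K q \<le> N}" for N
  have fin: "finite (S N)" for N by (rule finite_subset[of _ "{..N}"]) (auto simp: S_def)
  define p where "p N = Max (S N)" for N
  show thesis
  proof (rule that[of p])
    show "filterlim p at_top sequentially"
      unfolding filterlim_at_top
    proof
      fix q
      have "q \<le> p N" if "max q (K q) \<le> N" for N
        unfolding p_def using that by (intro Max_ge fin) (auto simp: S_def)
      then show "\<forall>\<^sub>F N in sequentially. q \<le> p N" by (rule eventually_sequentiallyI)
    qed
    \<comment> \<open>From \<open>K 0\<close> on the maximum is taken over a nonempty set.\<close>
    have "Q (p N) N" if "K 0 \<le> N" for N
    proof -
      have "0 \<in> S N" using that by (auto simp: S_def)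
      then have "p N \<in> S N" unfolding p_def using fin by (intro Max_in) auto
      then show ?thesis using K by (auto simp: S_def)
    qed
    then show "\<forall>\<^sub>F N in sequentially. Q (p N) N" by (rule eventually_sequentiallyI)
  qed
qed

text \<open>When a term is chosen, \<open>B\<close> is imposed relative to all indices up to the
  previous term. The earlier terms are among these, so a recursion that remembers only the last term
  suffices.\<close>

lemma ex_selection:
  fixes A :: "nat \<Rightarrow> nat \<Rightarrow> bool" and B :: "nat \<Rightarrow> nat \<Rightarrow> nat \<Rightarrow> bool"
  assumes A: "\<And>j. eventually (A j) sequentially" and B: "\<And>j i. eventually (B j i) sequentially"
  obtains s where "strict_mono s" "\<And>j. A j (s j)" "\<And>i j. i < j \<Longrightarrow> B j (s i) (s j)"
proof -
  have "\<exists>s. \<forall>j. A j (s j) \<and> (s j < s (Suc j) \<and> (\<forall>i\<le>s j. B (Suc j) i (s (Suc j))))"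
  proof (rule dependent_nat_choice)
    show "\<exists>x. A 0 x" using A[of 0] by (auto simp: eventually_sequentially)
    fix x j
    have "eventually (\<lambda>y. \<forall>i\<in>{..x}. B (Suc j) i y) sequentially"
      by (intro eventually_ball_finite) (auto intro: B)
    with A[of "Suc j"] eventually_gt_at_top[of x]
    have "eventually (\<lambda>y. A (Suc j) y \<and> x < y \<and> (\<forall>i\<le>x. B (Suc j) i y)) sequentially"
      by eventually_elim auto
    then show "\<exists>y. A (Suc j) y \<and> x < y \<and> (\<forall>i\<le>x. B (Suc j) i y)"
      by (rule eventually_happens'[OF sequentially_bot])
  qed
  then obtain s where s: "\<And>j. A j (s j)" "\<And>j. s j < s (Suc j)" "\<And>i j. i \<le> s j \<Longrightarrow> B (Suc j) i (s (Suc j))"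
    by blast
  have m: "strict_mono s" using s(2) by (simp add: strict_mono_Suc_iff)
  show thesis
  proof (rule that[OF m s(1)])
    fix i j :: nat assume "i < j"
    then obtain j' where j: "j = Suc j'" "i \<le> j'" by (cases j) auto
    have "s i \<le> s j'" using m j(2) by (simp add: strict_mono_less_eq)
    then show "B j (s i) (s j)" using s(3) j by simp
  qed
qed

section \<open>Tightness and squares of weak limits\<close>

context prob_space
begin

lemma single_tight:
  fixes X :: "'a \<Rightarrow> real"
  assumes [measurable]: "X \<in> borel_measurable M" and "0 < \<delta>"
  obtains L where "prob {\<omega>\<in>space M. L < \<bar>X \<omega>\<bar>} \<le> \<delta>"
proof -
  have "(\<lambda>n. prob {\<omega>\<in>space M. real n < \<bar>X \<omega>\<bar>}) \<longlonglongrightarrow> prob (\<Inter>n. {\<omega>\<in>space M. real n < \<bar>X \<omega>\<bar>})"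
    by (rule finite_Lim_measure_decseq) (auto simp: decseq_def)
  moreover have "(\<Inter>n. {\<omega>\<in>space M. real n < \<bar>X \<omega>\<bar>}) = {}"
  proof -
    have "\<exists>n::nat. \<not> real n < \<bar>X \<omega>\<bar>" for \<omega>
      using reals_Archimedean2[of "\<bar>X \<omega>\<bar>"] by (auto simp: not_less intro: less_imp_le)
    then show ?thesis by blast
  qed
  ultimately have "(\<lambda>n. prob {\<omega>\<in>space M. real n < \<bar>X \<omega>\<bar>}) \<longlonglongrightarrow> 0" by simp
  from order_tendstoD(2)[OF this \<open>0 < \<delta>\<close>] obtain n :: nat where "prob {\<omega>\<in>space M. real n < \<bar>X \<omega>\<bar>} < \<delta>"
    by (auto simp: eventually_sequentially)
  then show thesis using that by (meson less_imp_le)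
qed

lemma tight_of_eventually:
  fixes g :: "nat \<Rightarrow> 'a \<Rightarrow> real"
  assumes g[measurable]: "\<And>n. g n \<in> borel_measurable M" and "0 < \<delta>"
    and ev: "\<And>n. n0 \<le> n \<Longrightarrow> prob {\<omega>\<in>space M. L0 < \<bar>g n \<omega>\<bar>} \<le> \<delta>"
  obtains L where "\<And>n. prob {\<omega>\<in>space M. L < \<bar>g n \<omega>\<bar>} \<le> \<delta>" "L0 \<le> L"
proof -
  have "\<exists>L. prob {\<omega>\<in>space M. L < \<bar>g n \<omega>\<bar>} \<le> \<delta>" for n
    using single_tight[OF g \<open>0 < \<delta>\<close>] by metis
  then obtain l where l: "\<And>n. prob {\<omega>\<in>space M. l n < \<bar>g n \<omega>\<bar>} \<le> \<delta>" by metis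
  define L where "L = Max (insert L0 (l ` {..<n0}))"
  have mono: "prob {\<omega>\<in>space M. L < \<bar>g n \<omega>\<bar>} \<le> prob {\<omega>\<in>space M. a < \<bar>g n \<omega>\<bar>}" if "a \<le> L" for a n
    using that by (intro finite_measure_mono) auto
  show thesis
  proof (rule that)
    show "L0 \<le> L" by (simp add: L_def)
    show "prob {\<omega>\<in>space M. L < \<bar>g n \<omega>\<bar>} \<le> \<delta>" for n
    proof (cases "n0 \<le> n")
      case True
      show ?thesis using mono[OF \<open>L0 \<le> L\<close>, of n] ev[OF True] by linarith
    next
      case False
      then have "l n \<le> L" by (auto simp: L_def intro!: Max_ge)
      from mono[OF this, of n] l[of n] show ?thesis by linarith
    qed
  qed
qed

text \<open>The elementary \<open>2 * D * c \<le> D\<^sup>2 + c\<^sup>2\<close>, with c the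
  truncation and \<open>c\<^sup>2\<close> at most N times \<open>trunc_sq\<close>, is integrated
  over \<open>B\<close> and passed to the limit. There the left side becomes twice the integral of
  the square of \<open>D\<close>, one copy of which cancels. The weight
  \<open>indicator B * D\<close> is admissible because \<open>D\<close> is bounded.\<close>

lemma sq_weak_limit_truncation_le:
  fixes g :: "nat \<Rightarrow> 'a \<Rightarrow> real"
  assumes g[measurable]: "\<And>n. g n \<in> borel_measurable M" and N: "1 \<le> N"
    and Gm[measurable]: "G \<in> borel_measurable M" and Dm[measurable]: "D \<in> borel_measurable M"
    and G: "\<And>\<omega>. \<omega> \<in> space M \<Longrightarrow> \<bar>G \<omega>\<bar> \<le> real N" and D: "\<And>\<omega>. \<omega> \<in> space M \<Longrightarrow> \<bar>D \<omega>\<bar> \<le> real N"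
    and wG: "wk_conv M (\<lambda>n \<omega>. trunc_sq N (g n \<omega>)) G" and wD: "wk_conv M (\<lambda>n \<omega>. truncation N (g n \<omega>)) D"
  shows "AE \<omega> in M. (D \<omega>)\<^sup>2 \<le> real N * G \<omega>"
proof -
  have D2: "(D \<omega>)\<^sup>2 \<le> (real N)\<^sup>2" if "\<omega> \<in> space M" for \<omega>
    using D[OF that] by (simp add: abs_le_square_iff[symmetric])
  have ID2: "integrable M (\<lambda>\<omega>. (D \<omega>)\<^sup>2)"
    using D2 by (intro integrable_const_bound[where B="(real N)\<^sup>2"]) auto
  have IG: "integrable M G" using G by (intro integrable_const_bound[where B="real N"]) auto
  have Ih: "integrable M (\<lambda>\<omega>. trunc_sq N (g n \<omega>))" for n
    using abs_trunc_sq_le by (intro integrable_const_bound[where B="real N"]) auto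
  have SI: "integrable M (\<lambda>\<omega>. indicator B \<omega> * W \<omega>)" if "B \<in> sets M" "integrable M W" for B and W :: "'a \<Rightarrow> real"
    using integrable_mult_indicator[OF that] by simp
  show ?thesis
  proof (rule AE_le_of_set_integral_le[OF ID2])
    show "integrable M (\<lambda>\<omega>. real N * G \<omega>)" using IG by simp
    fix B assume B[measurable]: "B \<in> sets M"
    let ?Z = "\<lambda>\<omega>. indicator B \<omega> * D \<omega>"
    have IZ: "integrable M ?Z"
      by (rule SI[OF B]) (use D in \<open>intro integrable_const_bound[where B="real N"], auto\<close>)
    have 1: "(\<lambda>n. \<integral>\<omega>. ?Z \<omega> * truncation N (g n \<omega>) \<partial>M) \<longlonglongrightarrow> (\<integral>\<omega>. ?Z \<omega> * D \<omega> \<partial>M)"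
      using wk_conv_integral[OF wD IZ, of "real N"] abs_truncation_le D by simp
    have "(\<lambda>n. (\<integral>\<omega>\<in>B. (D \<omega>)\<^sup>2 \<partial>M) / 2 + real N / 2 * (\<integral>\<omega>\<in>B. trunc_sq N (g n \<omega>) \<partial>M)) \<longlonglongrightarrow>
        (\<integral>\<omega>\<in>B. (D \<omega>)\<^sup>2 \<partial>M) / 2 + real N / 2 * (\<integral>\<omega>\<in>B. G \<omega> \<partial>M)"
      by (intro tendsto_intros wk_convD[OF wG B])
    note 2 = this
    have "(\<integral>\<omega>. ?Z \<omega> * D \<omega> \<partial>M) \<le> (\<integral>\<omega>\<in>B. (D \<omega>)\<^sup>2 \<partial>M) / 2 + real N / 2 * (\<integral>\<omega>\<in>B. G \<omega> \<partial>M)"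
    proof (rule LIMSEQ_le[OF 1 2])
      show "\<exists>n0. \<forall>n\<ge>n0. (\<integral>\<omega>. ?Z \<omega> * truncation N (g n \<omega>) \<partial>M) \<le>
          (\<integral>\<omega>\<in>B. (D \<omega>)\<^sup>2 \<partial>M) / 2 + real N / 2 * (\<integral>\<omega>\<in>B. trunc_sq N (g n \<omega>) \<partial>M)"
      proof (intro exI allI impI)
        fix n
        have "(\<integral>\<omega>. ?Z \<omega> * truncation N (g n \<omega>) \<partial>M) \<le> (\<integral>\<omega>. (indicator B \<omega> * (D \<omega>)\<^sup>2) / 2 + real N / 2 * (indicator B \<omega> * trunc_sq N (g n \<omega>)) \<partial>M)"
        proof (rule integral_mono)
          show "integrable M (\<lambda>\<omega>. ?Z \<omega> * truncation N (g n \<omega>))"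
            using abs_truncation_le by (intro integrable_mult_bdd[OF IZ]) auto
          show "integrable M (\<lambda>\<omega>. (indicator B \<omega> * (D \<omega>)\<^sup>2) / 2 + real N / 2 * (indicator B \<omega> * trunc_sq N (g n \<omega>)))"
            using SI[OF B ID2] SI[OF B Ih] by simp
          fix \<omega>
          have "0 \<le> (D \<omega> - truncation N (g n \<omega>))\<^sup>2" by simp
          then have "D \<omega> * truncation N (g n \<omega>) \<le> (D \<omega>)\<^sup>2 / 2 + (truncation N (g n \<omega>))\<^sup>2 / 2"
            by (simp add: power2_eq_square algebra_simps)
          also have "\<dots> \<le> (D \<omega>)\<^sup>2 / 2 + real N * trunc_sq N (g n \<omega>) / 2"
            using truncation_sq_le[OF N, of "g n \<omega>"] by simp
          finally show "?Z \<omega> * truncation N (g n \<omega>) \<le> (indicator B \<omega> * (D \<omega>)\<^sup>2) / 2 + real N / 2 * (indicator B \<omega> * trunc_sq N (g n \<omega>))"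
            by (simp add: indicator_def)
        qed
        also have "\<dots> = (\<integral>\<omega>\<in>B. (D \<omega>)\<^sup>2 \<partial>M) / 2 + real N / 2 * (\<integral>\<omega>\<in>B. trunc_sq N (g n \<omega>) \<partial>M)"
          using SI[OF B ID2] SI[OF B Ih] by (simp add: set_lebesgue_integral_def)
        finally show "(\<integral>\<omega>. ?Z \<omega> * truncation N (g n \<omega>) \<partial>M) \<le>
          (\<integral>\<omega>\<in>B. (D \<omega>)\<^sup>2 \<partial>M) / 2 + real N / 2 * (\<integral>\<omega>\<in>B. trunc_sq N (g n \<omega>) \<partial>M)" .
      qed
    qed
    moreover have "(\<integral>\<omega>. ?Z \<omega> * D \<omega> \<partial>M) = (\<integral>\<omega>\<in>B. (D \<omega>)\<^sup>2 \<partial>M)"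
      by (simp add: set_lebesgue_integral_def power2_eq_square mult.assoc)
    moreover have "(\<integral>\<omega>\<in>B. real N * G \<omega> \<partial>M) = real N * (\<integral>\<omega>\<in>B. G \<omega> \<partial>M)" by simp
    ultimately show "(\<integral>\<omega>\<in>B. (D \<omega>)\<^sup>2 \<partial>M) \<le> (\<integral>\<omega>\<in>B. real N * G \<omega> \<partial>M)" by (simp add: field_simps)
  qed
qed


text \<open>The term at position p + k brings k correlations of at most 1 / (p + k + 1) each, whose
  sum stays below 1. Each step therefore costs at most c + 2: the diagonal term and twice the cross
  term.\<close>

lemma second_moment_partial_sums:
  fixes W :: "'a \<Rightarrow> real" and V :: "nat \<Rightarrow> 'a \<Rightarrow> real"
  assumes [measurable]: "W \<in> borel_measurable M" "\<And>n. V n \<in> borel_measurable M"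
    and W: "\<And>\<omega>. \<omega> \<in> space M \<Longrightarrow> 0 \<le> W \<omega> \<and> W \<omega> \<le> 1"
    and V: "\<And>n \<omega>. \<omega> \<in> space M \<Longrightarrow> \<bar>V n \<omega>\<bar> \<le> C"
    and diag: "\<And>n. p \<le> n \<Longrightarrow> (\<integral>\<omega>. W \<omega> * (V n \<omega>)\<^sup>2 \<partial>M) \<le> c"
    and off: "\<And>i n. p \<le> i \<Longrightarrow> i < n \<Longrightarrow> \<bar>\<integral>\<omega>. W \<omega> * V i \<omega> * V n \<omega> \<partial>M\<bar> \<le> 1 / real (n + 1)"
  shows "(\<integral>\<omega>. W \<omega> * (\<Sum>n=p..<p+k. V n \<omega>)\<^sup>2 \<partial>M) \<le> real k * (c + 2)"
proof (induct k)
  case (Suc k)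
  let ?S = "\<lambda>\<omega>. \<Sum>n=p..<p+k. V n \<omega>"
  have C: "0 \<le> C" using V not_empty by (meson abs_ge_zero all_not_in_conv order_trans)
  have IW: "integrable M W" using W by (intro integrable_const_bound[where B=1]) auto
  have S: "\<bar>?S \<omega>\<bar> \<le> real k * C" if "\<omega> \<in> space M" for \<omega>
  proof -
    have "\<bar>?S \<omega>\<bar> \<le> (\<Sum>n=p..<p+k. \<bar>V n \<omega>\<bar>)" by (rule sum_abs)
    also have "\<dots> \<le> (\<Sum>n=p..<p+k. C)" by (intro sum_mono V that)
    finally show ?thesis by simp
  qed
  have IWV: "integrable M (\<lambda>\<omega>. W \<omega> * V n \<omega>)" for n by (rule integrable_mult_bdd[OF IW]) (use V in auto)
  have IWVV: "integrable M (\<lambda>\<omega>. W \<omega> * V i \<omega> * V n \<omega>)" for i n by (rule integrable_mult_bdd[OF IWV]) (use V in auto)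
  have IWS: "integrable M (\<lambda>\<omega>. W \<omega> * ?S \<omega>)"
    using S by (intro integrable_mult_bdd[OF IW]) auto
  have I1: "integrable M (\<lambda>\<omega>. W \<omega> * (?S \<omega>)\<^sup>2)"
    using integrable_mult_bdd[OF IWS, of ?S "real k * C"] S by (simp add: power2_eq_square mult.assoc)
  have I3: "integrable M (\<lambda>\<omega>. W \<omega> * (V (p + k) \<omega>)\<^sup>2)"
    using IWVV[of "p + k" "p + k"] by (simp add: power2_eq_square mult.assoc)
  have e: "W \<omega> * ?S \<omega> * V (p + k) \<omega> = (\<Sum>i=p..<p+k. W \<omega> * V i \<omega> * V (p + k) \<omega>)" for \<omega>
    by (simp add: sum_distrib_left sum_distrib_right)
  have I2: "integrable M (\<lambda>\<omega>. W \<omega> * ?S \<omega> * V (p + k) \<omega>)" unfolding e using IWVV by simp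
  have "(\<integral>\<omega>. W \<omega> * ?S \<omega> * V (p + k) \<omega> \<partial>M) = (\<Sum>i=p..<p+k. \<integral>\<omega>. W \<omega> * V i \<omega> * V (p + k) \<omega> \<partial>M)"
    unfolding e by (intro Bochner_Integration.integral_sum IWVV)
  also have "\<dots> \<le> (\<Sum>i=p..<p+k. 1 / real (p + k + 1))"
  proof (rule sum_mono)
    fix i assume "i \<in> {p..<p+k}"
    then show "(\<integral>\<omega>. W \<omega> * V i \<omega> * V (p + k) \<omega> \<partial>M) \<le> 1 / real (p + k + 1)"
      using off[of i "p + k"] by (auto simp: abs_le_iff)
  qed
  also have "\<dots> \<le> 1" by (simp add: field_simps)
  finally have cross: "(\<integral>\<omega>. W \<omega> * ?S \<omega> * V (p + k) \<omega> \<partial>M) \<le> 1" .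
  have "(\<integral>\<omega>. W \<omega> * (\<Sum>n=p..<p+Suc k. V n \<omega>)\<^sup>2 \<partial>M) =
    (\<integral>\<omega>. W \<omega> * (?S \<omega>)\<^sup>2 + 2 * (W \<omega> * ?S \<omega> * V (p + k) \<omega>) + W \<omega> * (V (p + k) \<omega>)\<^sup>2 \<partial>M)"
    by (intro Bochner_Integration.integral_cong) (auto simp: power2_eq_square algebra_simps)
  also have "\<dots> = (\<integral>\<omega>. W \<omega> * (?S \<omega>)\<^sup>2 \<partial>M) + 2 * (\<integral>\<omega>. W \<omega> * ?S \<omega> * V (p + k) \<omega> \<partial>M) + (\<integral>\<omega>. W \<omega> * (V (p + k) \<omega>)\<^sup>2 \<partial>M)"
    using I1 I2 I3 by simp
  also have "\<dots> \<le> real k * (c + 2) + 2 * 1 + c"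
    using Suc cross diag[of "p + k"] by (intro add_mono) auto
  finally show ?case by (simp add: algebra_simps)
qed simp

text \<open>On the event that \<open>G N\<close> is at most \<eta>, the integral of
  \<open>trunc_sq N (g n)\<close> is eventually below 2 * \<eta>, and it bounds the probability that
  \<open>\<bar>g n\<bar>\<close> exceeds N there. The finitely many remaining n are absorbed by
  enlarging \<open>L\<close>.\<close>

lemma tight_of_trunc_sq:
  assumes g[measurable]: "\<And>n. g n \<in> borel_measurable M" and G[measurable]: "\<And>N. G N \<in> borel_measurable M"
    and Gb: "\<And>N \<omega>. \<omega> \<in> space M \<Longrightarrow> 0 \<le> G N \<omega> \<and> G N \<omega> \<le> real N"
    and wG: "\<And>N. 1 \<le> N \<Longrightarrow> wk_conv M (\<lambda>n \<omega>. trunc_sq N (g n \<omega>)) (G N)"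
    and G0: "conv_in_prob M G" and "0 < \<delta>"
  obtains L where "\<And>n. prob {\<omega>\<in>space M. L < \<bar>g n \<omega>\<bar>} \<le> \<delta>" "0 \<le> L"
proof -
  define \<eta> where "\<eta> = min (\<delta> / 4) 1"
  have \<eta>: "0 < \<eta>" "4 * \<eta> \<le> \<delta>" using \<open>0 < \<delta>\<close> by (auto simp: \<eta>_def)
  obtain N where N: "1 \<le> N" "prob {\<omega>\<in>space M. \<eta> < \<bar>G N \<omega>\<bar>} < \<eta>"
    using eventually_happens'[OF sequentially_bot eventually_conj[OF conv_in_probD[OF G0 G \<eta>(1) \<eta>(1)] eventually_ge_at_top[of 1]]]
    by auto
  let ?B = "{\<omega>\<in>space M. G N \<omega> \<le> \<eta>}"
  have IG: "integrable M (G N)" using Gb by (intro integrable_const_bound[where B="real N"]) auto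
  have Ih: "integrable M (\<lambda>\<omega>. trunc_sq N (g n \<omega>))" for n
    using abs_trunc_sq_le by (intro integrable_const_bound[where B="real N"]) auto
  have "(\<integral>\<omega>\<in>?B. G N \<omega> \<partial>M) \<le> (\<integral>\<omega>. \<eta> \<partial>M)"
    unfolding set_lebesgue_integral_def
  proof (rule integral_mono)
    show "integrable M (\<lambda>\<omega>. indicator ?B \<omega> *\<^sub>R G N \<omega>)"
      by (rule integrable_mult_indicator[OF _ IG]) measurable
  qed (use \<eta> in \<open>auto simp: indicator_def\<close>)
  then have "(\<integral>\<omega>\<in>?B. G N \<omega> \<partial>M) < 2 * \<eta>" using \<eta> by (simp add: prob_space)
  from order_tendstoD(2)[OF wk_convD[OF wG[OF N(1)], of ?B] this]
  obtain n0 where n0: "\<And>n. n0 \<le> n \<Longrightarrow> (\<integral>\<omega>\<in>?B. trunc_sq N (g n \<omega>) \<partial>M) < 2 * \<eta>"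
    by (auto simp: eventually_sequentially)
  have ev: "prob {\<omega>\<in>space M. real N < \<bar>g n \<omega>\<bar>} \<le> \<delta>" if "n0 \<le> n" for n
  proof -
    have "prob {\<omega>\<in>space M. real N < \<bar>g n \<omega>\<bar>} \<le> prob ({\<omega>\<in>space M. \<eta> < \<bar>G N \<omega>\<bar>} \<union> (?B \<inter> {\<omega>\<in>space M. real N < \<bar>g n \<omega>\<bar>}))"
      by (intro finite_measure_mono) auto
    also have "\<dots> \<le> prob {\<omega>\<in>space M. \<eta> < \<bar>G N \<omega>\<bar>} + prob (?B \<inter> {\<omega>\<in>space M. real N < \<bar>g n \<omega>\<bar>})"
      by (rule measure_Un_le) measurable
    also have "prob (?B \<inter> {\<omega>\<in>space M. real N < \<bar>g n \<omega>\<bar>}) = (\<integral>\<omega>. indicator (?B \<inter> {\<omega>\<in>space M. real N < \<bar>g n \<omega>\<bar>}) \<omega> \<partial>M)"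
      by simp
    also have "\<dots> \<le> (\<integral>\<omega>\<in>?B. trunc_sq N (g n \<omega>) \<partial>M)"
      unfolding set_lebesgue_integral_def
    proof (rule integral_mono)
      show "integrable M (\<lambda>\<omega>. indicator ?B \<omega> *\<^sub>R trunc_sq N (g n \<omega>))"
        by (rule integrable_mult_indicator[OF _ Ih]) measurable
      fix \<omega>
      have "trunc_sq N (g n \<omega>) / real N \<le> trunc_sq N (g n \<omega>) / 1"
        using N(1) trunc_sq_nonneg by (intro divide_left_mono) auto
      then have "indicator {x. real N < \<bar>x\<bar>} (g n \<omega>) \<le> trunc_sq N (g n \<omega>)"
        using indicator_gt_le_trunc_sq[OF N(1), of "g n \<omega>"] by simp
      then show "indicator (?B \<inter> {\<omega>\<in>space M. real N < \<bar>g n \<omega>\<bar>}) \<omega> \<le> indicator ?B \<omega> *\<^sub>R trunc_sq N (g n \<omega>)"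
        using trunc_sq_nonneg by (auto simp: indicator_def split: if_splits)
    qed (auto simp: emeasure_eq_measure)
    finally show ?thesis using n0[OF that] N(2) \<eta> by simp
  qed
  show thesis
  proof (rule tight_of_eventually[of g \<delta> n0 "real N", OF g \<open>0 < \<delta>\<close> ev])
    fix L assume "\<And>n. prob {\<omega>\<in>space M. L < \<bar>g n \<omega>\<bar>} \<le> \<delta>" "real N \<le> L"
    then show thesis by (intro that[of L]) auto
  qed
qed


lemma conv_in_prob_div_sqrt:
  assumes D[measurable]: "\<And>N. D N \<in> borel_measurable M" and G[measurable]: "\<And>N. G N \<in> borel_measurable M"
    and le: "\<And>N. 1 \<le> N \<Longrightarrow> AE \<omega> in M. (D N \<omega>)\<^sup>2 \<le> real N * G N \<omega>" and G0: "conv_in_prob M G"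
  shows "conv_in_prob M (\<lambda>N \<omega>. D N \<omega> / sqrt (real N))"
proof (rule conv_in_probI)
  fix \<epsilon> \<delta> :: real assume p: "0 < \<epsilon>" "0 < \<delta>"
  then have "0 < \<epsilon>\<^sup>2" by simp
  from conv_in_probD[OF G0 G this p(2)] eventually_ge_at_top[of 1]
  show "\<forall>\<^sub>F N in sequentially. prob {\<omega>\<in>space M. \<epsilon> < \<bar>D N \<omega> / sqrt (real N)\<bar>} \<le> \<delta>"
  proof eventually_elim
    case (elim N)
    have "prob {\<omega>\<in>space M. \<epsilon> < \<bar>D N \<omega> / sqrt (real N)\<bar>} \<le> prob {\<omega>\<in>space M. \<epsilon>\<^sup>2 < \<bar>G N \<omega>\<bar>}"
    proof (rule finite_measure_mono_AE)
      show "AE \<omega> in M. \<omega> \<in> {\<omega>\<in>space M. \<epsilon> < \<bar>D N \<omega> / sqrt (real N)\<bar>} \<longrightarrow> \<omega> \<in> {\<omega>\<in>space M. \<epsilon>\<^sup>2 < \<bar>G N \<omega>\<bar>}"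
        using le[OF elim(2)]
      proof eventually_elim
        case (elim \<omega>)
        have "\<epsilon>\<^sup>2 < \<bar>G N \<omega>\<bar>" if "\<epsilon> < \<bar>D N \<omega> / sqrt (real N)\<bar>"
        proof -
          have "\<epsilon>\<^sup>2 < \<bar>D N \<omega> / sqrt (real N)\<bar>\<^sup>2"
            using that p by (intro power_strict_mono) auto
          also have "\<dots> = (D N \<omega>)\<^sup>2 / real N" by (simp add: power_divide)
          also have "\<dots> \<le> G N \<omega>" using elim \<open>1 \<le> N\<close> by (simp add: field_simps)
          finally show ?thesis by simp
        qed
        then show ?case by auto
      qed
    qed simp
    with elim show ?case by simp
  qed
qed measurable

text \<open>The first \<open>p N\<close> terms of an average of length \<open>N\<close> are discarded. A term at position \<open>j\<close> therefore has to be
well behaved only for those \<open>N\<close> with \<open>p N \<le> j\<close>, which are finitely many, so that weak convergence provides it.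
The weight \<open>W\<close> is needed because \<open>G N\<close> tends to 0 in probability but not in mean.\<close>

theorem hereditary_weak_law_of_trunc_sq:
  assumes g[measurable]: "\<And>n. g n \<in> borel_measurable M" and G[measurable]: "\<And>N. G N \<in> borel_measurable M"
    and D[measurable]: "\<And>N. D N \<in> borel_measurable M"
    and Gb: "\<And>N \<omega>. \<omega> \<in> space M \<Longrightarrow> 0 \<le> G N \<omega> \<and> G N \<omega> \<le> real N"
    and Db: "\<And>N \<omega>. \<omega> \<in> space M \<Longrightarrow> \<bar>D N \<omega>\<bar> \<le> real N"
    and wG: "\<And>N. 1 \<le> N \<Longrightarrow> wk_conv M (\<lambda>n \<omega>. trunc_sq N (g n \<omega>)) (G N)"
    and wD: "\<And>N. 1 \<le> N \<Longrightarrow> wk_conv M (\<lambda>n \<omega>. truncation N (g n \<omega>)) (D N)"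
    and G0: "conv_in_prob M G"
  obtains s :: "nat \<Rightarrow> nat" where "strict_mono s"
    "\<And>m :: nat \<Rightarrow> nat. strict_mono m \<Longrightarrow> conv_in_prob M (\<lambda>N \<omega>. avg g (s \<circ> m) N \<omega> - D N \<omega>)"
proof -
  have DG: "AE \<omega> in M. (D N \<omega>)\<^sup>2 \<le> real N * G N \<omega>" if "1 \<le> N" for N
    by (rule sq_weak_limit_truncation_le[OF g that G D _ Db wG[OF that] wD[OF that]]) (use Gb in auto)
  have Dsqrt: "conv_in_prob M (\<lambda>N \<omega>. D N \<omega> / sqrt (real N))"
    by (rule conv_in_prob_div_sqrt[OF D G DG G0])
  have lim1: "(\<lambda>n. 1 / (real n + 1)) \<longlonglongrightarrow> 0"
    using LIMSEQ_inverse_real_of_nat by (simp add: inverse_eq_divide add.commute)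
  define W where "W N \<omega> = indicat_real {\<omega>\<in>space M. G N \<omega> \<le> 1} \<omega>" for N and \<omega> :: 'a
  have [measurable]: "W N \<in> borel_measurable M" for N unfolding W_def by measurable
  have W01: "0 \<le> W N \<omega> \<and> W N \<omega> \<le> 1" for N \<omega> by (auto simp: W_def indicator_def)
  have IW: "integrable M (W N)" for N using W01 by (intro integrable_const_bound[where B=1]) auto
  \<comment> \<open>The weighted mean of \<open>G N\<close>; it tends to 0 because
    \<open>W N * G N\<close> is bounded by 1 and tends to 0 in probability.\<close>
  define a where "a N = (\<integral>\<omega>. W N \<omega> * G N \<omega> \<partial>M)" for N
  have IWG: "integrable M (\<lambda>\<omega>. W N \<omega> * G N \<omega>)" for N
    using Gb by (intro integrable_mult_bdd[OF IW, of _ "real N"]) auto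
  have a0: "0 \<le> a N" for N unfolding a_def using W01 Gb by (intro Bochner_Integration.integral_nonneg) auto
  have alim: "a \<longlonglongrightarrow> 0"
  proof -
    have "(\<lambda>N. \<integral>\<omega>. \<bar>W N \<omega> * G N \<omega>\<bar> \<partial>M) \<longlonglongrightarrow> 0"
    proof (rule conv_in_prob_integral_bounded[where C=1])
      show "conv_in_prob M (\<lambda>N \<omega>. W N \<omega> * G N \<omega>)"
        by (rule conv_in_prob_bound[OF _ G G0]) (auto simp: W_def indicator_def)
      show "\<bar>W N \<omega> * G N \<omega>\<bar> \<le> 1" if "\<omega> \<in> space M" for N \<omega>
        using Gb[OF that, of N] that by (auto simp: W_def indicator_def)
    qed measurable
    moreover have "(\<integral>\<omega>. \<bar>W N \<omega> * G N \<omega>\<bar> \<partial>M) = a N" for N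
      unfolding a_def using W01 Gb by (intro Bochner_Integration.integral_cong) auto
    ultimately show ?thesis by simp
  qed
  \<comment> \<open>Among q discarded terms each is at most N / (q + 1)^2 up to probability 1 / (q +
    1)^2, so their sum is at most N / (q + 1) up to probability 1 / (q + 1). The condition q^2 \<le>
    N makes q copies of \<open>D N\<close> negligible against N, as \<open>D N\<close> is small
    compared with the square root of N.\<close>
  define Q where "Q q N \<longleftrightarrow> q * q \<le> N \<and>
    (\<forall>n. prob {\<omega>\<in>space M. real N / (real q + 1)\<^sup>2 < \<bar>g n \<omega>\<bar>} \<le> 1 / (real q + 1)\<^sup>2)" for q N
  have evQ: "eventually (Q q) sequentially" for q
  proof -
    have "0 < 1 / (real q + 1)\<^sup>2" by simp
    from tight_of_trunc_sq[OF g G Gb wG G0 this] obtain L where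
      L: "\<And>n. prob {\<omega>\<in>space M. L < \<bar>g n \<omega>\<bar>} \<le> 1 / (real q + 1)\<^sup>2" by metis
    obtain K :: nat where K: "L * (real q + 1)\<^sup>2 \<le> real K" using real_arch_simple by blast
    have "prob {\<omega>\<in>space M. real N / (real q + 1)\<^sup>2 < \<bar>g n \<omega>\<bar>} \<le> 1 / (real q + 1)\<^sup>2" if "K \<le> N" for n N
    proof -
      have "L * (real q + 1)\<^sup>2 \<le> real N" using K that by linarith
      then have "L \<le> real N / (real q + 1)\<^sup>2" by (simp add: pos_le_divide_eq)
      then have "prob {\<omega>\<in>space M. real N / (real q + 1)\<^sup>2 < \<bar>g n \<omega>\<bar>} \<le> prob {\<omega>\<in>space M. L < \<bar>g n \<omega>\<bar>}"
        by (intro finite_measure_mono) auto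
      with L[of n] show ?thesis by linarith
    qed
    then show ?thesis unfolding Q_def by (intro eventually_sequentiallyI[of "max K (q * q)"]) auto
  qed
  obtain p where pinf: "filterlim p at_top sequentially" and p: "eventually (\<lambda>N. Q (p N) N) sequentially"
    by (rule ex_slow_sequence[of Q, OF evQ])
  have pfin: "finite {N. 1 \<le> N \<and> p N \<le> j}" for j
  proof -
    have "eventually (\<lambda>N. Suc j \<le> p N) sequentially" using pinf by (simp add: filterlim_at_top)
    then obtain N0 where N0: "\<And>N. N0 \<le> N \<Longrightarrow> Suc j \<le> p N" by (auto simp: eventually_sequentially)
    have "N < N0" if "p N \<le> j" for N
    proof (rule ccontr)
      assume "\<not> N < N0"
      with N0[of N] that show False by simp
    qed
    then have "{N. 1 \<le> N \<and> p N \<le> j} \<subseteq> {..<N0}" by auto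
    then show ?thesis by (rule finite_subset) simp
  qed
  define V where "V N n \<omega> = truncation N (g n \<omega>) - D N \<omega>" for N n \<omega>
  have [measurable]: "V N n \<in> borel_measurable M" for N n unfolding V_def by measurable
  have Vb: "\<bar>V N n \<omega>\<bar> \<le> 2 * real N" if "\<omega> \<in> space M" for N n \<omega>
    using abs_truncation_le[of N "g n \<omega>"] Db[OF that, of N] unfolding V_def by linarith
  \<comment> \<open>The slack 1 / N turns convergence to \<open>a N\<close> into an inequality that
    holds eventually.\<close>
  have evA: "eventually (\<lambda>n. \<forall>N\<in>{N. 1 \<le> N \<and> p N \<le> j}. (\<integral>\<omega>. W N \<omega> * trunc_sq N (g n \<omega>) \<partial>M) \<le> a N + 1 / real N) sequentially" for j
  proof (intro eventually_ball_finite pfin ballI)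
    fix N assume "N \<in> {N. 1 \<le> N \<and> p N \<le> j}"
    then have N: "1 \<le> N" by simp
    have "(\<lambda>n. \<integral>\<omega>. W N \<omega> * trunc_sq N (g n \<omega>) \<partial>M) \<longlonglongrightarrow> a N"
      unfolding a_def using wk_conv_integral[OF wG[OF N] IW, of "real N"] abs_trunc_sq_le Gb by simp
    moreover have "a N < a N + 1 / real N" using N by simp
    ultimately have "eventually (\<lambda>n. (\<integral>\<omega>. W N \<omega> * trunc_sq N (g n \<omega>) \<partial>M) < a N + 1 / real N) sequentially"
      by (rule order_tendstoD(2))
    then show "eventually (\<lambda>n. (\<integral>\<omega>. W N \<omega> * trunc_sq N (g n \<omega>) \<partial>M) \<le> a N + 1 / real N) sequentially"
      by eventually_elim simp
  qed
  \<comment> \<open>For fixed i the variables \<open>V N n\<close> tend weakly to 0 against the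
    weight \<open>W N * V N i\<close>. The tolerance 1 / (j + 1) is the one that
    \<open>second_moment_partial_sums\<close> sums up.\<close>
  have evB: "eventually (\<lambda>n. \<forall>N\<in>{N. 1 \<le> N \<and> p N \<le> j}. \<bar>\<integral>\<omega>. W N \<omega> * V N i \<omega> * V N n \<omega> \<partial>M\<bar> \<le> 1 / real (j + 1)) sequentially" for j i
  proof (intro eventually_ball_finite pfin ballI)
    fix N assume "N \<in> {N. 1 \<le> N \<and> p N \<le> j}"
    then have N: "1 \<le> N" by simp
    have IZ: "integrable M (\<lambda>\<omega>. W N \<omega> * V N i \<omega>)"
      using Vb by (intro integrable_mult_bdd[OF IW, of _ "2 * real N"]) auto
    have IZD: "integrable M (\<lambda>\<omega>. W N \<omega> * V N i \<omega> * D N \<omega>)" using Db by (intro integrable_mult_bdd[OF IZ]) auto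
    have IZc: "integrable M (\<lambda>\<omega>. W N \<omega> * V N i \<omega> * truncation N (g n \<omega>))" for n
      using abs_truncation_le by (intro integrable_mult_bdd[OF IZ]) auto
    have "(\<lambda>n. \<integral>\<omega>. W N \<omega> * V N i \<omega> * truncation N (g n \<omega>) \<partial>M) \<longlonglongrightarrow> (\<integral>\<omega>. W N \<omega> * V N i \<omega> * D N \<omega> \<partial>M)"
      using wk_conv_integral[OF wD[OF N] IZ, of "real N"] abs_truncation_le Db by simp
    then have "(\<lambda>n. (\<integral>\<omega>. W N \<omega> * V N i \<omega> * truncation N (g n \<omega>) \<partial>M) - (\<integral>\<omega>. W N \<omega> * V N i \<omega> * D N \<omega> \<partial>M)) \<longlonglongrightarrow> 0"
      by (simp add: LIM_zero)
    moreover have "(\<integral>\<omega>. W N \<omega> * V N i \<omega> * V N n \<omega> \<partial>M) =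
        (\<integral>\<omega>. W N \<omega> * V N i \<omega> * truncation N (g n \<omega>) \<partial>M) - (\<integral>\<omega>. W N \<omega> * V N i \<omega> * D N \<omega> \<partial>M)" for n
      unfolding V_def[of N n] right_diff_distrib by (intro Bochner_Integration.integral_diff IZD IZc)
    ultimately have "(\<lambda>n. \<bar>\<integral>\<omega>. W N \<omega> * V N i \<omega> * V N n \<omega> \<partial>M\<bar>) \<longlonglongrightarrow> 0"
      by (simp add: tendsto_rabs_zero)
    from order_tendstoD(2)[OF this, of "1 / real (j + 1)"]
    show "eventually (\<lambda>n. \<bar>\<integral>\<omega>. W N \<omega> * V N i \<omega> * V N n \<omega> \<partial>M\<bar> \<le> 1 / real (j + 1)) sequentially"
      by (auto elim: eventually_mono)
  qed
  define A where "A j n \<longleftrightarrow> (\<forall>N\<in>{N. 1 \<le> N \<and> p N \<le> j}. (\<integral>\<omega>. W N \<omega> * trunc_sq N (g n \<omega>) \<partial>M) \<le> a N + 1 / real N)" for j n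
  define B where "B j i n \<longleftrightarrow> (\<forall>N\<in>{N. 1 \<le> N \<and> p N \<le> j}. \<bar>\<integral>\<omega>. W N \<omega> * V N i \<omega> * V N n \<omega> \<partial>M\<bar> \<le> 1 / real (j + 1))" for j i n
  obtain s where s: "strict_mono s" and As: "\<And>j. A j (s j)" and Bs: "\<And>i j. i < j \<Longrightarrow> B j (s i) (s j)"
  proof -
    have "eventually (A j) sequentially" for j unfolding A_def[abs_def] by (rule evA)
    moreover have "eventually (B j i) sequentially" for j i unfolding B_def[abs_def] by (rule evB)
    ultimately show thesis using ex_selection[of A B] that by blast
  qed
  have sA: "(\<integral>\<omega>. W N \<omega> * trunc_sq N (g (s j) \<omega>) \<partial>M) \<le> a N + 1 / real N" if "1 \<le> N" "p N \<le> j" for j N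
    using As[of j] that by (simp add: A_def)
  have sB: "\<bar>\<integral>\<omega>. W N \<omega> * V N (s i) \<omega> * V N (s j) \<omega> \<partial>M\<bar> \<le> 1 / real (j + 1)"
    if "i < j" "1 \<le> N" "p N \<le> j" for i j N
    using Bs[OF that(1)] that by (simp add: B_def)
  show thesis
  proof (rule that[OF s])
    fix m :: "nat \<Rightarrow> nat" assume m: "strict_mono m"
    \<comment> \<open>Positions only increase under a further subsequence, so the conditions
      attached to position n hold a fortiori for the term \<open>s (m n)\<close>.\<close>
    have mi: "n \<le> m n" for n using m by (rule strict_mono_imp_increasing)
    have gA: "(\<integral>\<omega>. W N \<omega> * trunc_sq N (g (s (m n)) \<omega>) \<partial>M) \<le> a N + 1 / real N" if "1 \<le> N" "p N \<le> n" for n N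
      using sA[of N "m n"] that mi[of n] by simp
    have gB: "\<bar>\<integral>\<omega>. W N \<omega> * V N (s (m i)) \<omega> * V N (s (m n)) \<omega> \<partial>M\<bar> \<le> 1 / real (n + 1)"
      if "1 \<le> N" "p N \<le> i" "i < n" for i n N
    proof -
      have "m i < m n" using m that by (simp add: strict_mono_less)
      from sB[OF this that(1)] have "\<bar>\<integral>\<omega>. W N \<omega> * V N (s (m i)) \<omega> * V N (s (m n)) \<omega> \<partial>M\<bar> \<le> 1 / real (m n + 1)"
        using that mi[of n] by simp
      also have "\<dots> \<le> 1 / real (n + 1)" using mi[of n] by (intro divide_left_mono) auto
      finally show ?thesis .
    qed
    show "conv_in_prob M (\<lambda>N \<omega>. avg g (s \<circ> m) N \<omega> - D N \<omega>)"
    proof (rule conv_in_probI)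
      fix \<epsilon> \<delta> :: real assume ed: "0 < \<epsilon>" "0 < \<delta>"
      \<comment> \<open>Three errors of size \<eta> arise, from the discarded terms, the centered
        sum and the missing copies of \<open>D N\<close>; a quarter of \<epsilon> for each keeps the
        total strictly below \<epsilon>.\<close>
      define \<eta> where "\<eta> = \<epsilon> / 4"
      have \<eta>: "0 < \<eta>" using ed by (simp add: \<eta>_def)
      define t where "t n = g (s (m n))" for n
      have [measurable]: "t n \<in> borel_measurable M" for n by (simp add: t_def)
      define R where "R N = 1 / (real (p N) + 1) + prob {\<omega>\<in>space M. \<eta> < \<bar>D N \<omega> / sqrt (real N)\<bar>}
        + prob {\<omega>\<in>space M. 1 < \<bar>G N \<omega>\<bar>} + (a N + 1 / real N) + 4 * (a N + 1 / real N) / \<eta>\<^sup>2" for N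
      have R0: "R \<longlonglongrightarrow> 0"
      proof -
        have "(\<lambda>N. 1 / (real (p N) + 1)) \<longlonglongrightarrow> 0"
          by (rule filterlim_compose[OF lim1 pinf])
        moreover have "(\<lambda>N. prob {\<omega>\<in>space M. \<eta> < \<bar>D N \<omega> / sqrt (real N)\<bar>}) \<longlonglongrightarrow> 0"
          using Dsqrt \<eta> by (subst (asm) conv_in_prob_iff) auto
        moreover have "(\<lambda>N. prob {\<omega>\<in>space M. 1 < \<bar>G N \<omega>\<bar>}) \<longlonglongrightarrow> 0"
          using G0 by (subst (asm) conv_in_prob_iff) auto
        moreover have "(\<lambda>N. a N + 1 / real N) \<longlonglongrightarrow> 0"
          using tendsto_add[OF alim lim_1_over_n] by simp
        ultimately have "R \<longlonglongrightarrow> 0 + 0 + 0 + 0 + 4 * 0 / \<eta>\<^sup>2"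
          unfolding R_def by (intro tendsto_intros) (use \<eta> in auto)
        then show ?thesis by simp
      qed
      from order_tendstoD(2)[OF R0 ed(2)] p eventually_ge_at_top[of 1]
        order_tendstoD(2)[OF filterlim_compose[OF lim1 pinf] \<eta>]
      show "\<forall>\<^sub>F N in sequentially. prob {\<omega>\<in>space M. \<epsilon> < \<bar>avg g (s \<circ> m) N \<omega> - D N \<omega>\<bar>} \<le> \<delta>"
      proof eventually_elim
        case (elim N)
        let ?p = "p N"
        have N: "1 \<le> N" and pp: "?p * ?p \<le> N" and N0: "0 < real N"
          and pt: "\<And>n. prob {\<omega>\<in>space M. real N / (real ?p + 1)\<^sup>2 < \<bar>g n \<omega>\<bar>} \<le> 1 / (real ?p + 1)\<^sup>2"
          using elim by (auto simp: Q_def)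
        have pN: "?p \<le> N" using pp by (metis le_trans le_square)
        have pn: "1 / (real ?p + 1) < \<eta>" using elim by (simp add: add.commute)
        \<comment> \<open>The five ways to fail: large discarded terms, \<open>D N\<close> not small
          against the square root of N, \<open>G N\<close> above 1, some term cut by the truncation,
          a large centered sum.\<close>
        let ?E1 = "{\<omega>\<in>space M. \<eta> * real N < (\<Sum>n<?p. \<bar>t n \<omega>\<bar>)}"
        let ?E2 = "{\<omega>\<in>space M. \<eta> < \<bar>D N \<omega> / sqrt (real N)\<bar>}"
        let ?E3 = "{\<omega>\<in>space M. 1 < \<bar>G N \<omega>\<bar>}"
        let ?E4 = "\<Union>n\<in>{?p..<N}. {\<omega>\<in>space M. G N \<omega> \<le> 1 \<and> real N < \<bar>t n \<omega>\<bar>}"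
        let ?E5 = "{\<omega>\<in>space M. G N \<omega> \<le> 1 \<and> \<eta> * real N \<le> \<bar>\<Sum>n=?p..<N. V N (s (m n)) \<omega>\<bar>}"
        have sub: "{\<omega>\<in>space M. \<epsilon> < \<bar>avg g (s \<circ> m) N \<omega> - D N \<omega>\<bar>} \<subseteq> ?E1 \<union> ?E2 \<union> ?E3 \<union> ?E4 \<union> ?E5"
        proof (rule subsetI, rule ccontr)
          fix \<omega> assume w: "\<omega> \<in> {\<omega>\<in>space M. \<epsilon> < \<bar>avg g (s \<circ> m) N \<omega> - D N \<omega>\<bar>}"
            and n: "\<omega> \<notin> ?E1 \<union> ?E2 \<union> ?E3 \<union> ?E4 \<union> ?E5"
          then have sp: "\<omega> \<in> space M" by auto
          have n1: "(\<Sum>n<?p. \<bar>t n \<omega>\<bar>) \<le> \<eta> * real N" using n sp by auto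
          have n2: "\<bar>D N \<omega>\<bar> \<le> \<eta> * sqrt (real N)" using n sp N0 by (simp add: abs_divide field_simps)
          have n3: "G N \<omega> \<le> 1" using n sp by auto
          have n4: "\<bar>t n \<omega>\<bar> \<le> real N" if "n \<in> {?p..<N}" for n
          proof -
            have "\<omega> \<notin> {\<omega>\<in>space M. G N \<omega> \<le> 1 \<and> real N < \<bar>t n \<omega>\<bar>}" using n that by blast
            then show ?thesis using sp n3 by simp
          qed
          have n5: "\<bar>\<Sum>n=?p..<N. V N (s (m n)) \<omega>\<bar> \<le> \<eta> * real N" using n sp n3 by auto
          have "(\<Sum>n<N. t n \<omega>) = (\<Sum>n<?p. t n \<omega>) + (\<Sum>n=?p..<N. t n \<omega>)"
            using sum.atLeastLessThan_concat[of 0 ?p N "\<lambda>n. t n \<omega>"] pN by (simp add: lessThan_atLeast0)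
          \<comment> \<open>Outside \<open>?E4\<close> the truncation leaves the terms
            unchanged.\<close>
          also have "(\<Sum>n=?p..<N. t n \<omega>) = (\<Sum>n=?p..<N. V N (s (m n)) \<omega> + D N \<omega>)"
            by (rule sum.cong) (use n4 in \<open>auto simp: V_def truncation_def t_def\<close>)
          also have "\<dots> = (\<Sum>n=?p..<N. V N (s (m n)) \<omega>) + (real N - real ?p) * D N \<omega>"
            using pN by (simp add: sum.distrib of_nat_diff)
          finally have "(\<Sum>n<N. t n \<omega>) - real N * D N \<omega> =
            (\<Sum>n<?p. t n \<omega>) + (\<Sum>n=?p..<N. V N (s (m n)) \<omega>) - real ?p * D N \<omega>" by (simp add: algebra_simps)
          moreover have "\<bar>\<Sum>n<?p. t n \<omega>\<bar> \<le> \<eta> * real N" using sum_abs[of "\<lambda>n. t n \<omega>" "{..<?p}"] n1 by linarith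
          moreover have "\<bar>real ?p * D N \<omega>\<bar> \<le> \<eta> * real N"
          proof -
            have "real ?p \<le> sqrt (real N)"
              using pp by (intro real_le_rsqrt) (simp add: power2_eq_square flip: of_nat_mult)
            then have "real ?p * \<bar>D N \<omega>\<bar> \<le> sqrt (real N) * (\<eta> * sqrt (real N))"
              using n2 by (intro mult_mono) auto
            also have "\<dots> = \<eta> * real N" by simp
            finally show ?thesis by (simp add: abs_mult)
          qed
          ultimately have T: "\<bar>(\<Sum>n<N. t n \<omega>) - real N * D N \<omega>\<bar> \<le> 3 * (\<eta> * real N)" using n5 by linarith
          have "avg g (s \<circ> m) N \<omega> - D N \<omega> = ((\<Sum>n<N. t n \<omega>) - real N * D N \<omega>) / real N"
            using N0 by (simp add: avg_def t_def field_simps)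
          then have "\<bar>avg g (s \<circ> m) N \<omega> - D N \<omega>\<bar> = \<bar>(\<Sum>n<N. t n \<omega>) - real N * D N \<omega>\<bar> / real N"
            by (simp only: abs_divide abs_of_nat)
          also have "\<dots> \<le> 3 * (\<eta> * real N) / real N" using T by (intro divide_right_mono) auto
          also have "\<dots> = 3 * \<eta>" using N0 by simp
          finally show False using w \<eta> by (simp add: \<eta>_def)
        qed
        have P1: "prob ?E1 \<le> 1 / (real ?p + 1)"
        proof -
          have "?E1 \<subseteq> (\<Union>n<?p. {\<omega>\<in>space M. real N / (real ?p + 1)\<^sup>2 < \<bar>t n \<omega>\<bar>})"
          proof (rule subsetI, rule ccontr)
            fix \<omega> assume w: "\<omega> \<in> ?E1" and "\<omega> \<notin> (\<Union>n<?p. {\<omega>\<in>space M. real N / (real ?p + 1)\<^sup>2 < \<bar>t n \<omega>\<bar>})"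
            then have "(\<Sum>n<?p. \<bar>t n \<omega>\<bar>) \<le> (\<Sum>n<?p. real N / (real ?p + 1)\<^sup>2)"
              by (intro sum_mono) (auto simp: not_less)
            also have "\<dots> = real ?p * real N / (real ?p + 1)\<^sup>2" by simp
            also have "\<dots> \<le> (real ?p + 1) * real N / (real ?p + 1)\<^sup>2"
              by (intro divide_right_mono mult_right_mono) auto
            also have "\<dots> = 1 / (real ?p + 1) * real N" by (simp add: power2_eq_square)
            also have "\<dots> \<le> \<eta> * real N" using pn by (intro mult_right_mono) auto
            finally show False using w by simp
          qed
          then have "prob ?E1 \<le> prob (\<Union>n<?p. {\<omega>\<in>space M. real N / (real ?p + 1)\<^sup>2 < \<bar>t n \<omega>\<bar>})"
            by (intro finite_measure_mono) auto
          also have "\<dots> \<le> (\<Sum>n<?p. prob {\<omega>\<in>space M. real N / (real ?p + 1)\<^sup>2 < \<bar>t n \<omega>\<bar>})"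
            by (rule finite_measure_subadditive_finite) auto
          also have "\<dots> \<le> (\<Sum>n<?p. 1 / (real ?p + 1)\<^sup>2)"
            unfolding t_def by (intro sum_mono pt)
          also have "\<dots> = real ?p / (real ?p + 1)\<^sup>2" by simp
          also have "\<dots> \<le> (real ?p + 1) / (real ?p + 1)\<^sup>2" by (intro divide_right_mono) auto
          also have "\<dots> = 1 / (real ?p + 1)" by (simp add: power2_eq_square)
          finally show ?thesis .
        qed
        have Wt: "integrable M (\<lambda>\<omega>. W N \<omega> * trunc_sq N (t n \<omega>))" for n
          using abs_trunc_sq_le by (intro integrable_mult_bdd[OF IW]) auto
        have P4: "prob ?E4 \<le> a N + 1 / real N"
        proof -
          have "prob ?E4 \<le> (\<Sum>n=?p..<N. prob {\<omega>\<in>space M. G N \<omega> \<le> 1 \<and> real N < \<bar>t n \<omega>\<bar>})"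
            by (rule finite_measure_subadditive_finite) auto
          also have "\<dots> \<le> (\<Sum>n=?p..<N. (a N + 1 / real N) / real N)"
          proof (rule sum_mono)
            fix n assume n: "n \<in> {?p..<N}"
            let ?A = "{\<omega>\<in>space M. G N \<omega> \<le> 1 \<and> real N < \<bar>t n \<omega>\<bar>}"
            have "prob ?A = (\<integral>\<omega>. indicator ?A \<omega> \<partial>M)" by simp
            also have "\<dots> \<le> (\<integral>\<omega>. W N \<omega> * trunc_sq N (t n \<omega>) / real N \<partial>M)"
            proof (rule integral_mono)
              fix \<omega> assume "\<omega> \<in> space M"
              then show "indicator ?A \<omega> \<le> W N \<omega> * trunc_sq N (t n \<omega>) / real N"
                using indicator_gt_le_trunc_sq[OF N, of "t n \<omega>"] trunc_sq_nonneg[of N "t n \<omega>"]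
                by (auto simp: W_def indicator_def split: if_splits)
            qed (use Wt in \<open>auto simp: emeasure_eq_measure\<close>)
            also have "\<dots> = (\<integral>\<omega>. W N \<omega> * trunc_sq N (t n \<omega>) \<partial>M) / real N" by simp
            also have "\<dots> \<le> (a N + 1 / real N) / real N"
              using gA[OF N, of n] n by (intro divide_right_mono) (auto simp: t_def)
            finally show "prob ?A \<le> (a N + 1 / real N) / real N" .
          qed
          also have "\<dots> = (real N - real ?p) * ((a N + 1 / real N) / real N)"
            using pN by (simp add: of_nat_diff)
          also have "\<dots> \<le> real N * ((a N + 1 / real N) / real N)"
            using a0[of N] by (intro mult_right_mono) auto
          also have "\<dots> = a N + 1 / real N" using N0 by simp
          finally show ?thesis .
        qed
        have P5: "prob ?E5 \<le> 4 * (a N + 1 / real N) / \<eta>\<^sup>2"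
        proof -
          let ?S = "\<lambda>\<omega>. \<Sum>n=?p..<N. V N (s (m n)) \<omega>"
          \<comment> \<open>The subtracted 2 cancels the 2 that
            \<open>second_moment_partial_sums\<close> adds, and the value equals
            \<open>4 * N * a N + 2\<close>, which is what the diagonal estimate produces.\<close>
          let ?c = "4 * real N * (a N + 1 / real N) - 2"
          have "(\<integral>\<omega>. W N \<omega> * (\<Sum>n=?p..<?p + (N - ?p). V N (s (m n)) \<omega>)\<^sup>2 \<partial>M) \<le> real (N - ?p) * (?c + 2)"
          proof (rule second_moment_partial_sums[where V="\<lambda>n. V N (s (m n))" and W="W N" and C="2 * real N"])
            fix n assume n: "?p \<le> n"
            have IV: "integrable M (\<lambda>\<omega>. W N \<omega> * (V N (s (m n)) \<omega>)\<^sup>2)"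
            proof (rule integrable_mult_bdd[OF IW])
              fix \<omega> assume "\<omega> \<in> space M"
              then have "\<bar>V N (s (m n)) \<omega>\<bar>\<^sup>2 \<le> (2 * real N)\<^sup>2" by (intro power_mono Vb) auto
              then show "\<bar>(V N (s (m n)) \<omega>)\<^sup>2\<bar> \<le> (2 * real N)\<^sup>2" by simp
            qed measurable
            have "(\<integral>\<omega>. W N \<omega> * (V N (s (m n)) \<omega>)\<^sup>2 \<partial>M) \<le>
              (\<integral>\<omega>. 2 * real N * (W N \<omega> * trunc_sq N (t n \<omega>)) + 2 * real N * (W N \<omega> * G N \<omega>) \<partial>M)"
            proof (rule integral_mono_AE)
              show "AE \<omega> in M. W N \<omega> * (V N (s (m n)) \<omega>)\<^sup>2 \<le> 2 * real N * (W N \<omega> * trunc_sq N (t n \<omega>)) + 2 * real N * (W N \<omega> * G N \<omega>)"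
                using DG[OF N]
              proof eventually_elim
                case (elim \<omega>)
                \<comment> \<open>This gives
                  \<open>(c - D)\<^sup>2 \<le> 2 * c\<^sup>2 + 2 * D\<^sup>2\<close> for the
                  truncation c; both squares are controlled by N times a small quantity.\<close>
                have "0 \<le> (truncation N (t n \<omega>) + D N \<omega>)\<^sup>2" by simp
                then have "(V N (s (m n)) \<omega>)\<^sup>2 \<le> 2 * (truncation N (t n \<omega>))\<^sup>2 + 2 * (D N \<omega>)\<^sup>2"
                  by (simp add: V_def t_def power2_eq_square algebra_simps)
                also have "\<dots> \<le> 2 * (real N * trunc_sq N (t n \<omega>)) + 2 * (real N * G N \<omega>)"
                  using truncation_sq_le[OF N, of "t n \<omega>"] elim by simp
                finally have "W N \<omega> * (V N (s (m n)) \<omega>)\<^sup>2 \<le> W N \<omega> * (2 * (real N * trunc_sq N (t n \<omega>)) + 2 * (real N * G N \<omega>))"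
                  using W01 by (intro mult_left_mono) auto
                then show ?case by (simp add: algebra_simps)
              qed
            qed (use IV Wt IWG in auto)
            also have "\<dots> = 2 * real N * (\<integral>\<omega>. W N \<omega> * trunc_sq N (t n \<omega>) \<partial>M) + 2 * real N * a N"
              using Wt IWG by (simp add: a_def)
            also have "\<dots> \<le> 2 * real N * (a N + 1 / real N) + 2 * real N * a N"
              using gA[OF N n] by (intro add_right_mono mult_left_mono) (auto simp: t_def)
            also have "\<dots> = ?c" using N0 by (simp add: field_simps)
            finally show "(\<integral>\<omega>. W N \<omega> * (V N (s (m n)) \<omega>)\<^sup>2 \<partial>M) \<le> ?c" .
          next
            fix i n assume "?p \<le> i" "i < n"
            then show "\<bar>\<integral>\<omega>. W N \<omega> * V N (s (m i)) \<omega> * V N (s (m n)) \<omega> \<partial>M\<bar> \<le> 1 / real (n + 1)"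
              by (intro gB N)
          qed (use W01 Vb in auto)
          then have "(\<integral>\<omega>. W N \<omega> * (?S \<omega>)\<^sup>2 \<partial>M) \<le> real (N - ?p) * (?c + 2)"
            unfolding le_add_diff_inverse[OF pN] .
          also have "\<dots> = real (N - ?p) * (4 * real N * (a N + 1 / real N))" by simp
          also have "\<dots> \<le> real N * (4 * real N * (a N + 1 / real N))"
            using a0[of N] by (intro mult_right_mono mult_nonneg_nonneg add_nonneg_nonneg) auto
          finally have S2: "(\<integral>\<omega>. W N \<omega> * (?S \<omega>)\<^sup>2 \<partial>M) \<le> 4 * (a N + 1 / real N) * (real N)\<^sup>2"
            by (simp only: power2_eq_square mult_ac)
          have Sb: "\<bar>?S \<omega>\<bar> \<le> real N * (2 * real N)" if "\<omega> \<in> space M" for \<omega>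
          proof -
            have "\<bar>?S \<omega>\<bar> \<le> (\<Sum>n=?p..<N. \<bar>V N (s (m n)) \<omega>\<bar>)" by (rule sum_abs)
            also have "\<dots> \<le> (\<Sum>n=?p..<N. 2 * real N)" by (intro sum_mono Vb that)
            also have "\<dots> \<le> real N * (2 * real N)" using pN by (auto intro!: mult_right_mono)
            finally show ?thesis .
          qed
          have IS: "integrable M (\<lambda>\<omega>. W N \<omega> * (?S \<omega>)\<^sup>2)"
          proof (rule integrable_mult_bdd[OF IW])
            fix \<omega> assume "\<omega> \<in> space M"
            from power_mono[OF Sb[OF this], of 2] show "\<bar>(?S \<omega>)\<^sup>2\<bar> \<le> (real N * (2 * real N))\<^sup>2" by simp
          qed measurable
          have "prob ?E5 = (\<integral>\<omega>. indicator ?E5 \<omega> \<partial>M)" by simp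
          \<comment> \<open>Chebyshev's inequality under the weight: \<open>W N\<close> equals 1 on
            \<open>?E5\<close>.\<close>
          also have "\<dots> \<le> (\<integral>\<omega>. W N \<omega> * (?S \<omega>)\<^sup>2 / (\<eta> * real N)\<^sup>2 \<partial>M)"
          proof (rule integral_mono)
            fix \<omega> assume "\<omega> \<in> space M"
            show "indicator ?E5 \<omega> \<le> W N \<omega> * (?S \<omega>)\<^sup>2 / (\<eta> * real N)\<^sup>2"
            proof (cases "\<omega> \<in> ?E5")
              case True
              then have "(\<eta> * real N)\<^sup>2 \<le> \<bar>?S \<omega>\<bar>\<^sup>2" using \<eta> by (intro power_mono) auto
              moreover have "W N \<omega> = 1" using True by (simp add: W_def)
              moreover have "0 < (\<eta> * real N)\<^sup>2" using \<eta> N0 by simp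
              ultimately show ?thesis using True by (simp del: power_mult_distrib)
            qed (use W01 in simp)
          qed (use IS in \<open>auto simp: emeasure_eq_measure\<close>)
          also have "\<dots> = (\<integral>\<omega>. W N \<omega> * (?S \<omega>)\<^sup>2 \<partial>M) / (\<eta> * real N)\<^sup>2" by simp
          also have "\<dots> \<le> (4 * (a N + 1 / real N) * (real N)\<^sup>2) / (\<eta> * real N)\<^sup>2"
            using S2 by (intro divide_right_mono) auto
          also have "\<dots> = 4 * (a N + 1 / real N) / \<eta>\<^sup>2" using N0 \<eta> by (simp add: power_mult_distrib)
          finally show ?thesis .
        qed
        have [measurable]: "?E1 \<in> sets M" "?E2 \<in> sets M" "?E3 \<in> sets M" "?E4 \<in> sets M" "?E5 \<in> sets M" by measurable
        have "prob {\<omega>\<in>space M. \<epsilon> < \<bar>avg g (s \<circ> m) N \<omega> - D N \<omega>\<bar>} \<le> prob (?E1 \<union> ?E2 \<union> ?E3 \<union> ?E4 \<union> ?E5)"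
          by (intro finite_measure_mono sub) measurable
        also have "\<dots> \<le> prob (?E1 \<union> ?E2 \<union> ?E3 \<union> ?E4) + prob ?E5" by (rule measure_Un_le) measurable
        also have "prob (?E1 \<union> ?E2 \<union> ?E3 \<union> ?E4) \<le> prob (?E1 \<union> ?E2 \<union> ?E3) + prob ?E4" by (rule measure_Un_le) measurable
        also have "prob (?E1 \<union> ?E2 \<union> ?E3) \<le> prob (?E1 \<union> ?E2) + prob ?E3" by (rule measure_Un_le) measurable
        also have "prob (?E1 \<union> ?E2) \<le> prob ?E1 + prob ?E2" by (rule measure_Un_le) measurable
        also have "prob ?E1 + prob ?E2 + prob ?E3 + prob ?E4 + prob ?E5 \<le> R N"
          unfolding R_def using P1 P4 P5 by linarith
        finally show ?case using elim by simp
      qed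
    qed (unfold avg_def, measurable)
  qed
qed

subsection \<open>Uniformity of the hereditary weak law\<close>

text \<open>A single term is the difference of two consecutive partial sums, and the weak law
  together with \<open>\<bar>D k\<bar> \<le> k\<close> bounds the partial sum of length k by k (k +
  1) up to small probability. Without tightness one could choose a subsequence whose term at each
  position N beats these bounds with probability more than \<delta>.\<close>

lemma hereditary_imp_tight:
  fixes g :: "nat \<Rightarrow> 'a \<Rightarrow> real"
  assumes g[measurable]: "\<And>n. g n \<in> borel_measurable M" and D[measurable]: "\<And>N. D N \<in> borel_measurable M"
    and Db: "AE \<omega> in M. \<forall>N\<ge>1. \<bar>D N \<omega>\<bar> \<le> real N"
    and conv: "\<And>m :: nat \<Rightarrow> nat. strict_mono m \<Longrightarrow> conv_in_prob M (\<lambda>N \<omega>. avg g m N \<omega> - D N \<omega>)"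
    and \<delta>: "0 < \<delta>"
  shows "\<exists>L. \<forall>n. prob {\<omega>\<in>space M. L < \<bar>g n \<omega>\<bar>} \<le> \<delta>"
proof (rule ccontr)
  assume no: "\<not> ?thesis"
  have ex: "\<exists>n>k. \<delta> < prob {\<omega>\<in>space M. L < \<bar>g n \<omega>\<bar>}" for L k
  proof (rule ccontr)
    assume "\<not> ?thesis"
    then have "prob {\<omega>\<in>space M. L < \<bar>g n \<omega>\<bar>} \<le> \<delta>" if "Suc k \<le> n" for n
      using that by (meson Suc_le_lessD not_less)
    from tight_of_eventually[of g \<delta> "Suc k" L, OF g \<delta> this] no show False by metis
  qed
  \<comment> \<open>At least (N + 1) (N + 2) + N (N + 1), the sum of the bounds for the partial sums
    of lengths N + 1 and N.\<close>
  define l where "l N = 2 * (real N + 1) * (real N + 2)" for N :: nat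
  have "\<exists>m. \<forall>N. \<delta> < prob {\<omega>\<in>space M. l N < \<bar>g (m N) \<omega>\<bar>} \<and> m N < m (Suc N)"
    by (rule dependent_nat_choice) (use ex in blast)+
  then obtain m where m1: "\<And>N. \<delta> < prob {\<omega>\<in>space M. l N < \<bar>g (m N) \<omega>\<bar>}" and m2: "\<And>N. m N < m (Suc N)"
    by blast
  have m: "strict_mono m" using m2 by (simp add: strict_mono_Suc_iff)
  have meas[measurable]: "(\<lambda>\<omega>. avg g m N \<omega> - D N \<omega>) \<in> borel_measurable M" for N unfolding avg_def by measurable
  have ev: "eventually (\<lambda>N. prob {\<omega>\<in>space M. 1 < \<bar>avg g m N \<omega> - D N \<omega>\<bar>} < \<delta> / 2) sequentially"
    using conv_in_probD[OF conv[OF m] meas, of 1 "\<delta> / 2"] \<delta> by simp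
  obtain N where N: "1 \<le> N" "prob {\<omega>\<in>space M. 1 < \<bar>avg g m N \<omega> - D N \<omega>\<bar>} < \<delta> / 2"
      "prob {\<omega>\<in>space M. 1 < \<bar>avg g m (Suc N) \<omega> - D (Suc N) \<omega>\<bar>} < \<delta> / 2"
    using eventually_happens'[OF sequentially_bot eventually_conj[OF eventually_ge_at_top[of 1]
      eventually_conj[OF ev eventually_sequentially_Suc[THEN iffD2, OF ev]]]] by auto
  let ?E = "\<lambda>N. {\<omega>\<in>space M. 1 < \<bar>avg g m N \<omega> - D N \<omega>\<bar>}"
  have "prob {\<omega>\<in>space M. l N < \<bar>g (m N) \<omega>\<bar>} \<le> prob (?E N \<union> ?E (Suc N))"
  proof (rule finite_measure_mono_AE)
    show "AE \<omega> in M. \<omega> \<in> {\<omega>\<in>space M. l N < \<bar>g (m N) \<omega>\<bar>} \<longrightarrow> \<omega> \<in> ?E N \<union> ?E (Suc N)"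
      using Db
    proof eventually_elim
      case (elim \<omega>)
      note b = elim
      show ?case
      proof (rule impI, rule ccontr)
      assume w: "\<omega> \<in> {\<omega>\<in>space M. l N < \<bar>g (m N) \<omega>\<bar>}"
        and n: "\<omega> \<notin> ?E N \<union> ?E (Suc N)"
      have S: "\<bar>\<Sum>n<k. g (m n) \<omega>\<bar> \<le> real k * (real k + 1)" if "1 \<le> k" "\<omega> \<notin> ?E k" for k
      proof -
        have "\<bar>avg g m k \<omega> - D k \<omega>\<bar> \<le> 1" using that w by auto
        moreover have "\<bar>D k \<omega>\<bar> \<le> real k" using b that by simp
        ultimately have "\<bar>avg g m k \<omega>\<bar> \<le> real k + 1" by linarith
        then have "real k * \<bar>avg g m k \<omega>\<bar> \<le> real k * (real k + 1)" by (intro mult_left_mono) auto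
        moreover have "(\<Sum>n<k. g (m n) \<omega>) = real k * avg g m k \<omega>" using that by (simp add: avg_def)
        ultimately show ?thesis by (simp add: abs_mult)
      qed
      have "g (m N) \<omega> = (\<Sum>n<Suc N. g (m n) \<omega>) - (\<Sum>n<N. g (m n) \<omega>)" by simp
      then have "\<bar>g (m N) \<omega>\<bar> \<le> real (Suc N) * (real (Suc N) + 1) + real N * (real N + 1)"
        using S[of N] S[of "Suc N"] N(1) n by simp
      also have "\<dots> \<le> l N" unfolding l_def by (simp add: algebra_simps)
      finally show False using w by simp
      qed
    qed
  qed measurable
  also have "\<dots> \<le> prob (?E N) + prob (?E (Suc N))" by (rule measure_Un_le) measurable
  also have "\<dots> < \<delta>" using N by simp
  finally show False using m1[of N] by simp
qed

text \<open>The threshold T depends on the number p of terms but not on which terms they are;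
  tightness supplies one level \<open>L\<close> for all of them.\<close>

lemma prefix_negligible:
  fixes g :: "nat \<Rightarrow> 'a \<Rightarrow> real"
  assumes g[measurable]: "\<And>n. g n \<in> borel_measurable M"
    and tight: "\<And>\<delta>. 0 < \<delta> \<Longrightarrow> \<exists>L. \<forall>n. prob {\<omega>\<in>space M. L < \<bar>g n \<omega>\<bar>} \<le> \<delta>"
    and e: "0 < \<epsilon>"
  shows "\<exists>T::nat. \<forall>N\<ge>T. \<forall>x::nat \<Rightarrow> nat. prob {\<omega>\<in>space M. \<epsilon> * real N < (\<Sum>i<p. \<bar>g (x i) \<omega>\<bar>)} \<le> \<epsilon>"
proof -
  have "0 < \<epsilon> / (real p + 1)" using e by simp
  from tight[OF this] obtain L where L: "\<And>n. prob {\<omega>\<in>space M. L < \<bar>g n \<omega>\<bar>} \<le> \<epsilon> / (real p + 1)" by blast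
  obtain T :: nat where T: "real p * L / \<epsilon> \<le> real T" using real_arch_simple by blast
  show ?thesis
  proof (intro exI allI impI)
    fix N :: nat and x :: "nat \<Rightarrow> nat" assume "T \<le> N"
    then have "real p * L / \<epsilon> \<le> real N" using T by linarith
    then have N: "real p * L \<le> \<epsilon> * real N" using e by (simp add: pos_divide_le_eq mult.commute)
    have "{\<omega>\<in>space M. \<epsilon> * real N < (\<Sum>i<p. \<bar>g (x i) \<omega>\<bar>)} \<subseteq> (\<Union>i<p. {\<omega>\<in>space M. L < \<bar>g (x i) \<omega>\<bar>})"
    proof (rule subsetI, rule ccontr)
      fix \<omega> assume w: "\<omega> \<in> {\<omega>\<in>space M. \<epsilon> * real N < (\<Sum>i<p. \<bar>g (x i) \<omega>\<bar>)}"
        and "\<omega> \<notin> (\<Union>i<p. {\<omega>\<in>space M. L < \<bar>g (x i) \<omega>\<bar>})"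
      then have "(\<Sum>i<p. \<bar>g (x i) \<omega>\<bar>) \<le> (\<Sum>i<p. L)" by (intro sum_mono) (auto simp: not_less)
      with w N show False by simp
    qed
    then have "prob {\<omega>\<in>space M. \<epsilon> * real N < (\<Sum>i<p. \<bar>g (x i) \<omega>\<bar>)} \<le> prob (\<Union>i<p. {\<omega>\<in>space M. L < \<bar>g (x i) \<omega>\<bar>})"
      by (intro finite_measure_mono) auto
    also have "\<dots> \<le> (\<Sum>i<p. prob {\<omega>\<in>space M. L < \<bar>g (x i) \<omega>\<bar>})"
      by (rule finite_measure_subadditive_finite) auto
    also have "\<dots> \<le> (\<Sum>i<p. \<epsilon> / (real p + 1))" by (intro sum_mono L)
    also have "\<dots> \<le> \<epsilon>" using e by (simp add: field_simps)
    finally show "prob {\<omega>\<in>space M. \<epsilon> * real N < (\<Sum>i<p. \<bar>g (x i) \<omega>\<bar>)} \<le> \<epsilon>" .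
  qed
qed

lemma avg_change_prefix:
  fixes g :: "nat \<Rightarrow> 'a \<Rightarrow> real" and m v :: "nat \<Rightarrow> nat"
  assumes "1 \<le> N" "p \<le> N" and eq: "\<And>i. p \<le> i \<Longrightarrow> v i = m i"
  shows "\<bar>avg g m N \<omega> - avg g v N \<omega>\<bar> \<le> ((\<Sum>i<p. \<bar>g (m i) \<omega>\<bar>) + (\<Sum>i<p. \<bar>g (v i) \<omega>\<bar>)) / real N"
proof -
  have s: "(\<Sum>n<N. h n) = (\<Sum>n<p. h n) + (\<Sum>n=p..<N. h n)" for h :: "nat \<Rightarrow> real"
    using sum.atLeastLessThan_concat[of 0 p N h] assms(2) by (simp add: lessThan_atLeast0)
  have "(\<Sum>n=p..<N. g (m n) \<omega>) = (\<Sum>n=p..<N. g (v n) \<omega>)" using eq by (intro sum.cong) auto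
  then have "avg g m N \<omega> - avg g v N \<omega> = ((\<Sum>i<p. g (m i) \<omega>) - (\<Sum>i<p. g (v i) \<omega>)) / real N"
    unfolding avg_def s[of "\<lambda>n. g (m n) \<omega>"] s[of "\<lambda>n. g (v n) \<omega>"] by (simp add: diff_divide_distrib add_divide_distrib)
  then have "\<bar>avg g m N \<omega> - avg g v N \<omega>\<bar> = \<bar>(\<Sum>i<p. g (m i) \<omega>) - (\<Sum>i<p. g (v i) \<omega>)\<bar> / real N"
    by (simp only: abs_divide abs_of_nat)
  also have "\<bar>(\<Sum>i<p. g (m i) \<omega>) - (\<Sum>i<p. g (v i) \<omega>)\<bar> \<le> (\<Sum>i<p. \<bar>g (m i) \<omega>\<bar>) + (\<Sum>i<p. \<bar>g (v i) \<omega>\<bar>)"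
    using sum_abs[of "\<lambda>i. g (m i) \<omega>" "{..<p}"] sum_abs[of "\<lambda>i. g (v i) \<omega>" "{..<p}"] by linarith
  finally show ?thesis by (simp add: divide_right_mono)
qed

lemma strict_mono_splice:
  fixes u m :: "nat \<Rightarrow> nat"
  assumes "strict_mono u" "strict_mono m" "u p \<le> m 0"
  shows "strict_mono (\<lambda>i. if i < p then u i else m i)"
proof (rule strict_monoI)
  fix i j :: nat assume ij: "i < j"
  have "u i < m j" if "i < p"
  proof -
    have "u i < u p" using assms(1) that by (simp add: strict_mono_less)
    also have "u p \<le> m 0" by fact
    also have "m 0 \<le> m j" using assms(2) by (simp add: strict_mono_less_eq)
    finally show ?thesis .
  qed
  then show "(if i < p then u i else m i) < (if j < p then u j else m j)"
    using ij assms(1,2) by (auto simp: strict_mono_less)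
qed

lemma strict_mono_diagonal:
  fixes u :: "nat \<Rightarrow> nat \<Rightarrow> nat" and p :: "nat \<Rightarrow> nat"
  assumes u: "\<And>l. strict_mono (u l)" and p: "\<And>l. p l < p (Suc l)"
    and agree: "\<And>l i. i < p l \<Longrightarrow> u (Suc l) i = u l i"
  obtains v where "strict_mono v" "\<And>l i. i < p l \<Longrightarrow> v i = u l i"
proof -
  have pm: "strict_mono p" using p by (simp add: strict_mono_Suc_iff)
  have pl: "l \<le> p l" for l using pm by (rule strict_mono_imp_increasing)
  have ag: "u (l + d) i = u l i" if "i < p l" for l d i
  proof (induct d)
    case (Suc d)
    have "p l \<le> p (l + d)" using pm by (simp add: strict_mono_less_eq)
    then have "u (Suc (l + d)) i = u (l + d) i" using that by (intro agree) simp
    then show ?case using Suc by simp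
  qed simp
  \<comment> \<open>Level \<open>Suc i\<close> has already fixed the value at i, since
    \<open>i < p (Suc i)\<close>.\<close>
  define v where "v i = u (Suc i) i" for i
  have v: "v i = u l i" if "i < p l" for l i
  proof (cases "l \<le> Suc i")
    case True
    then show ?thesis using ag[OF that, of "Suc i - l"] by (simp add: v_def)
  next
    case False
    have "i < p (Suc i)" using pl[of "Suc i"] by simp
    from ag[OF this, of "l - Suc i"] False show ?thesis by (simp add: v_def)
  qed
  show thesis
  proof (rule that[OF _ v])
    show "strict_mono v"
    proof (subst strict_mono_Suc_iff, rule allI)
      fix i
      have "Suc i < p (Suc (Suc i))" using pl[of "Suc (Suc i)"] by simp
      then have "v i = u (Suc (Suc i)) i" "v (Suc i) = u (Suc (Suc i)) (Suc i)" by (auto intro!: v)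
      then show "v i < v (Suc i)" using u by (simp add: strict_mono_less)
    qed
  qed
qed

text \<open>Gliding hump: otherwise bad initial segments, each far longer than the indices chosen before, can be
concatenated into one subsequence violating the weak law.\<close>

lemma hereditary_imp_uniform:
  fixes g :: "nat \<Rightarrow> 'a \<Rightarrow> real"
  assumes g[measurable]: "\<And>n. g n \<in> borel_measurable M" and D[measurable]: "\<And>N. D N \<in> borel_measurable M"
    and tight: "\<And>\<delta>. 0 < \<delta> \<Longrightarrow> \<exists>L. \<forall>n. prob {\<omega>\<in>space M. L < \<bar>g n \<omega>\<bar>} \<le> \<delta>"
    and conv: "\<And>m :: nat \<Rightarrow> nat. strict_mono m \<Longrightarrow> conv_in_prob M (\<lambda>N \<omega>. avg g m N \<omega> - D N \<omega>)"
    and e: "0 < \<epsilon>"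
  shows "\<exists>N0 K. \<forall>N\<ge>N0. \<forall>m :: nat \<Rightarrow> nat. strict_mono m \<longrightarrow> K \<le> m 0 \<longrightarrow>
    prob {\<omega>\<in>space M. \<epsilon> < \<bar>avg g m N \<omega> - D N \<omega>\<bar>} \<le> \<epsilon>"
proof (rule ccontr)
  assume no: "\<not> ?thesis"
  have meas[measurable]: "avg g m N \<in> borel_measurable M" for m :: "nat \<Rightarrow> nat" and N
    unfolding avg_def[abs_def] by measurable
  have ex: "\<exists>N\<ge>N0. \<exists>m :: nat \<Rightarrow> nat. strict_mono m \<and> K \<le> m 0 \<and>
      \<epsilon> < prob {\<omega>\<in>space M. \<epsilon> < \<bar>avg g m N \<omega> - D N \<omega>\<bar>}" for N0 K
    using no by (meson not_less)
  \<comment> \<open>Half of \<epsilon> is left after the first p indices are replaced: the old and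
    the new prefix each cost \<epsilon> / 4 in size and in probability.\<close>
  define bad where "bad v N \<longleftrightarrow> \<epsilon> / 2 < prob {\<omega>\<in>space M. \<epsilon> / 2 < \<bar>avg g v N \<omega> - D N \<omega>\<bar>}" for v :: "nat \<Rightarrow> nat" and N
  have step: "\<exists>v N. strict_mono v \<and> p < N \<and> (\<forall>i<p. v i = u i) \<and> bad v N" if u: "strict_mono u" for u :: "nat \<Rightarrow> nat" and p
  proof -
    have "0 < \<epsilon> / 4" using e by simp
    from prefix_negligible[OF g tight this, of p] obtain T where
      T: "\<And>N x. T \<le> N \<Longrightarrow> prob {\<omega>\<in>space M. \<epsilon> / 4 * real N < (\<Sum>i<p. \<bar>g (x i) \<omega>\<bar>)} \<le> \<epsilon> / 4" by blast
    obtain N m where N: "max T (Suc p) \<le> N" and m: "strict_mono m" "u p \<le> m 0"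
      and B: "\<epsilon> < prob {\<omega>\<in>space M. \<epsilon> < \<bar>avg g m N \<omega> - D N \<omega>\<bar>}" using ex by blast
    let ?v = "\<lambda>i. if i < p then u i else m i"
    let ?E = "\<lambda>x :: nat \<Rightarrow> nat. {\<omega>\<in>space M. \<epsilon> / 4 * real N < (\<Sum>i<p. \<bar>g (x i) \<omega>\<bar>)}"
    let ?A = "{\<omega>\<in>space M. \<epsilon> / 2 < \<bar>avg g ?v N \<omega> - D N \<omega>\<bar>}"
    have N1: "1 \<le> N" "p \<le> N" "T \<le> N" using N by auto
    have "{\<omega>\<in>space M. \<epsilon> < \<bar>avg g m N \<omega> - D N \<omega>\<bar>} \<subseteq> ?A \<union> ?E m \<union> ?E ?v"
    proof (rule subsetI, rule ccontr)
      fix \<omega> assume w: "\<omega> \<in> {\<omega>\<in>space M. \<epsilon> < \<bar>avg g m N \<omega> - D N \<omega>\<bar>}" and n: "\<omega> \<notin> ?A \<union> ?E m \<union> ?E ?v"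
      then have sp: "\<omega> \<in> space M" by simp
      have n1: "\<bar>avg g ?v N \<omega> - D N \<omega>\<bar> \<le> \<epsilon> / 2" using n sp by simp
      have n2: "(\<Sum>i<p. \<bar>g (m i) \<omega>\<bar>) \<le> \<epsilon> / 4 * real N" "(\<Sum>i<p. \<bar>g (?v i) \<omega>\<bar>) \<le> \<epsilon> / 4 * real N"
        using n sp by (auto simp: not_less)
      have "\<bar>avg g m N \<omega> - avg g ?v N \<omega>\<bar> \<le> ((\<Sum>i<p. \<bar>g (m i) \<omega>\<bar>) + (\<Sum>i<p. \<bar>g (?v i) \<omega>\<bar>)) / real N"
        by (rule avg_change_prefix[OF N1(1,2)]) auto
      also have "\<dots> \<le> (\<epsilon> / 4 * real N + \<epsilon> / 4 * real N) / real N"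
        by (intro divide_right_mono add_mono n2) auto
      also have "\<dots> = \<epsilon> / 2" using N1(1) by (simp add: field_simps)
      finally have n3: "\<bar>avg g m N \<omega> - avg g ?v N \<omega>\<bar> \<le> \<epsilon> / 2" .
      have "\<epsilon> < \<bar>avg g m N \<omega> - D N \<omega>\<bar>" using w by simp
      then show False using n1 n3 by linarith
    qed
    then have "prob {\<omega>\<in>space M. \<epsilon> < \<bar>avg g m N \<omega> - D N \<omega>\<bar>} \<le> prob (?A \<union> ?E m \<union> ?E ?v)"
      by (intro finite_measure_mono) measurable
    also have "\<dots> \<le> prob (?A \<union> ?E m) + prob (?E ?v)" by (rule measure_Un_le) measurable
    also have "prob (?A \<union> ?E m) \<le> prob ?A + prob (?E m)" by (rule measure_Un_le) measurable
    finally have "bad ?v N" unfolding bad_def using B T[OF N1(3), of m] T[OF N1(3), of ?v] by linarith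
    moreover have "strict_mono ?v" by (rule strict_mono_splice[OF u m])
    ultimately show ?thesis using N by (intro exI[of _ ?v] exI[of _ N]) auto
  qed
  \<comment> \<open>A state is a sequence together with the length of its frozen initial segment.
    Badness at that length involves only frozen indices, so it survives all later steps.\<close>
  have "\<exists>s. \<forall>l. strict_mono (fst (s l)) \<and> (snd (s l) < snd (s (Suc l)) \<and>
      (\<forall>i<snd (s l). fst (s (Suc l)) i = fst (s l) i) \<and> bad (fst (s (Suc l))) (snd (s (Suc l))))"
  proof (rule dependent_nat_choice)
    show "\<exists>x :: (nat \<Rightarrow> nat) \<times> nat. strict_mono (fst x)" by (intro exI[of _ "(id, 0)"]) (simp add: strict_mono_def)
    fix x :: "(nat \<Rightarrow> nat) \<times> nat" and l :: nat assume "strict_mono (fst x)"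
    from step[OF this, of "snd x"] obtain v N where "strict_mono v" "snd x < N" "\<forall>i<snd x. v i = fst x i" "bad v N" by blast
    then show "\<exists>y. strict_mono (fst y) \<and> snd x < snd y \<and> (\<forall>i<snd x. fst y i = fst x i) \<and> bad (fst y) (snd y)"
      by (intro exI[of _ "(v, N)"]) simp
  qed
  then obtain s where s: "\<And>l. strict_mono (fst (s l))" "\<And>l. snd (s l) < snd (s (Suc l))"
    "\<And>l i. i < snd (s l) \<Longrightarrow> fst (s (Suc l)) i = fst (s l) i" "\<And>l. bad (fst (s (Suc l))) (snd (s (Suc l)))" by blast
  obtain v where v: "strict_mono v" "\<And>l i. i < snd (s l) \<Longrightarrow> v i = fst (s l) i"
    using strict_mono_diagonal[of "\<lambda>l. fst (s l)" "\<lambda>l. snd (s l)", OF s(1-3)] by blast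
  have "0 < \<epsilon> / 2" using e by simp
  from conv_in_probD[OF conv[OF v(1)] _ this this]
  obtain N1 where N1: "\<And>N. N1 \<le> N \<Longrightarrow> prob {\<omega>\<in>space M. \<epsilon> / 2 < \<bar>avg g v N \<omega> - D N \<omega>\<bar>} < \<epsilon> / 2"
    by (auto simp: eventually_sequentially)
  have "strict_mono (\<lambda>l. snd (s l))" using s(2) by (simp add: strict_mono_Suc_iff)
  then have "Suc N1 \<le> snd (s (Suc N1))" by (rule strict_mono_imp_increasing)
  then have "prob {\<omega>\<in>space M. \<epsilon> / 2 < \<bar>avg g v (snd (s (Suc N1))) \<omega> - D (snd (s (Suc N1))) \<omega>\<bar>} < \<epsilon> / 2"
    by (intro N1) simp
  moreover have "avg g v (snd (s (Suc N1))) \<omega> = avg g (fst (s (Suc N1))) (snd (s (Suc N1))) \<omega>" for \<omega>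
    unfolding avg_def using v(2)[of _ "Suc N1"] by (intro arg_cong2[where f="(/)"] sum.cong) auto
  ultimately show False using s(4)[of N1] by (simp add: bad_def)
qed

section \<open>Weak limits of products along increasing indices\<close>

lemma wk_conv_integral_complex:
  fixes Z :: "'a \<Rightarrow> complex" and X :: "nat \<Rightarrow> 'a \<Rightarrow> complex"
  assumes w: "wk_conv M X Y" and Z: "integrable M Z"
    and X[measurable]: "\<And>n. X n \<in> borel_measurable M"
    and Y[measurable]: "Y \<in> borel_measurable M"
    and bX: "\<And>n \<omega>. \<omega> \<in> space M \<Longrightarrow> norm (X n \<omega>) \<le> C"
    and bY: "\<And>\<omega>. \<omega> \<in> space M \<Longrightarrow> norm (Y \<omega>) \<le> C"
  shows "(\<lambda>n. \<integral>\<omega>. Z \<omega> * X n \<omega> \<partial>M) \<longlonglongrightarrow> (\<integral>\<omega>. Z \<omega> * Y \<omega> \<partial>M)"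
proof -
  have e: "(\<integral>\<omega>. Z \<omega> * W \<omega> \<partial>M) = (\<integral>\<omega>. Re (Z \<omega>) *\<^sub>R W \<omega> \<partial>M) + \<i> * (\<integral>\<omega>. Im (Z \<omega>) *\<^sub>R W \<omega> \<partial>M)"
    if "W \<in> borel_measurable M" "\<And>\<omega>. \<omega> \<in> space M \<Longrightarrow> norm (W \<omega>) \<le> C" for W :: "'a \<Rightarrow> complex"
  proof -
    have I: "integrable M (\<lambda>\<omega>. Re (Z \<omega>) *\<^sub>R W \<omega>)" "integrable M (\<lambda>\<omega>. Im (Z \<omega>) *\<^sub>R W \<omega>)"
      using that Z by (auto intro!: integrable_scaleR_bdd)
    have "(\<integral>\<omega>. Z \<omega> * W \<omega> \<partial>M) = (\<integral>\<omega>. Re (Z \<omega>) *\<^sub>R W \<omega> + \<i> * (Im (Z \<omega>) *\<^sub>R W \<omega>) \<partial>M)"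
      by (intro Bochner_Integration.integral_cong) (auto simp: complex_eq_iff)
    also have "\<dots> = (\<integral>\<omega>. Re (Z \<omega>) *\<^sub>R W \<omega> \<partial>M) + (\<integral>\<omega>. \<i> * (Im (Z \<omega>) *\<^sub>R W \<omega>) \<partial>M)"
      using I by (intro Bochner_Integration.integral_add integrable_mult_right) auto
    also have "(\<integral>\<omega>. \<i> * (Im (Z \<omega>) *\<^sub>R W \<omega>) \<partial>M) = \<i> * (\<integral>\<omega>. Im (Z \<omega>) *\<^sub>R W \<omega> \<partial>M)"
      by (rule integral_mult_right_zero)
    finally show ?thesis .
  qed
  have "integrable M (\<lambda>\<omega>. Re (Z \<omega>))" "integrable M (\<lambda>\<omega>. Im (Z \<omega>))" using Z by auto
  note L = wk_conv_integral[OF w this(1) X Y bX bY] wk_conv_integral[OF w this(2) X Y bX bY]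
  have "(\<lambda>n. \<integral>\<omega>. Z \<omega> * X n \<omega> \<partial>M) = (\<lambda>n. (\<integral>\<omega>. Re (Z \<omega>) *\<^sub>R X n \<omega> \<partial>M) + \<i> * (\<integral>\<omega>. Im (Z \<omega>) *\<^sub>R X n \<omega> \<partial>M))"
    by (intro ext e X bX)
  moreover have "(\<lambda>n. (\<integral>\<omega>. Re (Z \<omega>) *\<^sub>R X n \<omega> \<partial>M) + \<i> * (\<integral>\<omega>. Im (Z \<omega>) *\<^sub>R X n \<omega> \<partial>M))
      \<longlonglongrightarrow> (\<integral>\<omega>. Re (Z \<omega>) *\<^sub>R Y \<omega> \<partial>M) + \<i> * (\<integral>\<omega>. Im (Z \<omega>) *\<^sub>R Y \<omega> \<partial>M)"
    by (intro tendsto_add tendsto_mult tendsto_const L)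
  ultimately show ?thesis using e[OF Y bY] by simp
qed

text \<open>The limits are taken from the last index inwards: with the earlier indices fixed, they contribute
a bounded weight to which weak convergence of the last factor applies.\<close>

lemma iterated_weak_limits:
  fixes g :: "nat \<Rightarrow> 'a \<Rightarrow> real" and u :: "nat \<Rightarrow> real \<Rightarrow> complex" and U :: "nat \<Rightarrow> 'a \<Rightarrow> complex"
  assumes g[measurable]: "\<And>n. g n \<in> borel_measurable M"
    and u[measurable]: "\<And>c. u c \<in> borel_measurable borel" and ub: "\<And>c x. norm (u c x) \<le> 1"
    and U[measurable]: "\<And>c. U c \<in> borel_measurable M" and Ub: "\<And>c \<omega>. \<omega> \<in> space M \<Longrightarrow> norm (U c \<omega>) \<le> 1"
    and w: "\<And>c. wk_conv M (\<lambda>n \<omega>. u c (g n \<omega>)) (U c)"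
    and Z: "Z \<in> borel_measurable M" and Zb: "\<And>\<omega>. \<omega> \<in> space M \<Longrightarrow> norm (Z \<omega>) \<le> 1"
    and hyp: "\<And>j :: nat \<Rightarrow> nat. strict_mono j \<Longrightarrow> K \<le> j 0 \<Longrightarrow>
       norm ((\<integral>\<omega>. Z \<omega> * (\<Prod>c<L. u c (g (j c) \<omega>)) \<partial>M) - a) \<le> \<delta>"
  shows "norm ((\<integral>\<omega>. Z \<omega> * (\<Prod>c<L. U c \<omega>) \<partial>M) - a) \<le> \<delta>"
  using Z Zb hyp
proof (induct L arbitrary: Z)
  case 0
  \<comment> \<open>The empty product does not involve the indices, so any increasing sequence
    starting at \<open>K\<close> will do.\<close>
  from 0(3)[of "\<lambda>i. K + i"] show ?case by (simp add: strict_mono_def)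
next
  case (Suc L)
  note [measurable] = Suc(2)
  have "norm ((\<integral>\<omega>. (Z \<omega> * U L \<omega>) * (\<Prod>c<L. U c \<omega>) \<partial>M) - a) \<le> \<delta>"
  proof (rule Suc(1))
    show "(\<lambda>\<omega>. Z \<omega> * U L \<omega>) \<in> borel_measurable M" by measurable
    show "norm (Z \<omega> * U L \<omega>) \<le> 1" if "\<omega> \<in> space M" for \<omega>
      using Suc(3)[OF that] Ub[OF that, of L] by (simp add: norm_mult mult_le_one)
    fix j :: "nat \<Rightarrow> nat" assume j: "strict_mono j" "K \<le> j 0"
    let ?P = "\<lambda>\<omega>. Z \<omega> * (\<Prod>c<L. u c (g (j c) \<omega>))"
    have "integrable M ?P"
    proof (rule integrable_const_bound[where B=1])
      show "AE \<omega> in M. norm (?P \<omega>) \<le> 1"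
      proof (rule AE_I2)
        fix \<omega> assume "\<omega> \<in> space M"
        moreover have "(\<Prod>c<L. norm (u c (g (j c) \<omega>))) \<le> 1" by (intro prod_le_1) (auto simp: ub)
        ultimately show "norm (?P \<omega>) \<le> 1"
          using Suc(3) by (auto simp: norm_mult prod_norm[symmetric] intro!: mult_le_one prod_nonneg)
      qed
    qed measurable
    from wk_conv_integral_complex[OF w this, of L 1]
    have lim: "(\<lambda>n. norm ((\<integral>\<omega>. ?P \<omega> * u L (g n \<omega>) \<partial>M) - a)) \<longlonglongrightarrow> norm ((\<integral>\<omega>. ?P \<omega> * U L \<omega> \<partial>M) - a)"
      using ub Ub by (intro tendsto_intros) auto
    have "norm ((\<integral>\<omega>. ?P \<omega> * u L (g n \<omega>) \<partial>M) - a) \<le> \<delta>" if n: "j L + L \<le> n" for n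
    proof -
      \<comment> \<open>Position L receives n and the later positions the numbers after n. The
        requirement \<open>j L + L \<le> n\<close> keeps the spliced sequence increasing, because
        its second piece is \<open>n - L + c\<close>.\<close>
      let ?j = "\<lambda>c. if c < L then j c else n - L + c"
      have sm: "strict_mono ?j" by (rule strict_mono_splice[OF j(1)]) (use n in \<open>auto simp: strict_mono_def\<close>)
      have eqP: "(\<Prod>c<L. u c (g (?j c) \<omega>)) = (\<Prod>c<L. u c (g (j c) \<omega>))" for \<omega> by (rule prod.cong) auto
      have jL: "?j L = n" using n by simp
      have "K \<le> ?j 0" using j n by auto
      from Suc(4)[OF sm this] show ?thesis
        unfolding prod.lessThan_Suc eqP jL by (simp add: mult.assoc)
    qed
    then have "norm ((\<integral>\<omega>. ?P \<omega> * U L \<omega> \<partial>M) - a) \<le> \<delta>"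
      by (intro LIMSEQ_le_const2[OF lim]) blast
    moreover have "?P \<omega> * U L \<omega> = Z \<omega> * U L \<omega> * (\<Prod>c<L. u c (g (j c) \<omega>))" for \<omega> by (simp add: mult_ac)
    ultimately show "norm ((\<integral>\<omega>. Z \<omega> * U L \<omega> * (\<Prod>c<L. u c (g (j c) \<omega>)) \<partial>M) - a) \<le> \<delta>" by simp
  qed
  then show ?case by (simp add: mult_ac)
qed

end

subsection \<open>Truncated second moments and characteristic functions\<close>

lemma set_integrable_Icc_bounded:
  fixes f :: "real \<Rightarrow> real"
  assumes [measurable]: "f \<in> borel_measurable borel" and b: "\<And>x. \<bar>f x\<bar> \<le> C"
  shows "set_integrable lborel {a..b} f"
  unfolding set_integrable_def
proof (rule Bochner_Integration.integrable_bound[of lborel "\<lambda>x. C * indicator {a..b} x"])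
  show "integrable lborel (\<lambda>x. C * indicator {a..b} x)"
    by (intro integrable_mult_right integrable_real_indicator) (auto simp: emeasure_lborel_Icc_eq)
  show "AE x in lborel. norm (indicat_real {a..b} x *\<^sub>R f x) \<le> norm (C * indicat_real {a..b} x)"
  proof (rule AE_I2)
    fix x show "norm (indicat_real {a..b} x *\<^sub>R f x) \<le> norm (C * indicat_real {a..b} x)"
      using b[of x] by (auto simp: indicator_def)
  qed
qed measurable

lemma Fubini_bounded_Icc:
  fixes f :: "'a \<Rightarrow> real \<Rightarrow> real"
  assumes P: "prob_space P" and f[measurable]: "(\<lambda>(x, s). f x s) \<in> borel_measurable (P \<Otimes>\<^sub>M borel)"
    and b: "\<And>x s. \<bar>f x s\<bar> \<le> C"
  shows "(\<integral>x. (\<integral>s\<in>{a..b}. f x s \<partial>lborel) \<partial>P) = (\<integral>s\<in>{a..b}. (\<integral>x. f x s \<partial>P) \<partial>lborel)"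
proof -
  interpret P: prob_space P by fact
  interpret pair_sigma_finite P lborel ..
  let ?h = "\<lambda>x s. indicator {a..b} s *\<^sub>R f x s"
  have "integrable (P \<Otimes>\<^sub>M lborel) (\<lambda>(x, s). ?h x s)"
  proof (rule Bochner_Integration.integrable_bound[of _ "\<lambda>z. C * indicator (space P \<times> {a..b}) z"])
    show "integrable (P \<Otimes>\<^sub>M lborel) (\<lambda>z. C * indicator (space P \<times> {a..b}) z)"
    proof (intro integrable_mult_right integrable_real_indicator)
      show "space P \<times> {a..b} \<in> sets (P \<Otimes>\<^sub>M lborel)" by measurable
      have "emeasure (P \<Otimes>\<^sub>M lborel) (space P \<times> {a..b}) = emeasure P (space P) * emeasure lborel {a..b}"
        by (rule lborel.emeasure_pair_measure_Times) auto
      then show "emeasure (P \<Otimes>\<^sub>M lborel) (space P \<times> {a..b}) < \<infinity>"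
        by (simp add: P.emeasure_space_1 emeasure_lborel_Icc_eq)
    qed
    show "(\<lambda>(x, s). ?h x s) \<in> borel_measurable (P \<Otimes>\<^sub>M lborel)" by measurable
    show "AE z in P \<Otimes>\<^sub>M lborel. norm (case z of (x, s) \<Rightarrow> ?h x s) \<le> norm (C * indicat_real (space P \<times> {a..b}) z)"
    proof (rule AE_I2)
      fix z :: "'a \<times> real" assume z: "z \<in> space (P \<Otimes>\<^sub>M lborel)"
      obtain x s where zs: "z = (x, s)" by (cases z)
      then have "x \<in> space P" using z by (simp add: space_pair_measure)
      then show "norm (case z of (x, s) \<Rightarrow> ?h x s) \<le> norm (C * indicat_real (space P \<times> {a..b}) z)"
        using b[of x s] zs by (auto simp: indicator_def)
    qed
  qed
  from Fubini_integral[OF this]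
  have "(\<integral>s. (\<integral>x. ?h x s \<partial>P) \<partial>lborel) = (\<integral>x. (\<integral>s. ?h x s \<partial>lborel) \<partial>P)" by simp
  then show ?thesis by (simp add: set_lebesgue_integral_def)
qed

lemma set_integral_Icc_nonneg:
  fixes f :: "real \<Rightarrow> real"
  assumes "\<And>x. 0 \<le> f x" shows "0 \<le> (\<integral>s\<in>{a..b}. f s \<partial>lborel)"
  unfolding set_lebesgue_integral_def using assms by (intro Bochner_Integration.integral_nonneg) auto

lemma set_integral_const_unit: "(\<integral>s\<in>{0..1::real}. c \<partial>lborel) = (c::real)"
  by (simp add: set_lebesgue_integral_def)

lemma integral_2_2:
  fixes f g :: "'a \<Rightarrow> real"
  assumes "integrable M f" "integrable M g"
  shows "(\<integral>x. 2 * f x + 2 * g x \<partial>M) = 2 * (\<integral>x. f x \<partial>M) + 2 * (\<integral>x. g x \<partial>M)"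
  using assms by (subst Bochner_Integration.integral_add) auto

text \<open>For z \<noteq> 0 the integral is 1 - sin z / z. Up to modulus 2 the Taylor bound gives
  at least z^2 / 6 - z^4 / 120, which is at least z^2 (1 / 6 - 1 / 30); beyond 2 the value is at
  least 1 / 2. The constant 1 / 12 fits both cases.\<close>

lemma integral_one_minus_cos_ge:
  fixes z :: real
  shows
  "min 1 (z\<^sup>2) / 12 \<le> (\<integral>t\<in>{0..1}. 1 - cos (t * z) \<partial>lborel)"
proof (cases "z = 0")
  case True then show ?thesis by simp
next
  case False
  have "(\<integral>t. (1 - cos (t * z)) * indicator {0..1} t \<partial>lborel) = (1 - sin (1 * z) / z) - (0 - sin (0 * z) / z)"
    by (rule integral_FTC_Icc_real) (use False in \<open>auto intro!: derivative_eq_intros continuous_intros simp: field_simps\<close>)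
  then have I: "(\<integral>t\<in>{0..1}. 1 - cos (t * z) \<partial>lborel) = 1 - sin z / z"
    by (simp add: set_lebesgue_integral_def mult.commute)
  have sz: "sin z / z = sin \<bar>z\<bar> / \<bar>z\<bar>" by (simp add: abs_if)
  have zp: "0 < \<bar>z\<bar>" using False by simp
  have "min 1 (z\<^sup>2) / 12 \<le> 1 - sin \<bar>z\<bar> / \<bar>z\<bar>"
  proof (cases "\<bar>z\<bar> \<le> 2")
    case True
    let ?x = "\<bar>z\<bar>"
    have "\<bar>sin ?x - (\<Sum>m<5. sin_coeff m * ?x ^ m)\<bar> \<le> inverse (fact 5) * \<bar>?x\<bar> ^ 5"
      by (rule Maclaurin_sin_bound)
    moreover have "(\<Sum>m<5. sin_coeff m * ?x ^ m) = ?x - ?x ^ 3 / 6"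
      by (simp add: lessThan_nat_numeral sin_coeff_def fact_numeral)
    moreover have "inverse (fact 5) * \<bar>?x\<bar> ^ 5 = ?x ^ 5 / 120"
      by (simp add: fact_numeral)
    ultimately have "sin ?x \<le> ?x - ?x ^ 3 / 6 + ?x ^ 5 / 120"
      unfolding abs_le_iff by linarith
    also have "\<dots> = ?x * (1 - z\<^sup>2 / 6 + z\<^sup>2 * z\<^sup>2 / 120)"
      by (simp add: power2_eq_square numeral_eq_Suc algebra_simps flip: abs_mult)
    finally have "sin ?x / ?x \<le> 1 - z\<^sup>2 / 6 + z\<^sup>2 * z\<^sup>2 / 120"
      using zp by (simp add: pos_divide_le_eq mult.commute)
    moreover have "z\<^sup>2 * z\<^sup>2 \<le> 4 * z\<^sup>2"
      using True abs_le_square_iff[of z 2] by (intro mult_right_mono) auto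
    moreover have "min 1 (z\<^sup>2) \<le> z\<^sup>2" "0 \<le> z\<^sup>2" by auto
    ultimately show ?thesis by linarith
  next
    case False
    have "sin \<bar>z\<bar> / \<bar>z\<bar> \<le> 1 / \<bar>z\<bar>" by (intro divide_right_mono) auto
    also have "\<dots> \<le> 1 / 2" using False by (intro divide_left_mono) auto
    finally have "sin \<bar>z\<bar> / \<bar>z\<bar> \<le> 1 / 2" .
    moreover have "min 1 (z\<^sup>2) \<le> 1" by simp
    ultimately show ?thesis by linarith
  qed
  then show ?thesis using I sz by simp
qed

text \<open>In half angles this reads sin^2 (u - v) \<le> 2 sin^2 u + 2 sin^2 v. Integrated, it
  becomes the subadditivity of the defect.\<close>

lemma one_minus_cos_le: "1 - cos a \<le> 2 * (1 - cos (a + b)) + 2 * (1 - cos (b::real))"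
proof -
  have c: "1 - cos x = 2 * (sin (x / 2))\<^sup>2" for x :: real
    using cos_double_sin[of "x / 2"] by simp
  define u v where "u = (a + b) / 2" and "v = b / 2"
  have "sin (a / 2) = sin (u - v)" by (simp add: u_def v_def field_simps)
  also have "\<dots> = sin u * cos v - cos u * sin v" by (rule sin_diff)
  finally have e: "sin (a / 2) = sin u * cos v - cos u * sin v" .
  have "(sin (a / 2))\<^sup>2 \<le> 2 * (sin u * cos v)\<^sup>2 + 2 * (cos u * sin v)\<^sup>2"
    unfolding e using zero_le_power2[of "sin u * cos v + cos u * sin v"]
    by (simp add: power2_eq_square algebra_simps)
  also have "(sin u * cos v)\<^sup>2 \<le> (sin u)\<^sup>2 * 1"
    unfolding power_mult_distrib by (intro mult_left_mono) (auto simp: abs_square_le_1)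
  also have "(cos u * sin v)\<^sup>2 \<le> 1 * (sin v)\<^sup>2"
    unfolding power_mult_distrib by (intro mult_right_mono) (auto simp: abs_square_le_1)
  finally have "(sin (a / 2))\<^sup>2 \<le> 2 * (sin u)\<^sup>2 + 2 * (sin v)\<^sup>2" by simp
  then show ?thesis unfolding c[of a] c[of "a + b"] c[of b] u_def v_def by simp
qed

text \<open>Bernoulli's inequality for (1 + q)^N gives (1 - q)^N (1 + N q) \<le> (1 - q^2)^N \<le>
  1, so (1 - q)^N is at most 1 / (1 + N q).\<close>

lemma min_one_le_one_minus_power:
  assumes "0 \<le> q" "q \<le> (1::real)"
  shows "min 1 (real N * q) \<le> 2 * (1 - (1 - q) ^ N)"
proof -
  have "(1 - q) ^ N * (1 + real N * q) \<le> (1 - q) ^ N * (1 + q) ^ N"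
    using Bernoulli_inequality[of q N] assms by (intro mult_left_mono) auto
  also have "\<dots> = (1 - q\<^sup>2) ^ N" by (simp flip: power_mult_distrib add: power2_eq_square algebra_simps)
  also have "\<dots> \<le> 1" using assms by (intro power_le_one) (auto simp: abs_square_le_1)
  finally have le: "(1 - q) ^ N * (1 + real N * q) \<le> 1" .
  have x: "0 \<le> real N * q" using assms by simp
  define x where "x = real N * q"
  define y where "y = (1 - q) ^ N"
  have y0: "0 \<le> y" "y * (1 + x) \<le> 1" "0 \<le> x" using le assms x by (auto simp: x_def y_def)
  show ?thesis
  proof (cases "x \<le> 1")
    case True
    have "y \<le> 1 / (1 + x)" using y0 by (simp add: pos_le_divide_eq)
    also have "\<dots> \<le> 1 - x / 2"
    proof -
      have "x * x \<le> x * 1" using True y0 by (intro mult_left_mono) auto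
      then have "1 \<le> (1 - x / 2) * (1 + x)" by (simp add: algebra_simps)
      then show ?thesis using y0 by (simp add: pos_divide_le_eq)
    qed
    finally show ?thesis using True by (simp add: x_def y_def)
  next
    case False
    have "y * 2 \<le> y * (1 + x)" using False y0 by (intro mult_left_mono) auto
    then show ?thesis using y0 False by (simp add: x_def y_def)
  qed
qed

section \<open>The symmetrized characteristic function\<close>

definition chf :: "real measure \<Rightarrow> real \<Rightarrow> complex" where
  "chf \<mu> s = (\<integral>x. cis (s * x) \<partial>\<mu>)"

text \<open>One minus the characteristic function of X - Y at s, for independent X and Y of law
  \<open>\<mu>\<close>. It is real and insensitive to centering.\<close>

definition chf_defect :: "real measure \<Rightarrow> real \<Rightarrow> real" where
  "chf_defect \<mu> s = 1 - (cmod (chf \<mu> s))\<^sup>2"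

context real_distribution
begin

lemma prob_UNIV: "prob UNIV = 1"
  using prob_space by simp

lemma integrable_bounded:
  fixes f :: "real \<Rightarrow> real"
  assumes "f \<in> borel_measurable borel" "\<And>x. \<bar>f x\<bar> \<le> C" shows "integrable M f"
  using assms by (intro integrable_const_bound[where B=C]) auto

lemma chf_eq: "chf M s = Complex (\<integral>x. cos (s * x) \<partial>M) (\<integral>x. sin (s * x) \<partial>M)"
proof -
  have I: "integrable M (\<lambda>x. cis (s * x))"
    by (intro integrable_const_bound[where B=1]) (auto simp: cis_conv_exp)
  show ?thesis unfolding chf_def complex_eq_iff
    using integral_Re[OF I] integral_Im[OF I] by simp
qed

text \<open>The squared modulus is the expectation of cos (s (X - Y)) over independent copies. In
  this form the properties of the defect follow from pointwise ones of 1 - cos.\<close>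

lemma chf_defect_eq: "chf_defect M s = (\<integral>y. (\<integral>x. 1 - cos (s * (x - y)) \<partial>M) \<partial>M)"
proof -
  let ?C = "\<integral>x. cos (s * x) \<partial>M" and ?S = "\<integral>x. sin (s * x) \<partial>M"
  have I: "integrable M (\<lambda>x. cos (s * x))" "integrable M (\<lambda>x. sin (s * x))"
    by (auto intro!: integrable_bounded[of _ 1])
  have "(\<integral>x. 1 - cos (s * (x - y)) \<partial>M) = 1 - (?C * cos (s * y) + ?S * sin (s * y))" for y
  proof -
    have "(\<integral>x. 1 - cos (s * (x - y)) \<partial>M) = (\<integral>x. 1 - (cos (s * x) * cos (s * y) + sin (s * x) * sin (s * y)) \<partial>M)"
      by (simp add: right_diff_distrib cos_diff)
    also have "\<dots> = 1 - (?C * cos (s * y) + ?S * sin (s * y))" using I by (simp add: prob_UNIV)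
    finally show ?thesis .
  qed
  then have "(\<integral>y. (\<integral>x. 1 - cos (s * (x - y)) \<partial>M) \<partial>M) = (\<integral>y. 1 - (?C * cos (s * y) + ?S * sin (s * y)) \<partial>M)" by simp
  also have "\<dots> = 1 - (?C * ?C + ?S * ?S)" using I by (simp add: prob_UNIV)
  also have "\<dots> = chf_defect M s"
    unfolding chf_defect_def chf_eq cmod_power2 by (simp add: power2_eq_square)
  finally show ?thesis by simp
qed

lemma inner_measurable[measurable]:
  fixes f :: "real \<Rightarrow> real \<Rightarrow> real"
  assumes "(\<lambda>(y, x). f y x) \<in> borel_measurable (borel \<Otimes>\<^sub>M borel)"
  shows "(\<lambda>y. \<integral>x. f y x \<partial>M) \<in> borel_measurable borel"
proof -
  have [measurable]: "(\<lambda>(y, x). f y x) \<in> borel_measurable (borel \<Otimes>\<^sub>M M)"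
    using assms by (simp cong: measurable_cong_sets sets_pair_measure_cong)
  show ?thesis by measurable
qed

lemma chf_defect_nonneg: "0 \<le> chf_defect M s"
  unfolding chf_defect_eq by (intro Bochner_Integration.integral_nonneg) auto

lemma chf_defect_le_1: "chf_defect M s \<le> 1"
  by (simp add: chf_defect_def)

lemma chf_defect_measurable[measurable]: "chf_defect M \<in> borel_measurable borel"
proof -
  have "chf_defect M = (\<lambda>s. 1 - ((\<integral>x. cos (s * x) \<partial>M)\<^sup>2 + (\<integral>x. sin (s * x) \<partial>M)\<^sup>2))"
    by (auto simp: chf_defect_def chf_eq cmod_power2 fun_eq_iff)
  also have "\<dots> \<in> borel_measurable borel" by measurable
  finally show ?thesis .
qed

lemma abs_inner_le:
  fixes f :: "real \<Rightarrow> real"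
  assumes "f \<in> borel_measurable borel" "\<And>x. \<bar>f x\<bar> \<le> C" shows "\<bar>\<integral>x. f x \<partial>M\<bar> \<le> C"
proof -
  have "\<bar>\<integral>x. f x \<partial>M\<bar> \<le> (\<integral>x. \<bar>f x\<bar> \<partial>M)" by (rule integral_abs_bound)
  also have "\<dots> \<le> (\<integral>x. C \<partial>M)"
    using assms by (intro integral_mono integrable_const integrable_bounded[of "\<lambda>x. \<bar>f x\<bar>" C]) auto
  finally show ?thesis by (simp add: prob_UNIV)
qed

lemma chf_defect_subadditive: "chf_defect M a \<le> 2 * chf_defect M (a + b) + 2 * chf_defect M b"
proof -
  have b1: "\<bar>1 - cos x\<bar> \<le> 2" for x :: real using cos_le_one[of x] cos_ge_minus_one[of x] by linarith
  have b2: "\<bar>\<integral>x. 1 - cos (s * (x - y)) \<partial>M\<bar> \<le> 2" for s y by (rule abs_inner_le) (auto simp: b1)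
  have I1: "integrable M (\<lambda>x. 1 - cos (s * (x - y)))" for s y by (rule integrable_bounded[of _ 2]) (auto simp: b1)
  have I2: "integrable M (\<lambda>y. \<integral>x. 1 - cos (s * (x - y)) \<partial>M)" for s by (rule integrable_bounded[of _ 2]) (measurable, rule b2)
  have e: "(\<integral>x. 2 * (1 - cos ((a + b) * (x - y))) + 2 * (1 - cos (b * (x - y))) \<partial>M) =
      2 * (\<integral>x. 1 - cos ((a + b) * (x - y)) \<partial>M) + 2 * (\<integral>x. 1 - cos (b * (x - y)) \<partial>M)" for y
    by (rule integral_2_2[OF I1 I1])
  have "chf_defect M a \<le> (\<integral>y. (\<integral>x. 2 * (1 - cos ((a + b) * (x - y))) + 2 * (1 - cos (b * (x - y))) \<partial>M) \<partial>M)"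
    unfolding chf_defect_eq
  proof (rule integral_mono)
    show "integrable M (\<lambda>y. (\<integral>x. 2 * (1 - cos ((a + b) * (x - y))) + 2 * (1 - cos (b * (x - y))) \<partial>M))"
      unfolding e by (intro Bochner_Integration.integrable_add integrable_mult_right I2)
    fix y
    show "(\<integral>x. 1 - cos (a * (x - y)) \<partial>M) \<le> (\<integral>x. 2 * (1 - cos ((a + b) * (x - y))) + 2 * (1 - cos (b * (x - y))) \<partial>M)"
    proof (rule integral_mono[OF I1])
      show "integrable M (\<lambda>x. 2 * (1 - cos ((a + b) * (x - y))) + 2 * (1 - cos (b * (x - y))))"
        by (intro Bochner_Integration.integrable_add integrable_mult_right I1)
      show "1 - cos (a * (x - y)) \<le> 2 * (1 - cos ((a + b) * (x - y))) + 2 * (1 - cos (b * (x - y)))" for x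
        using one_minus_cos_le[of "a * (x - y)" "b * (x - y)"] by (simp add: distrib_right)
    qed
  qed (rule I2)
  also have "\<dots> = 2 * chf_defect M (a + b) + 2 * chf_defect M b"
    unfolding e chf_defect_eq by (rule integral_2_2[OF I2 I2])
  finally show ?thesis .
qed

text \<open>Subadditivity turns smallness of the capped defect on average into smallness of the defect at every
point; the cap at 1 is all that \<open>min_one_le_one_minus_power\<close> allows to be estimated.\<close>

lemma scaled_defect_le:
  assumes N: "1 \<le> N" and R: "R = (\<integral>s\<in>{0..2}. min 1 (real N * chf_defect M (s / real N)) \<partial>lborel)"
    and small: "R < 1 / 2" and t: "0 \<le> t" "t \<le> 1"
  shows "real N * chf_defect M (t / real N) \<le> 4 * R"
proof -
  define u where "u s = real N * chf_defect M (s / real N)" for s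
  define w where "w s = min 1 (u s)" for s
  have [measurable]: "u \<in> borel_measurable borel" unfolding u_def by measurable
  have [measurable]: "w \<in> borel_measurable borel" unfolding w_def by measurable
  have u0: "0 \<le> u s" for s using chf_defect_nonneg by (simp add: u_def)
  have w01: "0 \<le> w s" "w s \<le> 1" for s using u0 by (auto simp: w_def)
  have wI: "set_integrable lborel {a..b} w" for a b by (rule set_integrable_Icc_bounded[of _ 1]) (use w01 in auto)
  have mono: "(\<integral>s\<in>{a..b}. w s \<partial>lborel) \<le> R" if "0 \<le> a" "b \<le> 2" for a b
  proof -
    have "(\<integral>s\<in>{a..b}. w s \<partial>lborel) \<le> (\<integral>s\<in>{0..2}. w s \<partial>lborel)"
      unfolding set_lebesgue_integral_def
      by (rule integral_mono) (use that w01 wI in \<open>auto simp: set_integrable_def indicator_def\<close>)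
    then show ?thesis by (simp add: R w_def u_def)
  qed
  \<comment> \<open>The argument s + t runs through [t, 1 + t], which stays inside [0, 2] for t
    \<le> 1; hence the range of integration in \<open>R\<close>.\<close>
  have shift: "(\<integral>s\<in>{0..1}. w (s + t) \<partial>lborel) = (\<integral>s\<in>{t..1 + t}. w s \<partial>lborel)"
  proof -
    have "(\<integral>s\<in>{t..1 + t}. w s \<partial>lborel) = (\<integral>s. indicator {t..1 + t} (t + 1 * s) *\<^sub>R w (t + 1 * s) \<partial>lborel)"
      unfolding set_lebesgue_integral_def by (subst lborel_integral_real_affine[of 1 _ t]) auto
    also have "\<dots> = (\<integral>s\<in>{0..1}. w (s + t) \<partial>lborel)"
      unfolding set_lebesgue_integral_def
      by (intro Bochner_Integration.integral_cong) (auto simp: indicator_def add.commute)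
    finally show ?thesis by simp
  qed
  \<comment> \<open>If a summand on the right is capped, the sum is already at least 1; otherwise
    the subadditivity of the defect applies.\<close>
  have pt: "min 1 (u t / 2) \<le> w s + w (s + t)" for s
  proof -
    have "u t \<le> 2 * u (s + t) + 2 * u s"
      using mult_left_mono[OF chf_defect_subadditive[of "t / real N" "s / real N"], of "real N"] N
      by (simp add: u_def algebra_simps add_divide_distrib)
    then show ?thesis using u0[of s] u0[of "s + t"] by (auto simp: w_def min_def)
  qed
  have "min 1 (u t / 2) = (\<integral>s\<in>{0..1::real}. min 1 (u t / 2) \<partial>lborel)" by (rule set_integral_const_unit[symmetric])
  also have "\<dots> \<le> (\<integral>s\<in>{0..1}. w s + w (s + t) \<partial>lborel)"
  proof (rule set_integral_mono[OF _ _ pt])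
    show "set_integrable lborel {0..1::real} (\<lambda>s. min 1 (u t / 2))"
      by (rule set_integrable_Icc_bounded[of _ 1]) (use u0[of t] in auto)
    show "set_integrable lborel {0..1} (\<lambda>s. w s + w (s + t))"
    proof (rule set_integrable_Icc_bounded[of _ 2])
      show "\<bar>w s + w (s + t)\<bar> \<le> 2" for s using w01[of s] w01[of "s + t"] by linarith
    qed measurable
  qed
  also have "\<dots> = (\<integral>s\<in>{0..1}. w s \<partial>lborel) + (\<integral>s\<in>{0..1}. w (s + t) \<partial>lborel)"
    by (rule set_integral_add[OF wI set_integrable_Icc_bounded[of _ 1]]) (use w01 in auto)
  also have "\<dots> \<le> R + R" unfolding shift using t by (intro add_mono mono) auto
  finally have "min 1 (u t / 2) \<le> 2 * R" by simp
  \<comment> \<open>\<open>R < 1 / 2\<close> excludes that the minimum is attained by 1.\<close>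
  then have "u t / 2 \<le> 2 * R" using small by (simp add: min_def split: if_splits)
  then show ?thesis by (simp add: u_def)
qed

text \<open>Undoes the symmetrization: shifting by some y in [-L, L] changes the capped square by at
  most a factor 2 and an additive \<open>2 * L\<^sup>2\<close>, and such y carry half of the mass.
  The constant 192 is the product of 12 from \<open>integral_one_minus_cos_ge\<close>, 2 from the
  shift, 2 from the mass and 4 from \<open>scaled_defect_le\<close>.\<close>

lemma integral_trunc_sq_le:
  assumes N: "1 \<le> N" and R: "R = (\<integral>s\<in>{0..2}. min 1 (real N * chf_defect M (s / real N)) \<partial>lborel)"
    and small: "R < 1 / 2" and L: "0 \<le> L" "1 / 2 \<le> prob {-L..L}"
  shows "(\<integral>x. trunc_sq N x \<partial>M) \<le> 192 * R + 2 * L\<^sup>2 / real N"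
proof -
  have N0: "0 < real N" using N by simp
  have b1: "\<bar>1 - cos x\<bar> \<le> 2" for x :: real using cos_le_one[of x] cos_ge_minus_one[of x] by linarith
  let ?f = "\<lambda>t x y. 1 - cos (t / real N * (x - y))"
  \<comment> \<open>The average of 1 - cos over frequencies in [0, 1]. By Fubini its mean at (x - y)
    / N over x and y is the averaged defect \<open>S\<close>.\<close>
  define A :: "real \<Rightarrow> real" where "A z = (\<integral>t\<in>{0..1}. 1 - cos (t * z) \<partial>lborel)" for z
  define S where "S = (\<integral>t\<in>{0..1}. chf_defect M (t / real N) \<partial>lborel)"
  define G where "G = (\<integral>x. trunc_sq N x \<partial>M)"
  have IT: "integrable M (trunc_sq N)" by (rule integrable_bounded[of _ "real N"]) (auto simp: abs_trunc_sq_le)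
  have A0: "0 \<le> A z" for z unfolding A_def by (intro set_integral_Icc_nonneg) auto
  have A2: "A z \<le> 2" for z
  proof -
    have "A z \<le> (\<integral>t\<in>{0..1::real}. 2 \<partial>lborel)" unfolding A_def
    proof (intro set_integral_mono set_integrable_Icc_bounded[of _ 2])
      show "1 - cos (t * z) \<le> 2" for t using b1[of "t * z"] by linarith
    qed (auto simp: b1)
    also have "\<dots> = 2" by (rule set_integral_const_unit)
    finally show ?thesis .
  qed
  have Am[measurable]: "A \<in> borel_measurable borel"
    unfolding A_def[abs_def] set_lebesgue_integral_def by measurable
  have SA: "S = (\<integral>y. (\<integral>x. A ((x - y) / real N) \<partial>M) \<partial>M)"
  proof -
    have "S = (\<integral>t\<in>{0..1}. (\<integral>y. (\<integral>x. ?f t x y \<partial>M) \<partial>M) \<partial>lborel)"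
      unfolding S_def chf_defect_eq ..
    also have "\<dots> = (\<integral>y. (\<integral>t\<in>{0..1}. (\<integral>x. ?f t x y \<partial>M) \<partial>lborel) \<partial>M)"
    proof (rule Fubini_bounded_Icc[symmetric, where C=2])
      show "prob_space M" by (rule prob_space_axioms)
      show "(\<lambda>(y, t). \<integral>x. ?f t x y \<partial>M) \<in> borel_measurable (M \<Otimes>\<^sub>M borel)" by measurable
      show "\<bar>\<integral>x. ?f t x y \<partial>M\<bar> \<le> 2" for t y by (rule abs_inner_le) (auto simp: b1)
    qed
    also have "\<dots> = (\<integral>y. (\<integral>x. (\<integral>t\<in>{0..1}. ?f t x y \<partial>lborel) \<partial>M) \<partial>M)"
    proof (intro Bochner_Integration.integral_cong refl Fubini_bounded_Icc[symmetric, where C=2])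
      fix y
      show "prob_space M" by (rule prob_space_axioms)
      show "(\<lambda>(x, t). ?f t x y) \<in> borel_measurable (M \<Otimes>\<^sub>M borel)" by measurable
      show "\<bar>?f t x y\<bar> \<le> 2" for x t by (rule b1)
    qed
    finally show ?thesis by (simp add: A_def)
  qed
  have inner: "(G - 2 * L\<^sup>2 / real N) / (24 * real N) \<le> (\<integral>x. A ((x - y) / real N) \<partial>M)" if y: "\<bar>y\<bar> \<le> L" for y
  proof -
    have pt: "(trunc_sq N x - 2 * L\<^sup>2 / real N) / (24 * real N) \<le> A ((x - y) / real N)" for x
    proof -
      have y2: "y\<^sup>2 \<le> L\<^sup>2" using y L by (simp add: abs_le_square_iff[symmetric])
      have "min (x\<^sup>2) ((real N)\<^sup>2) \<le> 2 * min ((x - y)\<^sup>2) ((real N)\<^sup>2) + 2 * L\<^sup>2"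
      proof -
        have "x\<^sup>2 \<le> 2 * (x - y)\<^sup>2 + 2 * y\<^sup>2"
          using zero_le_power2[of "x - 2 * y"] by (simp add: power2_eq_square algebra_simps)
        with y2 have "x\<^sup>2 \<le> 2 * (x - y)\<^sup>2 + 2 * L\<^sup>2" by linarith
        then show ?thesis
        proof (cases "(x - y)\<^sup>2 \<le> (real N)\<^sup>2")
          case True
          then have "min ((x - y)\<^sup>2) ((real N)\<^sup>2) = (x - y)\<^sup>2" by simp
          then show ?thesis
            using min.cobounded1[of "x\<^sup>2" "(real N)\<^sup>2"] \<open>x\<^sup>2 \<le> 2 * (x - y)\<^sup>2 + 2 * L\<^sup>2\<close> by linarith
        next
          case False
          then have "min ((x - y)\<^sup>2) ((real N)\<^sup>2) = (real N)\<^sup>2" by simp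
          moreover have "(real N)\<^sup>2 \<le> 2 * (real N)\<^sup>2 + 2 * L\<^sup>2" by simp
          ultimately show ?thesis using min.cobounded2[of "x\<^sup>2" "(real N)\<^sup>2"] by linarith
        qed
      qed
      then have "trunc_sq N x \<le> (2 * min ((x - y)\<^sup>2) ((real N)\<^sup>2) + 2 * L\<^sup>2) / real N"
        unfolding trunc_sq_def by (intro divide_right_mono) auto
      then have "trunc_sq N x - 2 * L\<^sup>2 / real N \<le> 2 * min ((x - y)\<^sup>2) ((real N)\<^sup>2) / real N"
        by (simp add: add_divide_distrib)
      also have "min ((x - y)\<^sup>2) ((real N)\<^sup>2) = (real N)\<^sup>2 * min 1 (((x - y) / real N)\<^sup>2)"
        using N0 by (auto simp: min_def power_divide field_simps)
      finally have "(trunc_sq N x - 2 * L\<^sup>2 / real N) / (24 * real N) \<le>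
          (2 * ((real N)\<^sup>2 * min 1 (((x - y) / real N)\<^sup>2)) / real N) / (24 * real N)"
        by (intro divide_right_mono) auto
      also have "\<dots> = min 1 (((x - y) / real N)\<^sup>2) / 12" using N0 by (simp add: power2_eq_square)
      also have "\<dots> \<le> A ((x - y) / real N)" unfolding A_def by (rule integral_one_minus_cos_ge)
      finally show ?thesis .
    qed
    have "(G - 2 * L\<^sup>2 / real N) / (24 * real N) = (\<integral>x. (trunc_sq N x - 2 * L\<^sup>2 / real N) / (24 * real N) \<partial>M)"
      using IT by (simp add: G_def prob_UNIV)
    also have "\<dots> \<le> (\<integral>x. A ((x - y) / real N) \<partial>M)"
    proof (rule integral_mono[OF _ _ pt])
      show "integrable M (\<lambda>x. A ((x - y) / real N))"
        by (rule integrable_bounded[of _ 2]) (use A0 A2 in auto)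
    qed (use IT in simp)
    finally show ?thesis .
  qed
  have "G \<le> 192 * R + 2 * L\<^sup>2 / real N"
  proof (cases "G - 2 * L\<^sup>2 / real N \<le> 0")
    case True
    have "0 \<le> R" unfolding R using chf_defect_nonneg by (intro set_integral_Icc_nonneg) auto
    then show ?thesis using True by linarith
  next
    case False
    let ?d = "(G - 2 * L\<^sup>2 / real N) / (24 * real N)"
    \<comment> \<open>Nonnegativity permits multiplying the lower bound 1 / 2 for the mass of
      [-L, L] by \<open>?d\<close>.\<close>
    have d: "0 \<le> ?d" using False N0 by simp
    have "?d / 2 \<le> ?d * prob {-L..L}" using mult_left_mono[OF L(2) d] by simp
    also have "\<dots> = (\<integral>y. ?d * indicator {-L..L} y \<partial>M)" by simp
    also have "\<dots> \<le> S" unfolding SA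
    proof (rule integral_mono)
      show "integrable M (\<lambda>y. \<integral>x. A ((x - y) / real N) \<partial>M)"
      proof (rule integrable_bounded[of _ 2])
        show "\<bar>\<integral>x. A ((x - y) / real N) \<partial>M\<bar> \<le> 2" for y
          by (rule abs_inner_le) (use A0 A2 in auto)
      qed measurable
      fix y show "?d * indicator {-L..L} y \<le> (\<integral>x. A ((x - y) / real N) \<partial>M)"
      proof (cases "\<bar>y\<bar> \<le> L")
        case True
        then have "y \<in> {-L..L}" by auto
        then show ?thesis using inner[OF True] by simp
      next
        case False
        then have "y \<notin> {-L..L}" by auto
        then show ?thesis using A0 by (simp add: Bochner_Integration.integral_nonneg)
      qed
    next
      show "integrable M (\<lambda>y. ?d * indicator {-L..L} y)"
        by (intro integrable_mult_right integrable_real_indicator) (auto simp: emeasure_eq_measure)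
    qed
    also have "S \<le> (\<integral>t\<in>{0..1::real}. 4 * R / real N \<partial>lborel)"
      unfolding S_def
    proof (rule set_integral_mono)
      show "set_integrable lborel {0..1} (\<lambda>t. chf_defect M (t / real N))"
        by (rule set_integrable_Icc_bounded[of _ 1]) (use chf_defect_nonneg chf_defect_le_1 in auto)
      show "set_integrable lborel {0..1::real} (\<lambda>t. 4 * R / real N)"
        by (rule set_integrable_Icc_bounded[of _ "\<bar>4 * R / real N\<bar>"]) auto
      show "chf_defect M (t / real N) \<le> 4 * R / real N" if "t \<in> {0..1}" for t
        using scaled_defect_le[OF N R small, of t] that N0 by (simp add: pos_le_divide_eq mult.commute)
    qed
    also have "\<dots> = 4 * R / real N" by (rule set_integral_const_unit)
    finally have "?d / 2 \<le> 4 * R / real N" .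
    then have "?d / 2 * (48 * real N) \<le> 4 * R / real N * (48 * real N)" by (intro mult_right_mono) auto
    moreover have "?d / 2 * (48 * real N) = G - 2 * L\<^sup>2 / real N" using N0 by simp
    moreover have "4 * R / real N * (48 * real N) = 192 * R" using N0 by simp
    ultimately show ?thesis by linarith
  qed
  then show ?thesis by (simp add: G_def)
qed

end

text \<open>The shift by 1 reduces the claim to nonnegative integrands.\<close>

lemma kernel_integral_measurable:
  fixes f :: "'b \<Rightarrow> real \<Rightarrow> real"
  assumes K[measurable]: "K \<in> measurable P (subprob_algebra borel)"
    and RK: "\<And>p. p \<in> space P \<Longrightarrow> real_distribution (K p)"
    and f[measurable]: "(\<lambda>(p, x). f p x) \<in> borel_measurable (P \<Otimes>\<^sub>M borel)" and b: "\<And>p x. \<bar>f p x\<bar> \<le> 1"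
  shows "(\<lambda>p. \<integral>x. f p x \<partial>K p) \<in> borel_measurable P"
proof -
  have m: "(\<lambda>p. \<integral>\<^sup>+x. ennreal (1 + f p x) \<partial>K p) \<in> borel_measurable P"
    by (rule nn_integral_measurable_subprob_algebra2[OF _ K]) measurable
  have "(\<lambda>p. \<integral>x. f p x \<partial>K p) \<in> borel_measurable P \<longleftrightarrow>
    (\<lambda>p. enn2real (\<integral>\<^sup>+x. ennreal (1 + f p x) \<partial>K p) - 1) \<in> borel_measurable P"
  proof (rule measurable_cong)
    fix p assume p: "p \<in> space P"
    interpret R: real_distribution "K p" by (rule RK[OF p])
    have [measurable]: "f p \<in> borel_measurable borel" using measurable_Pair2[OF f p] by simp
    have I: "integrable (K p) (f p)" by (rule R.integrable_bounded[of _ 1]) (auto simp: b)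
    have p0: "0 \<le> 1 + f p x" for x using b[of p x] by linarith
    have "(\<integral>x. 1 + f p x \<partial>K p) = enn2real (\<integral>\<^sup>+x. ennreal (1 + f p x) \<partial>K p)"
      by (rule integral_eq_nn_integral) (auto simp: p0)
    moreover have "(\<integral>x. 1 + f p x \<partial>K p) = 1 + (\<integral>x. f p x \<partial>K p)" using I by (simp add: R.prob_UNIV)
    ultimately show "(\<integral>x. f p x \<partial>K p) = enn2real (\<integral>\<^sup>+x. ennreal (1 + f p x) \<partial>K p) - 1" by simp
  qed
  also have "\<dots>" using m by measurable
  finally show ?thesis .
qed

section \<open>Random measures whose characteristic functions have modulus close to one\<close>

context prob_space
begin

text \<open>For each \<omega> the bound \<open>integral_trunc_sq_le\<close> needs a level L carrying
  half of the mass and a small integrated defect. One fixed L works outside a small event, since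
  every \<open>K \<omega>\<close> is a probability measure; the defect is controlled by the
  hypothesis through Fubini and Markov's inequality.\<close>

lemma conv_in_prob_trunc_sq_of_chf:
  assumes K[measurable]: "K \<in> measurable M (subprob_algebra borel)"
    and RK: "\<And>\<omega>. \<omega> \<in> space M \<Longrightarrow> real_distribution (K \<omega>)"
    and hyp: "\<And>\<epsilon>. 0 < \<epsilon> \<Longrightarrow> \<exists>N0. \<forall>N\<ge>N0. \<forall>t\<in>{0..2}.
       (\<integral>\<omega>. 1 - (1 - chf_defect (K \<omega>) (t / real N)) ^ N \<partial>M) \<le> \<epsilon>"
  shows "conv_in_prob M (\<lambda>N \<omega>. \<integral>x. trunc_sq N x \<partial>K \<omega>)"
proof (rule conv_in_probI)
  show "(\<lambda>\<omega>. \<integral>x. trunc_sq N x \<partial>K \<omega>) \<in> borel_measurable M" for N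
    by (rule measurable_compose[OF K integral_measurable_subprob_algebra]) measurable
  fix \<eta> \<delta> :: real assume p: "0 < \<eta>" "0 < \<delta>"
  have dm: "(\<lambda>(\<omega>, s). chf_defect (K \<omega>) (s / real N)) \<in> borel_measurable (M \<Otimes>\<^sub>M borel)" for N
  proof -
    have KP: "(\<lambda>z. K (fst z)) \<in> measurable (M \<Otimes>\<^sub>M (borel :: real measure)) (subprob_algebra borel)" by measurable
    have RP: "real_distribution (K (fst z))" if "z \<in> space (M \<Otimes>\<^sub>M (borel :: real measure))" for z
      using that by (intro RK) (auto simp: space_pair_measure)
    have C: "(\<lambda>z. \<integral>x. cos (snd z / real N * x) \<partial>K (fst z)) \<in> borel_measurable (M \<Otimes>\<^sub>M borel)"
      by (rule kernel_integral_measurable[OF KP RP]) auto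
    have S: "(\<lambda>z. \<integral>x. sin (snd z / real N * x) \<partial>K (fst z)) \<in> borel_measurable (M \<Otimes>\<^sub>M borel)"
      by (rule kernel_integral_measurable[OF KP RP]) auto
    have "(\<lambda>z. chf_defect (K (fst z)) (snd z / real N)) \<in> borel_measurable (M \<Otimes>\<^sub>M borel) \<longleftrightarrow>
      (\<lambda>z. 1 - ((\<integral>x. cos (snd z / real N * x) \<partial>K (fst z))\<^sup>2 + (\<integral>x. sin (snd z / real N * x) \<partial>K (fst z))\<^sup>2)) \<in> borel_measurable (M \<Otimes>\<^sub>M borel)"
    proof (rule measurable_cong)
      fix z assume "z \<in> space (M \<Otimes>\<^sub>M (borel :: real measure))"
      then interpret R: real_distribution "K (fst z)" by (rule RP)
      show "chf_defect (K (fst z)) (snd z / real N) =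
        1 - ((\<integral>x. cos (snd z / real N * x) \<partial>K (fst z))\<^sup>2 + (\<integral>x. sin (snd z / real N * x) \<partial>K (fst z))\<^sup>2)"
        unfolding chf_defect_def R.chf_eq cmod_power2 by simp
    qed
    also have "\<dots>" using C S by measurable
    finally show ?thesis by (simp add: case_prod_beta')
  qed
  have d01: "0 \<le> chf_defect (K \<omega>) s \<and> chf_defect (K \<omega>) s \<le> 1" if "\<omega> \<in> space M" for \<omega> s
    using real_distribution.chf_defect_nonneg[OF RK[OF that]] real_distribution.chf_defect_le_1[OF RK[OF that]] by blast
  \<comment> \<open>\<open>max 0\<close> has no effect on \<open>space M\<close> and provides bounds
    for every \<omega>, also where \<open>K \<omega>\<close> is unspecified, as
    \<open>Fubini_bounded_Icc\<close> asks.\<close>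
  define w where "w N \<omega> s = max 0 (min 1 (real N * chf_defect (K \<omega>) (s / real N)))" for N \<omega> s
  have wm[measurable]: "(\<lambda>(\<omega>, s). w N \<omega> s) \<in> borel_measurable (M \<Otimes>\<^sub>M borel)" for N
    unfolding w_def using dm[of N] by measurable
  have w01: "0 \<le> w N \<omega> s" "w N \<omega> s \<le> 1" for N \<omega> s by (auto simp: w_def)
  have w_eq: "w N \<omega> s = min 1 (real N * chf_defect (K \<omega>) (s / real N))" if "\<omega> \<in> space M" for N \<omega> s
    using d01[OF that, of "s / real N"] by (simp add: w_def)
  define R where "R N \<omega> = (\<integral>s\<in>{0..2}. w N \<omega> s \<partial>lborel)" for N \<omega>
  have Rm[measurable]: "R N \<in> borel_measurable M" for N
    unfolding R_def[abs_def] set_lebesgue_integral_def by measurable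
  have wI: "set_integrable lborel {0..2} (w N \<omega>)" if "\<omega> \<in> space M" for N \<omega>
  proof (rule set_integrable_Icc_bounded[of _ 1])
    show "w N \<omega> \<in> borel_measurable borel" using measurable_Pair2[OF wm[of N] that] by simp
  qed (use w01 in auto)
  have R0: "0 \<le> R N \<omega>" for N \<omega> unfolding R_def using w01 by (intro set_integral_Icc_nonneg)
  have const2: "(\<integral>s\<in>{0..2::real}. c \<partial>lborel) = 2 * (c::real)" for c by (simp add: set_lebesgue_integral_def)
  have R2: "R N \<omega> \<le> 2" if "\<omega> \<in> space M" for N \<omega>
  proof -
    have "R N \<omega> \<le> (\<integral>s\<in>{0..2::real}. 1 \<partial>lborel)"
      unfolding R_def using w01 by (intro set_integral_mono wI[OF that] set_integrable_Icc_bounded[of _ 1]) auto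
    then show ?thesis by (simp only: const2)
  qed
  have RI: "integrable M (R N)" for N
    using R0 R2 by (intro integrable_const_bound[where B=2]) auto
  \<comment> \<open>1 / 2 is the smallness required by \<open>integral_trunc_sq_le\<close>, and 192
    times \<eta> / 384 is \<eta> / 2.\<close>
  define \<rho> where "\<rho> = min (1 / 2) (\<eta> / 384)"
  have \<rho>: "0 < \<rho>" using p by (simp add: \<rho>_def)
  have "\<exists>n::nat. prob {\<omega>\<in>space M. measure (K \<omega>) {-real n..real n} < 1 / 2} < \<delta> / 2"
  proof -
    have meas[measurable]: "(\<lambda>\<omega>. measure (K \<omega>) {-real n..real n}) \<in> borel_measurable M" for n :: nat
      by (rule measurable_compose[OF K measurable_measure_subprob_algebra]) simp
    have "(\<lambda>n::nat. prob {\<omega>\<in>space M. measure (K \<omega>) {-real n..real n} < 1 / 2}) \<longlonglongrightarrow>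
        prob (\<Inter>n::nat. {\<omega>\<in>space M. measure (K \<omega>) {-real n..real n} < 1 / 2})"
    proof (rule finite_Lim_measure_decseq)
      show "decseq (\<lambda>n::nat. {\<omega>\<in>space M. measure (K \<omega>) {-real n..real n} < 1 / 2})"
        unfolding decseq_def
      proof (intro allI impI subsetI)
        fix m n :: nat and \<omega> assume mn: "m \<le> n" and w: "\<omega> \<in> {\<omega>\<in>space M. measure (K \<omega>) {-real n..real n} < 1 / 2}"
        then interpret R: real_distribution "K \<omega>" using RK by simp
        have "measure (K \<omega>) {-real m..real m} \<le> measure (K \<omega>) {-real n..real n}"
          using mn by (intro R.finite_measure_mono) auto
        then show "\<omega> \<in> {\<omega>\<in>space M. measure (K \<omega>) {-real m..real m} < 1 / 2}" using w by simp
      qed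
    qed auto
    also have "(\<Inter>n::nat. {\<omega>\<in>space M. measure (K \<omega>) {-real n..real n} < 1 / 2}) = {}"
    proof (rule ccontr)
      assume "\<not> ?thesis"
      then obtain \<omega> where w: "\<omega> \<in> space M" "\<And>n::nat. measure (K \<omega>) {-real n..real n} < 1 / 2" by auto
      interpret R: real_distribution "K \<omega>" by (rule RK[OF w(1)])
      have "(\<lambda>n::nat. measure (K \<omega>) {-real n..real n}) \<longlonglongrightarrow> measure (K \<omega>) (\<Union>n::nat. {-real n..real n})"
        by (rule R.finite_Lim_measure_incseq) (auto simp: incseq_def)
      also have "(\<Union>n::nat. {-real n..real n}) = UNIV"
      proof -
        have "\<exists>n::nat. x \<in> {-real n..real n}" for x :: real
        proof -
          obtain n :: nat where "\<bar>x\<bar> \<le> real n" using real_arch_simple by blast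
          then show ?thesis by (intro exI[of _ n]) auto
        qed
        then show ?thesis by blast
      qed
      finally have "(\<lambda>n::nat. measure (K \<omega>) {-real n..real n}) \<longlonglongrightarrow> 1" by (simp add: R.prob_UNIV)
      moreover have "1 \<le> (1 / 2 :: real)" by (rule LIMSEQ_le_const2[OF calculation]) (use w(2) less_imp_le in blast)
      then show False by simp
    qed
    finally have "(\<lambda>n::nat. prob {\<omega>\<in>space M. measure (K \<omega>) {-real n..real n} < 1 / 2}) \<longlonglongrightarrow> 0" by simp
    from order_tendstoD(2)[OF this, of "\<delta> / 2"] p show ?thesis by (auto simp: eventually_sequentially)
  qed
  then obtain n :: nat where n: "prob {\<omega>\<in>space M. measure (K \<omega>) {-real n..real n} < 1 / 2} < \<delta> / 2" by blast
  let ?L = "real n"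
  \<comment> \<open>A factor 2 comes from \<open>min_one_le_one_minus_power\<close> and another from
    the length of [0, 2], which leaves \<delta> * \<rho> / 2; Markov's inequality at level \<rho>
    then yields \<delta> / 2.\<close>
  have "0 < \<delta> * \<rho> / 8" using p \<rho> by simp
  from hyp[OF this] obtain N0 where N0: "\<And>N t. N0 \<le> N \<Longrightarrow> t \<in> {0..2} \<Longrightarrow>
      (\<integral>\<omega>. 1 - (1 - chf_defect (K \<omega>) (t / real N)) ^ N \<partial>M) \<le> \<delta> * \<rho> / 8" by blast
  \<comment> \<open>From here on the error term \<open>2 * ?L\<^sup>2 / N\<close> is at most \<eta>
    / 2.\<close>
  obtain N1 :: nat where N1: "4 * ?L\<^sup>2 / \<eta> \<le> real N1" using real_arch_simple by blast
  show "\<forall>\<^sub>F N in sequentially. prob {\<omega>\<in>space M. \<eta> < \<bar>\<integral>x. trunc_sq N x \<partial>K \<omega>\<bar>} \<le> \<delta>"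
  proof (rule eventually_sequentiallyI[of "max 1 (max N0 N1)"])
    fix N assume "max 1 (max N0 N1) \<le> N"
    then have N: "1 \<le> N" "N0 \<le> N" "N1 \<le> N" by auto
    then have Np: "0 < real N" by simp
    have Lb: "2 * ?L\<^sup>2 / real N \<le> \<eta> / 2"
    proof -
      have "4 * ?L\<^sup>2 / \<eta> \<le> real N" using N1 N(3) by linarith
      then have "4 * ?L\<^sup>2 \<le> real N * \<eta>" using p by (simp add: pos_divide_le_eq)
      then show ?thesis using Np by (simp add: pos_divide_le_eq mult.commute)
    qed
    have ER: "(\<integral>\<omega>. R N \<omega> \<partial>M) \<le> \<delta> * \<rho> / 2"
    proof -
      have "(\<integral>\<omega>. R N \<omega> \<partial>M) = (\<integral>s\<in>{0..2}. (\<integral>\<omega>. w N \<omega> s \<partial>M) \<partial>lborel)"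
        unfolding R_def
        by (rule Fubini_bounded_Icc[where C=1]) (use w01 prob_space_axioms in auto)
      also have "\<dots> \<le> (\<integral>s\<in>{0..2::real}. \<delta> * \<rho> / 4 \<partial>lborel)"
      proof (rule set_integral_mono)
        have wm2: "(\<lambda>s. \<integral>\<omega>. w N \<omega> s \<partial>M) \<in> borel_measurable borel"
        proof -
          have "(\<lambda>(s, \<omega>). w N \<omega> s) \<in> borel_measurable (borel \<Otimes>\<^sub>M M)"
            using measurable_pair_swap[OF wm[of N]] by (simp add: case_prod_beta')
          then show ?thesis by measurable
        qed
        show "set_integrable lborel {0..2} (\<lambda>s. \<integral>\<omega>. w N \<omega> s \<partial>M)"
        proof (rule set_integrable_Icc_bounded[OF wm2, of 1])
          fix s
          have ws: "(\<lambda>\<omega>. w N \<omega> s) \<in> borel_measurable M" using wm[of N] by measurable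
          have "(\<integral>\<omega>. w N \<omega> s \<partial>M) \<le> (\<integral>\<omega>. 1 \<partial>M)"
            using w01 ws by (intro integral_mono integrable_const_bound[where B=1]) auto
          moreover have "0 \<le> (\<integral>\<omega>. w N \<omega> s \<partial>M)" using w01 by simp
          ultimately show "\<bar>\<integral>\<omega>. w N \<omega> s \<partial>M\<bar> \<le> 1" by (simp add: prob_space)
        qed
        show "set_integrable lborel {0..2::real} (\<lambda>s. \<delta> * \<rho> / 4)"
          by (rule set_integrable_Icc_bounded[of _ "\<bar>\<delta> * \<rho> / 4\<bar>"]) auto
        fix s :: real assume s: "s \<in> {0..2}"
        have ws: "(\<lambda>\<omega>. w N \<omega> s) \<in> borel_measurable M" using wm[of N] by measurable
        have ds[measurable]: "(\<lambda>\<omega>. chf_defect (K \<omega>) (s / real N)) \<in> borel_measurable M" using dm[of N] by measurable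
        have "(\<integral>\<omega>. w N \<omega> s \<partial>M) \<le> (\<integral>\<omega>. 2 * (1 - (1 - chf_defect (K \<omega>) (s / real N)) ^ N) \<partial>M)"
        proof (rule integral_mono)
          show "integrable M (\<lambda>\<omega>. w N \<omega> s)"
            using ws w01 by (intro integrable_const_bound[where B=1]) auto
          show "integrable M (\<lambda>\<omega>. 2 * (1 - (1 - chf_defect (K \<omega>) (s / real N)) ^ N))"
          proof (rule integrable_const_bound[where B=2])
            show "AE \<omega> in M. norm (2 * (1 - (1 - chf_defect (K \<omega>) (s / real N)) ^ N)) \<le> 2"
            proof (rule AE_I2)
              fix \<omega> assume "\<omega> \<in> space M"
              note d01[OF this, of "s / real N"]
              then have "0 \<le> (1 - chf_defect (K \<omega>) (s / real N)) ^ N" "(1 - chf_defect (K \<omega>) (s / real N)) ^ N \<le> 1"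
                by (auto intro: power_le_one)
              then show "norm (2 * (1 - (1 - chf_defect (K \<omega>) (s / real N)) ^ N)) \<le> 2" by simp
            qed
          qed measurable
          fix \<omega> assume w: "\<omega> \<in> space M"
          show "w N \<omega> s \<le> 2 * (1 - (1 - chf_defect (K \<omega>) (s / real N)) ^ N)"
            unfolding w_eq[OF w] using d01[OF w] by (intro min_one_le_one_minus_power) auto
        qed
        also have "\<dots> = 2 * (\<integral>\<omega>. 1 - (1 - chf_defect (K \<omega>) (s / real N)) ^ N \<partial>M)" by (rule integral_mult_right_zero)
        also have "\<dots> \<le> \<delta> * \<rho> / 4" using N0[OF N(2) s] by simp
        finally show "(\<integral>\<omega>. w N \<omega> s \<partial>M) \<le> \<delta> * \<rho> / 4" .
      qed
      also have "\<dots> = \<delta> * \<rho> / 2" unfolding const2 by simp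
      finally show ?thesis .
    qed
    have PR: "prob {\<omega>\<in>space M. \<rho> \<le> R N \<omega>} \<le> \<delta> / 2"
    proof -
      have "prob {\<omega>\<in>space M. \<rho> \<le> R N \<omega>} \<le> (\<integral>\<omega>. R N \<omega> \<partial>M) / \<rho>"
        using integral_Markov_inequality_measure[OF RI[of N], of "space M" \<rho>] R0 \<rho> by simp
      also have "\<dots> \<le> (\<delta> * \<rho> / 2) / \<rho>" using ER \<rho> by (intro divide_right_mono) auto
      also have "\<dots> = \<delta> / 2" using \<rho> by simp
      finally show ?thesis .
    qed
    have meas[measurable]: "(\<lambda>\<omega>. measure (K \<omega>) {-?L..?L}) \<in> borel_measurable M"
      by (rule measurable_compose[OF K measurable_measure_subprob_algebra]) simp
    let ?E1 = "{\<omega>\<in>space M. measure (K \<omega>) {-?L..?L} < 1 / 2}" and ?E2 = "{\<omega>\<in>space M. \<rho> \<le> R N \<omega>}"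
    have "{\<omega>\<in>space M. \<eta> < \<bar>\<integral>x. trunc_sq N x \<partial>K \<omega>\<bar>} \<subseteq> ?E1 \<union> ?E2"
    proof (rule subsetI, rule ccontr)
      fix \<omega> assume w: "\<omega> \<in> {\<omega>\<in>space M. \<eta> < \<bar>\<integral>x. trunc_sq N x \<partial>K \<omega>\<bar>}" and nE: "\<omega> \<notin> ?E1 \<union> ?E2"
      then have sp: "\<omega> \<in> space M" by simp
      interpret R: real_distribution "K \<omega>" by (rule RK[OF sp])
      have r: "R N \<omega> < \<rho>" and k: "1 / 2 \<le> measure (K \<omega>) {-?L..?L}" using nE sp by auto
      have Req: "R N \<omega> = (\<integral>s\<in>{0..2}. min 1 (real N * chf_defect (K \<omega>) (s / real N)) \<partial>lborel)"
        unfolding R_def w_eq[OF sp] ..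
      have "(\<integral>x. trunc_sq N x \<partial>K \<omega>) \<le> 192 * R N \<omega> + 2 * ?L\<^sup>2 / real N"
        by (rule R.integral_trunc_sq_le[OF N(1) Req _ _ k]) (use r in \<open>auto simp: \<rho>_def\<close>)
      also have "\<dots> \<le> \<eta> / 2 + \<eta> / 2" using r Lb by (intro add_mono) (auto simp: \<rho>_def)
      finally have "(\<integral>x. trunc_sq N x \<partial>K \<omega>) \<le> \<eta>" by simp
      moreover have "0 \<le> (\<integral>x. trunc_sq N x \<partial>K \<omega>)" using trunc_sq_nonneg by (intro Bochner_Integration.integral_nonneg)
      ultimately show False using w by simp
    qed
    then have "prob {\<omega>\<in>space M. \<eta> < \<bar>\<integral>x. trunc_sq N x \<partial>K \<omega>\<bar>} \<le> prob (?E1 \<union> ?E2)"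
      by (intro finite_measure_mono) measurable
    also have "\<dots> \<le> prob ?E1 + prob ?E2" by (rule measure_Un_le) measurable
    also have "\<dots> \<le> \<delta>" using n PR by simp
    finally show "prob {\<omega>\<in>space M. \<eta> < \<bar>\<integral>x. trunc_sq N x \<partial>K \<omega>\<bar>} \<le> \<delta>" .
  qed
qed

end

subsection \<open>The equivalence\<close>

lemma norm_cis_minus_1_le: "norm (cis x - 1) \<le> \<bar>x\<bar>"
proof (rule power2_le_imp_le)
  have "(norm (cis x - 1))\<^sup>2 = (cos x - 1)\<^sup>2 + (sin x)\<^sup>2" by (simp add: cmod_power2)
  also have "\<dots> = 2 * (1 - cos x)"
    using sin_cos_squared_add[of x] by (simp add: power2_eq_square algebra_simps)
  also have "1 - cos x = 2 * (sin (x / 2))\<^sup>2" using cos_double_sin[of "x / 2"] by simp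
  also have "2 * (2 * (sin (x / 2))\<^sup>2) \<le> 2 * (2 * \<bar>x / 2\<bar>\<^sup>2)"
    using power_mono[OF abs_sin_x_le_abs_x[of "x / 2"], of 2] by simp
  also have "\<dots> = \<bar>x\<bar>\<^sup>2" by (simp add: power_divide)
  finally show "(norm (cis x - 1))\<^sup>2 \<le> \<bar>x\<bar>\<^sup>2" .
qed simp

lemma prod_cis: "(\<Prod>c\<in>A. cis (h c)) = cis (\<Sum>c\<in>A. h c)"
  by (induct A rule: infinite_finite_induct) (auto simp: cis_mult)

lemma lessThan_split_shift:
  fixes h :: "nat \<Rightarrow> 'b::comm_monoid_add"
  shows "(\<Sum>c<2 * N. h c) = (\<Sum>c<N. h c) + (\<Sum>c<N. h (N + c))"
  using sum.atLeastLessThan_concat[of 0 N "2 * N" h] sum.atLeastLessThan_shift_0[of h N "2 * N"]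
  by (simp add: lessThan_atLeast0 o_def mult_2)

lemma prod_lessThan_split_shift:
  fixes h :: "nat \<Rightarrow> 'b::comm_monoid_mult"
  shows "(\<Prod>c<2 * N. h c) = (\<Prod>c<N. h c) * (\<Prod>c<N. h (N + c))"
  using prod.atLeastLessThan_concat[of 0 N "2 * N" h] prod.atLeastLessThan_shift_0[of h N "2 * N"]
  by (simp add: lessThan_atLeast0 o_def mult_2)

lemma (in real_distribution) chf_uminus: "chf M (- s) = cnj (chf M s)"
  by (simp add: chf_eq complex_eq_iff)

lemma (in real_distribution) integral_trunc_sq_eq:
  assumes "1 \<le> N"
  shows "(\<integral>x. trunc_sq N x \<partial>M) = real N * prob (UNIV - {- real N .. real N}) + (\<integral>x\<in>{- real N .. real N}. x\<^sup>2 \<partial>M) / real N"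
proof -
  let ?I = "{- real N .. real N}"
  have e: "trunc_sq N x = real N * indicator (UNIV - ?I) x + (indicator ?I x * x\<^sup>2) / real N" for x
  proof (cases "x \<in> ?I")
    case True
    then have "x\<^sup>2 \<le> (real N)\<^sup>2" using abs_le_square_iff[of x "real N"] by auto
    then show ?thesis using True by (simp add: trunc_sq_def)
  next
    case False
    then have "(real N)\<^sup>2 \<le> x\<^sup>2" using abs_le_square_iff[of "real N" x] by auto
    then show ?thesis using False assms by (simp add: trunc_sq_def min_def power2_eq_square)
  qed
  have I2: "integrable M (\<lambda>x. indicator ?I x * x\<^sup>2)"
  proof (rule integrable_bounded[of _ "(real N)\<^sup>2"])
    show "\<bar>indicator ?I x * x\<^sup>2\<bar> \<le> (real N)\<^sup>2" for x
      using abs_le_square_iff[of x "real N"] by (auto simp: indicator_def)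
  qed measurable
  have I1: "integrable M (\<lambda>x. indicat_real (UNIV - ?I) x)" by (simp add: emeasure_eq_measure)
  show ?thesis unfolding e set_lebesgue_integral_def
    using I1 I2 by (subst Bochner_Integration.integral_add) auto
qed

lemma norm_chf_le:
  assumes "real_distribution \<mu>" shows "norm (chf \<mu> s) \<le> 1"
proof -
  have "(cmod (chf \<mu> s))\<^sup>2 \<le> 1"
    using real_distribution.chf_defect_nonneg[OF assms, of s] by (simp add: chf_defect_def)
  then show ?thesis by (simp add: abs_square_le_1)
qed

lemma wk_conv_cong:
  assumes "\<And>\<omega>. \<omega> \<in> space M \<Longrightarrow> Y \<omega> = Y' \<omega>" shows "wk_conv M X Y \<longleftrightarrow> wk_conv M X Y'"
proof -
  have "(\<integral>\<omega>\<in>B. Y \<omega> \<partial>M) = (\<integral>\<omega>\<in>B. Y' \<omega> \<partial>M)" for B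
    unfolding set_lebesgue_integral_def using assms by (intro Bochner_Integration.integral_cong) auto
  then show ?thesis by (simp add: wk_conv_def)
qed

context prob_space
begin

lemma chf_kernel_measurable:
  assumes "K \<in> measurable M (subprob_algebra borel)"
  shows "(\<lambda>\<omega>. chf (K \<omega>) s) \<in> borel_measurable M"
  unfolding chf_def
  by (rule measurable_compose[OF assms integral_measurable_subprob_algebra])
    (auto intro!: borel_measurable_continuous_onI continuous_intros)

lemma wk_conv_chf:
  assumes f[measurable]: "\<And>n. f n \<in> borel_measurable M"
    and det: "determining_with M f k D H" and K[measurable]: "K \<in> measurable M (subprob_algebra borel)"
    and RK: "\<And>\<omega>. \<omega> \<in> space M \<Longrightarrow> real_distribution (K \<omega>)"
    and KH: "AE \<omega> in M. \<forall>x. measure (K \<omega>) {..x} = H x \<omega>"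
  shows "wk_conv M (\<lambda>n \<omega>. cis (s * f (k n) \<omega>)) (\<lambda>\<omega>. chf (K \<omega>) s)"
proof (rule wk_conv_complexI)
  have [measurable]: "cis \<in> borel_measurable borel" by (intro borel_measurable_continuous_onI continuous_intros)
  show "integrable M (\<lambda>\<omega>. cis (s * f (k n) \<omega>))" for n
    by (intro integrable_const_bound[where B=1]) auto
  show "integrable M (\<lambda>\<omega>. chf (K \<omega>) s)"
    using norm_chf_le[OF RK] chf_kernel_measurable[OF K] by (intro integrable_const_bound[where B=1]) auto
  have "wk_conv M (\<lambda>n \<omega>. cos (s * f (k n) \<omega>)) (\<lambda>\<omega>. \<integral>x. cos (s * x) \<partial>K \<omega>)"
    by (rule wk_conv_kernel_real[OF f det K RK KH, of "\<lambda>x. cos (s * x)" 1]) auto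
  moreover have "Re (chf (K \<omega>) s) = (\<integral>x. cos (s * x) \<partial>K \<omega>)" if "\<omega> \<in> space M" for \<omega>
    using real_distribution.chf_eq[OF RK[OF that]] by simp
  ultimately show "wk_conv M (\<lambda>n \<omega>. Re (cis (s * f (k n) \<omega>))) (\<lambda>\<omega>. Re (chf (K \<omega>) s))"
    by (subst wk_conv_cong[where Y'="\<lambda>\<omega>. \<integral>x. cos (s * x) \<partial>K \<omega>"]) auto
  have "wk_conv M (\<lambda>n \<omega>. sin (s * f (k n) \<omega>)) (\<lambda>\<omega>. \<integral>x. sin (s * x) \<partial>K \<omega>)"
    by (rule wk_conv_kernel_real[OF f det K RK KH, of "\<lambda>x. sin (s * x)" 1]) auto
  moreover have "Im (chf (K \<omega>) s) = (\<integral>x. sin (s * x) \<partial>K \<omega>)" if "\<omega> \<in> space M" for \<omega>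
    using real_distribution.chf_eq[OF RK[OF that]] by simp
  ultimately show "wk_conv M (\<lambda>n \<omega>. Im (cis (s * f (k n) \<omega>))) (\<lambda>\<omega>. Im (chf (K \<omega>) s))"
    by (subst wk_conv_cong[where Y'="\<lambda>\<omega>. \<integral>x. sin (s * x) \<partial>K \<omega>"]) auto
qed

text \<open>Two consecutive blocks of N indices get the frequencies t / N and -t / N, so the product
  of the exponentials is close to 1 in mean, whatever the late indices are. After the limits each
  block contributes the N-th power of \<phi> (t / N) or of its conjugate, together the N-th power of
  the squared modulus.\<close>

lemma chf_power_near_one:
  fixes g :: "nat \<Rightarrow> 'a \<Rightarrow> real"
  assumes g[measurable]: "\<And>n. g n \<in> borel_measurable M" and D[measurable]: "\<And>N. D N \<in> borel_measurable M"
    and tight: "\<And>\<delta>. 0 < \<delta> \<Longrightarrow> \<exists>L. \<forall>n. prob {\<omega>\<in>space M. L < \<bar>g n \<omega>\<bar>} \<le> \<delta>"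
    and conv: "\<And>m :: nat \<Rightarrow> nat. strict_mono m \<Longrightarrow> conv_in_prob M (\<lambda>N \<omega>. avg g m N \<omega> - D N \<omega>)"
    and K[measurable]: "K \<in> measurable M (subprob_algebra borel)"
    and RK: "\<And>\<omega>. \<omega> \<in> space M \<Longrightarrow> real_distribution (K \<omega>)"
    and wk: "\<And>s. wk_conv M (\<lambda>n \<omega>. cis (s * g n \<omega>)) (\<lambda>\<omega>. chf (K \<omega>) s)"
    and e: "0 < \<epsilon>"
  shows "\<exists>N0. \<forall>N\<ge>N0. \<forall>t\<in>{0..2}. (\<integral>\<omega>. 1 - (1 - chf_defect (K \<omega>) (t / real N)) ^ N \<partial>M) \<le> \<epsilon>"
proof -
  \<comment> \<open>Where both block averages are within \<eta> of \<open>D N\<close>, the phase is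
    at most 4 * \<eta>, since t \<le> 2; the two exceptional events have probability at most \<eta>
    and cost 2 each. The total is 8 * \<eta>.\<close>
  define \<eta> where "\<eta> = \<epsilon> / 8"
  have \<eta>: "0 < \<eta>" using e by (simp add: \<eta>_def)
  have cis_m[measurable]: "cis \<in> borel_measurable borel" by (intro borel_measurable_continuous_onI continuous_intros)
  have avg_m[measurable]: "avg g m N \<in> borel_measurable M" for m :: "nat \<Rightarrow> nat" and N
    unfolding avg_def[abs_def] by measurable
  note chf_m[measurable] = chf_kernel_measurable[OF K]
  from hereditary_imp_uniform[OF g D tight conv \<eta>] obtain N0 Q where
    U: "\<And>N m. N0 \<le> N \<Longrightarrow> strict_mono m \<Longrightarrow> Q \<le> m 0 \<Longrightarrow> prob {\<omega>\<in>space M. \<eta> < \<bar>avg g m N \<omega> - D N \<omega>\<bar>} \<le> \<eta>"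
    by blast
  have "(\<integral>\<omega>. 1 - (1 - chf_defect (K \<omega>) (t / real N)) ^ N \<partial>M) \<le> \<epsilon>" if N: "N0 \<le> N" and t: "t \<in> {0..2}" for N t
  proof -
    define r where "r c = (if c < N then t / real N else - (t / real N))" for c :: nat
    have est: "norm ((\<integral>\<omega>. 1 * (\<Prod>c<2 * N. cis (r c * g (j c) \<omega>)) \<partial>M) - 1) \<le> \<epsilon>"
      if j: "strict_mono j" "Q \<le> j 0" for j :: "nat \<Rightarrow> nat"
    proof -
      \<comment> \<open>The second block continues the same increasing sequence, so it starts at
        least as late and the uniform bound covers it as well.\<close>
      define j2 where "j2 i = j (N + i)" for i
      have j2: "strict_mono j2" "Q \<le> j2 0"
        using j strict_mono_less_eq[OF j(1), of 0 N] by (auto simp: j2_def strict_mono_def)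
      define \<theta> where "\<theta> \<omega> = t * (avg g j N \<omega> - avg g j2 N \<omega>)" for \<omega>
      have [measurable]: "\<theta> \<in> borel_measurable M" unfolding \<theta>_def[abs_def] by measurable
      have pr: "(\<Prod>c<2 * N. cis (r c * g (j c) \<omega>)) = cis (\<theta> \<omega>)" for \<omega>
      proof -
        have "(\<Sum>c<2 * N. r c * g (j c) \<omega>) = (\<Sum>c<N. t / real N * g (j c) \<omega>) + (\<Sum>c<N. - (t / real N) * g (j2 c) \<omega>)"
          unfolding lessThan_split_shift by (intro arg_cong2[where f="(+)"] sum.cong) (auto simp: r_def j2_def)
        also have "\<dots> = t / real N * (\<Sum>c<N. g (j c) \<omega>) + - (t / real N) * (\<Sum>c<N. g (j2 c) \<omega>)"
          by (simp only: sum_distrib_left)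
        also have "\<dots> = \<theta> \<omega>" by (simp add: \<theta>_def avg_def algebra_simps)
        finally show ?thesis by (simp only: prod_cis)
      qed
      define E where "E m = {\<omega>\<in>space M. \<eta> < \<bar>avg g m N \<omega> - D N \<omega>\<bar>}" for m :: "nat \<Rightarrow> nat"
      have [measurable]: "E m \<in> sets M" for m unfolding E_def by measurable
      have I: "integrable M (\<lambda>\<omega>. cis (\<theta> \<omega>))" by (intro integrable_const_bound[where B=1]) auto
      have "(\<integral>\<omega>. cis (\<theta> \<omega>) \<partial>M) - 1 = (\<integral>\<omega>. cis (\<theta> \<omega>) - 1 \<partial>M)"
        using I by (simp add: prob_space)
      then have "norm ((\<integral>\<omega>. cis (\<theta> \<omega>) \<partial>M) - 1) \<le> (\<integral>\<omega>. norm (cis (\<theta> \<omega>) - 1) \<partial>M)"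
        using integral_norm_bound[of M "\<lambda>\<omega>. cis (\<theta> \<omega>) - 1"] by simp
      also have "\<dots> \<le> (\<integral>\<omega>. 4 * \<eta> + 2 * (indicator (E j) \<omega> + indicator (E j2) \<omega>) \<partial>M)"
      proof (rule integral_mono)
        show "integrable M (\<lambda>\<omega>. norm (cis (\<theta> \<omega>) - 1))" using I by (intro integrable_norm) simp
        show "integrable M (\<lambda>\<omega>. 4 * \<eta> + 2 * (indicat_real (E j) \<omega> + indicator (E j2) \<omega>))"
          by (intro Bochner_Integration.integrable_add integrable_mult_right integrable_const integrable_real_indicator)
            (auto simp: emeasure_eq_measure)
        fix \<omega> assume sp: "\<omega> \<in> space M"
        have n2: "norm (cis (\<theta> \<omega>) - 1) \<le> 2" using norm_triangle_ineq4[of "cis (\<theta> \<omega>)" 1] by simp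
        show "norm (cis (\<theta> \<omega>) - 1) \<le> 4 * \<eta> + 2 * (indicat_real (E j) \<omega> + indicator (E j2) \<omega>)"
        proof (cases "\<omega> \<in> E j \<or> \<omega> \<in> E j2")
          case True
          then have "1 \<le> indicat_real (E j) \<omega> + indicator (E j2) \<omega>" by (auto simp: indicator_def)
          then have "0 + 2 * 1 \<le> 4 * \<eta> + 2 * (indicat_real (E j) \<omega> + indicator (E j2) \<omega>)"
            using \<eta> by (intro add_mono mult_left_mono) auto
          then show ?thesis using n2 by (auto intro: order_trans)
        next
          case False
          then have "\<bar>avg g j N \<omega> - D N \<omega>\<bar> \<le> \<eta>" "\<bar>avg g j2 N \<omega> - D N \<omega>\<bar> \<le> \<eta>" using sp by (auto simp: E_def)
          then have "\<bar>avg g j N \<omega> - avg g j2 N \<omega>\<bar> \<le> 2 * \<eta>" by linarith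
          then have "\<bar>\<theta> \<omega>\<bar> \<le> 2 * (2 * \<eta>)" using t unfolding \<theta>_def abs_mult by (intro mult_mono) auto
          with norm_cis_minus_1_le have "norm (cis (\<theta> \<omega>) - 1) \<le> 2 * (2 * \<eta>)" by (rule order_trans)
          moreover have "indicat_real (E j) \<omega> = 0" "indicat_real (E j2) \<omega> = 0" using False by auto
          ultimately show ?thesis by simp
        qed
      qed
      also have "\<dots> = 4 * \<eta> + 2 * (prob (E j) + prob (E j2))"
      proof -
        have "integrable M (indicat_real (E j))" "integrable M (indicat_real (E j2))"
          by (auto intro!: integrable_real_indicator simp: emeasure_eq_measure)
        then show ?thesis by (simp add: prob_space)
      qed
      also have "\<dots> \<le> 4 * \<eta> + 2 * (\<eta> + \<eta>)"
        using U[OF N j] U[OF N j2] unfolding E_def by (intro add_left_mono mult_left_mono add_mono) auto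
      also have "\<dots> = \<epsilon>" by (simp add: \<eta>_def)
      finally show ?thesis unfolding pr by simp
    qed
    have lim: "norm ((\<integral>\<omega>. 1 * (\<Prod>c<2 * N. chf (K \<omega>) (r c)) \<partial>M) - 1) \<le> \<epsilon>"
    proof (rule iterated_weak_limits[where u="\<lambda>c x. cis (r c * x)" and g=g and K=Q])
      show "norm (chf (K \<omega>) (r c)) \<le> 1" if "\<omega> \<in> space M" for c \<omega> by (rule norm_chf_le[OF RK[OF that]])
      show "wk_conv M (\<lambda>n \<omega>. cis (r c * g n \<omega>)) (\<lambda>\<omega>. chf (K \<omega>) (r c))" for c by (rule wk)
      show "norm ((\<integral>\<omega>. 1 * (\<Prod>c<2 * N. cis (r c * g (j c) \<omega>)) \<partial>M) - 1) \<le> \<epsilon>"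
        if "strict_mono j" "Q \<le> j 0" for j :: "nat \<Rightarrow> nat" by (rule est[OF that])
    qed auto
    let ?q = "\<lambda>\<omega>. chf_defect (K \<omega>) (t / real N)"
    have pq: "(\<Prod>c<2 * N. chf (K \<omega>) (r c)) = of_real ((1 - ?q \<omega>) ^ N)" if "\<omega> \<in> space M" for \<omega>
    proof -
      interpret R: real_distribution "K \<omega>" by (rule RK[OF that])
      have "(\<Prod>c<2 * N. chf (K \<omega>) (r c)) = (\<Prod>c<N. chf (K \<omega>) (t / real N)) * (\<Prod>c<N. cnj (chf (K \<omega>) (t / real N)))"
        unfolding prod_lessThan_split_shift
        by (intro arg_cong2[where f="(*)"] prod.cong) (auto simp: r_def R.chf_uminus)
      also have "\<dots> = (chf (K \<omega>) (t / real N) * cnj (chf (K \<omega>) (t / real N))) ^ N"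
        by (simp add: power_mult_distrib)
      also have "chf (K \<omega>) (t / real N) * cnj (chf (K \<omega>) (t / real N)) = of_real (1 - ?q \<omega>)"
        using complex_norm_square[of "chf (K \<omega>) (t / real N)"] by (simp add: chf_defect_def)
      finally show ?thesis by simp
    qed
    have q01: "0 \<le> (1 - ?q \<omega>) ^ N \<and> (1 - ?q \<omega>) ^ N \<le> 1" if "\<omega> \<in> space M" for \<omega>
      using real_distribution.chf_defect_nonneg[OF RK[OF that], of "t / real N"]
        real_distribution.chf_defect_le_1[OF RK[OF that], of "t / real N"] by (auto intro: power_le_one)
    have qm[measurable]: "(\<lambda>\<omega>. ?q \<omega>) \<in> borel_measurable M" unfolding chf_defect_def by measurable
    have Iq: "integrable M (\<lambda>\<omega>. (1 - ?q \<omega>) ^ N)"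
      using q01 by (intro integrable_const_bound[where B=1]) auto
    have "(\<integral>\<omega>. 1 * (\<Prod>c<2 * N. chf (K \<omega>) (r c)) \<partial>M) = (\<integral>\<omega>. of_real ((1 - ?q \<omega>) ^ N) \<partial>M)"
      using pq by (intro Bochner_Integration.integral_cong) auto
    also have "\<dots> = of_real (\<integral>\<omega>. (1 - ?q \<omega>) ^ N \<partial>M)" by (rule integral_complex_of_real)
    finally have "norm (complex_of_real (\<integral>\<omega>. (1 - ?q \<omega>) ^ N \<partial>M) - of_real 1) \<le> \<epsilon>" using lim by simp
    then have "\<bar>(\<integral>\<omega>. (1 - ?q \<omega>) ^ N \<partial>M) - 1\<bar> \<le> \<epsilon>" unfolding of_real_diff[symmetric] norm_of_real .
    moreover have "(\<integral>\<omega>. 1 - (1 - ?q \<omega>) ^ N \<partial>M) = 1 - (\<integral>\<omega>. (1 - ?q \<omega>) ^ N \<partial>M)"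
      using Iq by (simp add: prob_space)
    ultimately show ?thesis by linarith
  qed
  then show ?thesis by blast
qed

text \<open>A conditional probability lies in [0, 1] and integrates to the probability, and for
  nonnegative variables with a common bound convergence to 0 in probability is convergence of the
  means to 0.\<close>

lemma conv_in_prob_iff_real_cond_exp:
  assumes T: "subalgebra M T" and A[measurable]: "\<And>N. A N \<in> sets M"
  shows "conv_in_prob M (\<lambda>N. real_cond_exp M T (indicator (A N))) \<longleftrightarrow> (\<lambda>N. prob (A N)) \<longlonglongrightarrow> 0"
proof -
  interpret T: finite_measure_subalgebra M T by unfold_locales (rule T)
  define Y where "Y N = real_cond_exp M T (indicat_real (A N))" for N
  have IA: "integrable M (indicat_real (A N))" for N by (simp add: emeasure_eq_measure)
  have [measurable]: "Y N \<in> borel_measurable M" for N unfolding Y_def by simp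
  have EY: "(\<integral>\<omega>. Y N \<omega> \<partial>M) = prob (A N)" for N
  proof -
    have "(\<integral>\<omega>. Y N \<omega> \<partial>M) = (\<integral>\<omega>. indicat_real (A N) \<omega> \<partial>M)"
      unfolding Y_def by (rule T.real_cond_exp_int(2)[OF IA[of N]])
    also have "\<dots> = prob (A N)" by simp
    finally show ?thesis .
  qed
  have Y0: "AE \<omega> in M. 0 \<le> Y N \<omega>" for N unfolding Y_def by (rule T.real_cond_exp_pos[of "indicat_real (A N)"]) simp_all
  have Y1: "AE \<omega> in M. Y N \<omega> \<le> 1" for N
    unfolding Y_def by (rule T.real_cond_exp_le_c[OF IA[of N]], rule AE_I2) (simp add: indicator_def)
  \<comment> \<open>The conditional expectation lies in [0, 1] only almost everywhere; its clamped
    version does so at every point.\<close>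
  define Z where "Z N \<omega> = max 0 (min 1 (Y N \<omega>))" for N \<omega>
  have [measurable]: "Z N \<in> borel_measurable M" for N unfolding Z_def[abs_def] by measurable
  have ZY: "AE \<omega> in M. Z N \<omega> = Y N \<omega>" for N using Y0[of N] Y1[of N] by eventually_elim (simp add: Z_def)
  have Z01: "0 \<le> Z N \<omega>" "Z N \<omega> \<le> 1" for N \<omega> by (auto simp: Z_def)
  have IZ: "integrable M (Z N)" for N using Z01 by (intro integrable_const_bound[where B=1]) auto
  have EZ: "(\<integral>\<omega>. \<bar>Z N \<omega>\<bar> \<partial>M) = prob (A N)" for N
  proof -
    have "(\<integral>\<omega>. \<bar>Z N \<omega>\<bar> \<partial>M) = (\<integral>\<omega>. Y N \<omega> \<partial>M)" using ZY[of N] Z01 by (intro integral_cong_AE) auto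
    then show ?thesis by (simp add: EY)
  qed
  have "conv_in_prob M Y \<longleftrightarrow> conv_in_prob M Z" using ZY by (intro conv_in_prob_AE_cong) auto
  also have "\<dots> \<longleftrightarrow> (\<lambda>N. \<integral>\<omega>. \<bar>Z N \<omega>\<bar> \<partial>M) \<longlonglongrightarrow> 0"
  proof
    assume "conv_in_prob M Z"
    then show "(\<lambda>N. \<integral>\<omega>. \<bar>Z N \<omega>\<bar> \<partial>M) \<longlonglongrightarrow> 0"
      by (intro conv_in_prob_integral_bounded[where C=1]) (use Z01 in auto)
  next
    assume "(\<lambda>N. \<integral>\<omega>. \<bar>Z N \<omega>\<bar> \<partial>M) \<longlonglongrightarrow> 0"
    then show "conv_in_prob M Z" by (intro conv_in_prob_integral IZ) auto
  qed
  finally show ?thesis unfolding EZ Y_def[abs_def] .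
qed

lemma cond_i_iff_cond_i':
  assumes f[measurable]: "\<And>n. f n \<in> borel_measurable M"
  shows "cond_i M f k D \<longleftrightarrow> cond_i' M f k D"
proof -
  note T = subalgebra_tail_algebra[where f=f, OF f]
  have "conv_in_prob M (\<lambda>N \<omega>. avg f (k \<circ> m) N \<omega> - D N \<omega>) \<longleftrightarrow>
    (\<forall>\<epsilon>>0. conv_in_prob M (\<lambda>N. real_cond_exp M (tail_algebra M f)
          (indicator {\<omega>\<in>space M. \<epsilon> < \<bar>avg f (k \<circ> m) N \<omega> - D N \<omega>\<bar>})))"
    if "\<forall>N. D N \<in> borel_measurable (tail_algebra M f)" for m :: "nat \<Rightarrow> nat"
  proof -
    have [measurable]: "D N \<in> borel_measurable M" for N using that T by (blast intro: measurable_from_subalg)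
    have [measurable]: "(\<lambda>\<omega>. avg f (k \<circ> m) N \<omega>) \<in> borel_measurable M" for N unfolding avg_def by measurable
    show ?thesis
      by (subst conv_in_prob_iff) (auto simp: conv_in_prob_iff_real_cond_exp[OF T])
  qed
  then show ?thesis unfolding cond_i_def cond_i'_def by blast
qed

lemma conv_in_prob_add:
  assumes [measurable]: "\<And>N. X N \<in> borel_measurable M" "\<And>N. Y N \<in> borel_measurable M"
    and c: "conv_in_prob M X" "conv_in_prob M Y"
  shows "conv_in_prob M (\<lambda>N \<omega>. X N \<omega> + Y N \<omega>)"
proof (rule conv_in_probI)
  fix \<epsilon> \<delta> :: real assume "0 < \<epsilon>" "0 < \<delta>"
  then have p: "0 < \<epsilon> / 2" "0 < \<delta> / 2" by auto
  from conv_in_probD[OF c(1) assms(1) p] conv_in_probD[OF c(2) assms(2) p]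
  show "\<forall>\<^sub>F N in sequentially. prob {\<omega>\<in>space M. \<epsilon> < \<bar>X N \<omega> + Y N \<omega>\<bar>} \<le> \<delta>"
  proof (eventually_elim)
    case (elim N)
    have "prob {\<omega>\<in>space M. \<epsilon> < \<bar>X N \<omega> + Y N \<omega>\<bar>} \<le> prob ({\<omega>\<in>space M. \<epsilon> / 2 < \<bar>X N \<omega>\<bar>} \<union> {\<omega>\<in>space M. \<epsilon> / 2 < \<bar>Y N \<omega>\<bar>})"
      by (intro finite_measure_mono) auto
    also have "\<dots> \<le> prob {\<omega>\<in>space M. \<epsilon> / 2 < \<bar>X N \<omega>\<bar>} + prob {\<omega>\<in>space M. \<epsilon> / 2 < \<bar>Y N \<omega>\<bar>}"
      by (rule measure_Un_le) measurable
    finally show ?case using elim by simp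
  qed
qed measurable

text \<open>For N \<ge> 1 both quantities are nonnegative and add up to the integral of
  \<open>trunc_sq\<close>, so each is dominated by the sum. The kernel \<open>K\<close> supplies
  measurable versions.\<close>

lemma random_measure_conditions_iff:
  assumes K[measurable]: "K \<in> measurable M (subprob_algebra borel)"
    and RK: "\<And>\<omega>. \<omega> \<in> space M \<Longrightarrow> real_distribution (K \<omega>)"
    and KR: "AE \<omega> in M. K \<omega> = random_measure H \<omega>"
  shows "conv_in_prob M (\<lambda>N \<omega>. real N * measure (random_measure H \<omega>) (UNIV - {- real N .. real N})) \<and>
      conv_in_prob M (\<lambda>N \<omega>. (\<integral>x\<in>{- real N .. real N}. x\<^sup>2 \<partial>random_measure H \<omega>) / real N) \<longleftrightarrow>
    conv_in_prob M (\<lambda>N \<omega>. \<integral>x. trunc_sq N x \<partial>K \<omega>)"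
proof -
  define X where "X N \<omega> = real N * measure (K \<omega>) (UNIV - {- real N .. real N})" for N \<omega>
  define Y where "Y N \<omega> = (\<integral>x\<in>{- real N .. real N}. x\<^sup>2 \<partial>K \<omega>) / real N" for N \<omega>
  define G where "G N \<omega> = (\<integral>x. trunc_sq N x \<partial>K \<omega>)" for N \<omega>
  have [measurable]: "X N \<in> borel_measurable M" for N
    unfolding X_def[abs_def]
    by (intro borel_measurable_times borel_measurable_const measurable_compose[OF K measurable_measure_subprob_algebra]) auto
  have [measurable]: "Y N \<in> borel_measurable M" for N
    unfolding Y_def[abs_def] set_lebesgue_integral_def
    by (intro borel_measurable_divide borel_measurable_const measurable_compose[OF K integral_measurable_subprob_algebra]) measurable
  have [measurable]: "G N \<in> borel_measurable M" for N
    unfolding G_def[abs_def] by (rule measurable_compose[OF K integral_measurable_subprob_algebra]) measurable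
  have X0: "0 \<le> X N \<omega>" and Y0: "0 \<le> Y N \<omega>" for N \<omega>
    unfolding X_def Y_def set_lebesgue_integral_def
    by (auto intro!: divide_nonneg_nonneg Bochner_Integration.integral_nonneg)
  have GXY: "G N \<omega> = X N \<omega> + Y N \<omega>" if "1 \<le> N" "\<omega> \<in> space M" for N \<omega>
    unfolding G_def X_def Y_def by (rule real_distribution.integral_trunc_sq_eq[OF RK[OF that(2)] that(1)])
  have "conv_in_prob M (\<lambda>N \<omega>. real N * measure (random_measure H \<omega>) (UNIV - {- real N .. real N})) \<longleftrightarrow> conv_in_prob M X"
    by (rule conv_in_prob_AE_cong) (use KR in \<open>auto simp: X_def elim: eventually_mono\<close>)
  moreover have "conv_in_prob M (\<lambda>N \<omega>. (\<integral>x\<in>{- real N .. real N}. x\<^sup>2 \<partial>random_measure H \<omega>) / real N) \<longleftrightarrow> conv_in_prob M Y"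
    by (rule conv_in_prob_AE_cong) (use KR in \<open>auto simp: Y_def elim: eventually_mono\<close>)
  moreover have "conv_in_prob M X \<and> conv_in_prob M Y \<longleftrightarrow> conv_in_prob M G"
  proof (intro iffI conjI)
    assume "conv_in_prob M X \<and> conv_in_prob M Y"
    then have "conv_in_prob M (\<lambda>N \<omega>. X N \<omega> + Y N \<omega>)" by (intro conv_in_prob_add) auto
    then show "conv_in_prob M G"
      by (rule conv_in_prob_bound[rotated 2]) (use GXY in auto)
  next
    assume c: "conv_in_prob M G"
    show "conv_in_prob M X"
      by (rule conv_in_prob_bound[OF _ _ c]) (use GXY X0 Y0 in auto)
    show "conv_in_prob M Y"
      by (rule conv_in_prob_bound[OF _ _ c]) (use GXY X0 Y0 in auto)
  qed
  ultimately show ?thesis unfolding G_def[abs_def] by simp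
qed

lemma cond_i_imp_cond_ii:
  assumes f[measurable]: "\<And>n. f n \<in> borel_measurable M" and c: "cond_i M f k D"
  shows "cond_ii M f"
proof -
  note T = subalgebra_tail_algebra[where f=f, OF f]
  have k: "strict_mono k" and DT: "\<And>N. D N \<in> borel_measurable (tail_algebra M f)"
    and Db: "AE \<omega> in M. \<forall>N\<ge>1. \<bar>D N \<omega>\<bar> \<le> real N"
    and conv: "\<And>m :: nat \<Rightarrow> nat. strict_mono m \<Longrightarrow> conv_in_prob M (\<lambda>N \<omega>. avg f (k \<circ> m) N \<omega> - D N \<omega>)"
    using c unfolding cond_i_def by auto
  have D[measurable]: "D N \<in> borel_measurable M" for N by (rule measurable_from_subalg[OF T DT])
  define g where "g n = f (k n)" for n
  have g[measurable]: "g n \<in> borel_measurable M" for n by (simp add: g_def)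
  have cg: "conv_in_prob M (\<lambda>N \<omega>. avg g m N \<omega> - D N \<omega>)" if "strict_mono m" for m :: "nat \<Rightarrow> nat"
    using conv[OF that] by (simp add: avg_def g_def o_def)
  have tight: "\<exists>L. \<forall>n. prob {\<omega>\<in>space M. L < \<bar>g n \<omega>\<bar>} \<le> \<delta>" if "0 < \<delta>" for \<delta>
    by (rule hereditary_imp_tight[OF g D Db cg that])
  obtain r E H where r: "strict_mono r" and det: "determining_with M g r E H"
    by (rule tight_imp_determining[OF g tight])
  have HM: "H x \<in> borel_measurable M" and Hd: "AE \<omega> in M. distribution_function (\<lambda>x. H x \<omega>)" for x
    using det by (auto simp: determining_with_def)
  obtain K where K: "K \<in> measurable M (subprob_algebra borel)"
    and RK: "\<And>\<omega>. \<omega> \<in> space M \<Longrightarrow> real_distribution (K \<omega>)"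
    and KH: "AE \<omega> in M. K \<omega> = random_measure H \<omega> \<and> (\<forall>x. measure (K \<omega>) {..x} = H x \<omega>)"
    using kernel_of_distribution_functions[OF HM Hd] by blast
  have KH1: "AE \<omega> in M. K \<omega> = random_measure H \<omega>" and KH2: "AE \<omega> in M. \<forall>x. measure (K \<omega>) {..x} = H x \<omega>"
    using KH by (auto elim: eventually_mono)
  have wk: "wk_conv M (\<lambda>n \<omega>. cis (s * g (r n) \<omega>)) (\<lambda>\<omega>. chf (K \<omega>) s)" for s
    by (rule wk_conv_chf[OF g det K RK KH2])
  have "conv_in_prob M (\<lambda>N \<omega>. \<integral>x. trunc_sq N x \<partial>K \<omega>)"
  proof (rule conv_in_prob_trunc_sq_of_chf[OF K RK])
    fix \<epsilon> :: real assume e: "0 < \<epsilon>"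
    have gr: "g (r n) \<in> borel_measurable M" for n by simp
    have tr: "\<exists>L. \<forall>n. prob {\<omega>\<in>space M. L < \<bar>g (r n) \<omega>\<bar>} \<le> \<delta>" if "0 < \<delta>" for \<delta>
      using tight[OF that] by blast
    \<comment> \<open>Subsequences of the subsequence are covered by the hypothesis, so the weak law
      persists with the same centering \<open>D\<close>.\<close>
    have cr: "conv_in_prob M (\<lambda>N \<omega>. avg (\<lambda>n. g (r n)) m N \<omega> - D N \<omega>)" if "strict_mono m" for m :: "nat \<Rightarrow> nat"
      using cg[OF strict_mono_o[OF r that]] by (simp add: avg_def o_def)
    show "\<exists>N0. \<forall>N\<ge>N0. \<forall>t\<in>{0..2}. (\<integral>\<omega>. 1 - (1 - chf_defect (K \<omega>) (t / real N)) ^ N \<partial>M) \<le> \<epsilon>"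
      by (rule chf_power_near_one[where g="\<lambda>n. g (r n)" and D=D, OF gr D tr cr K RK wk e])
  qed
  moreover have "determining_with M f (k \<circ> r) E H"
    using det by (simp add: determining_with_def g_def)
  moreover have "strict_mono (k \<circ> r)" using k r by (rule strict_mono_o)
  ultimately show ?thesis
    unfolding cond_ii_def using random_measure_conditions_iff[OF K RK KH1] by blast
qed

text \<open>Conditional expectation is self-adjoint, so it passes from \<open>X n\<close> to the
  test function, which becomes an integrable weight for weak convergence of bounded variables. Since
  \<open>D\<close> is measurable for \<open>T\<close>, conditioning the test function does not
  change its integral against \<open>D\<close>.\<close>

lemma weak_L2_limit_cond_exp:
  assumes T: "subalgebra M T" and X[measurable]: "\<And>n. X n \<in> borel_measurable M"
    and D: "D \<in> borel_measurable T"
    and bX: "\<And>n \<omega>. \<omega> \<in> space M \<Longrightarrow> \<bar>X n \<omega>\<bar> \<le> C" and bD: "\<And>\<omega>. \<omega> \<in> space M \<Longrightarrow> \<bar>D \<omega>\<bar> \<le> C"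
    and w: "wk_conv M X D"
  shows "weak_L2_limit M (\<lambda>n \<omega>. real_cond_exp M T (X n) \<omega>) D"
  unfolding weak_L2_limit_def
proof (intro conjI ballI impI)
  interpret T: finite_measure_subalgebra M T by unfold_locales (rule T)
  show DM[measurable]: "D \<in> borel_measurable M" by (rule measurable_from_subalg[OF T D])
  have D2: "(D \<omega>)\<^sup>2 \<le> C\<^sup>2" if "\<omega> \<in> space M" for \<omega>
    using power_mono[OF bD[OF that], of 2] by simp
  show "integrable M (\<lambda>\<omega>. (D \<omega>)\<^sup>2)"
    using D2 by (intro integrable_const_bound[where B="C\<^sup>2"]) auto
  fix g :: "'a \<Rightarrow> real" assume g[measurable]: "g \<in> borel_measurable M" and g2: "integrable M (\<lambda>\<omega>. (g \<omega>)\<^sup>2)"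
  \<comment> \<open>On a probability space |g| \<le> 1 + g^2 makes square integrable functions
    integrable.\<close>
  have Ig: "integrable M g"
  proof (rule Bochner_Integration.integrable_bound[of M "\<lambda>\<omega>. 1 + (g \<omega>)\<^sup>2"])
    show "AE \<omega> in M. norm (g \<omega>) \<le> norm (1 + (g \<omega>)\<^sup>2)"
    proof (rule AE_I2)
      fix \<omega>
      have "0 \<le> (\<bar>g \<omega>\<bar> - 1)\<^sup>2" "0 \<le> (\<bar>g \<omega>\<bar>)\<^sup>2" by simp_all
      then show "norm (g \<omega>) \<le> norm (1 + (g \<omega>)\<^sup>2)" by (simp add: power2_eq_square algebra_simps)
    qed
  qed (use g2 in auto)
  let ?h = "real_cond_exp M T g"
  have Ih: "integrable M ?h" by (rule T.real_cond_exp_int(1)[OF Ig])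
  have IX: "integrable M (X n)" for n using bX by (intro integrable_const_bound[where B=C]) auto
  have e1: "(\<integral>\<omega>. real_cond_exp M T (X n) \<omega> * g \<omega> \<partial>M) = (\<integral>\<omega>. ?h \<omega> * X n \<omega> \<partial>M)" for n
  proof -
    let ?Y = "real_cond_exp M T (X n)"
    have "AE \<omega> in M. ?Y \<omega> \<le> C"
      by (rule T.real_cond_exp_le_c[OF IX]) (use bX in \<open>auto simp: abs_le_iff\<close>)
    moreover have "AE \<omega> in M. - C \<le> ?Y \<omega>"
      by (rule T.real_cond_exp_ge_c[OF IX]) (use bX in \<open>auto simp: abs_le_iff minus_le_iff\<close>)
    ultimately have Yb: "AE \<omega> in M. \<bar>?Y \<omega>\<bar> \<le> C" by eventually_elim auto
    have IYg: "integrable M (\<lambda>\<omega>. ?Y \<omega> * g \<omega>)"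
    proof (rule Bochner_Integration.integrable_bound[of M "\<lambda>\<omega>. C * g \<omega>"])
      show "AE \<omega> in M. norm (?Y \<omega> * g \<omega>) \<le> norm (C * g \<omega>)"
        using Yb
      proof eventually_elim
        case (elim \<omega>)
        then have "\<bar>?Y \<omega>\<bar> \<le> \<bar>C\<bar>" by linarith
        then show ?case by (simp add: abs_mult mult_right_mono)
      qed
    qed (use Ig in auto)
    have IhX: "integrable M (\<lambda>\<omega>. ?h \<omega> * X n \<omega>)" by (rule integrable_mult_bdd[OF Ih X bX])
    have "(\<integral>\<omega>. ?Y \<omega> * g \<omega> \<partial>M) = (\<integral>\<omega>. ?Y \<omega> * ?h \<omega> \<partial>M)"
      by (rule T.real_cond_exp_intg(2)[symmetric, OF IYg]) auto
    also have "\<dots> = (\<integral>\<omega>. ?h \<omega> * ?Y \<omega> \<partial>M)" by (simp add: mult.commute)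
    also have "\<dots> = (\<integral>\<omega>. ?h \<omega> * X n \<omega> \<partial>M)" by (rule T.real_cond_exp_intg(2)[OF IhX]) auto
    finally show ?thesis .
  qed
  have IDg: "integrable M (\<lambda>\<omega>. D \<omega> * g \<omega>)"
    using integrable_mult_bdd[OF Ig DM bD] by (simp add: mult.commute)
  have "(\<integral>\<omega>. ?h \<omega> * D \<omega> \<partial>M) = (\<integral>\<omega>. D \<omega> * ?h \<omega> \<partial>M)" by (simp add: mult.commute)
  also have "\<dots> = (\<integral>\<omega>. D \<omega> * g \<omega> \<partial>M)" by (rule T.real_cond_exp_intg(2)[OF IDg D]) simp
  finally have e2: "(\<integral>\<omega>. ?h \<omega> * D \<omega> \<partial>M) = (\<integral>\<omega>. D \<omega> * g \<omega> \<partial>M)" .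
  have "(\<lambda>n. \<integral>\<omega>. ?h \<omega> * X n \<omega> \<partial>M) \<longlonglongrightarrow> (\<integral>\<omega>. ?h \<omega> * D \<omega> \<partial>M)"
    using wk_conv_integral[OF w Ih X DM, of C] bX bD by simp
  then show "(\<lambda>n. \<integral>\<omega>. real_cond_exp M T (X n) \<omega> * g \<omega> \<partial>M) \<longlonglongrightarrow> (\<integral>\<omega>. D \<omega> * g \<omega> \<partial>M)"
    unfolding e1 e2 .
qed

lemma cond_ii_imp_cond_i:
  assumes f[measurable]: "\<And>n. f n \<in> borel_measurable M" and c: "cond_ii M f"
  shows "\<exists>k D. cond_i M f k D
    \<and> (\<forall>N\<ge>1. weak_L2_limit M (\<lambda>n \<omega>. real_cond_exp M (tail_algebra M f)
          (\<lambda>\<omega>. f (k n) \<omega> * indicator {\<omega>. \<bar>f (k n) \<omega>\<bar> \<le> real N} \<omega>) \<omega>) (D N))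
    \<and> conv_in_prob M (\<lambda>N \<omega>. D N \<omega> / sqrt (real N))"
proof -
  note T = subalgebra_tail_algebra[where f=f, OF f]
  obtain k E H where k: "strict_mono k" and det: "determining_with M f k E H"
    and c2: "conv_in_prob M (\<lambda>N \<omega>. real N * measure (random_measure H \<omega>) (UNIV - {- real N .. real N})) \<and>
      conv_in_prob M (\<lambda>N \<omega>. (\<integral>x\<in>{- real N .. real N}. x\<^sup>2 \<partial>random_measure H \<omega>) / real N)"
    using c unfolding cond_ii_def by blast
  have HM: "H x \<in> borel_measurable M" and Hd: "AE \<omega> in M. distribution_function (\<lambda>x. H x \<omega>)" for x
    using det by (auto simp: determining_with_def)
  obtain K where K: "K \<in> measurable M (subprob_algebra borel)"
    and RK: "\<And>\<omega>. \<omega> \<in> space M \<Longrightarrow> real_distribution (K \<omega>)"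
    and KH: "AE \<omega> in M. K \<omega> = random_measure H \<omega> \<and> (\<forall>x. measure (K \<omega>) {..x} = H x \<omega>)"
    using kernel_of_distribution_functions[OF HM Hd] by blast
  have KH1: "AE \<omega> in M. K \<omega> = random_measure H \<omega>" and KH2: "AE \<omega> in M. \<forall>x. measure (K \<omega>) {..x} = H x \<omega>"
    using KH by (auto elim: eventually_mono)
  define G where "G N \<omega> = (\<integral>x. trunc_sq N x \<partial>K \<omega>)" for N \<omega>
  have G0: "conv_in_prob M G"
    using c2 random_measure_conditions_iff[OF K RK KH1] by (simp add: G_def[abs_def])
  have GM[measurable]: "G N \<in> borel_measurable M" for N
    unfolding G_def[abs_def] by (rule measurable_compose[OF K integral_measurable_subprob_algebra]) measurable
  have Gb: "0 \<le> G N \<omega> \<and> G N \<omega> \<le> real N" if w: "\<omega> \<in> space M" for N \<omega>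
  proof -
    interpret R: real_distribution "K \<omega>" by (rule RK[OF w])
    have "\<bar>\<integral>x. trunc_sq N x \<partial>K \<omega>\<bar> \<le> real N" by (rule R.abs_inner_le) (auto simp: abs_trunc_sq_le)
    moreover have "0 \<le> (\<integral>x. trunc_sq N x \<partial>K \<omega>)" using trunc_sq_nonneg by (intro Bochner_Integration.integral_nonneg)
    ultimately show ?thesis by (simp add: G_def)
  qed
  have wG0: "wk_conv M (\<lambda>n \<omega>. trunc_sq N (f (k n) \<omega>)) (G N)" for N
    unfolding G_def[abs_def]
    by (rule wk_conv_kernel_real[OF f det K RK KH2 isCont_trunc_sq abs_trunc_sq_le])
  \<comment> \<open>Compactness asks for positive bounds, so N = 0 gets the bound 1.\<close>
  define C :: "nat \<Rightarrow> real" where "C i = (if i = 0 then 1 else real i)" for i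
  have Cb: "0 < C i" "\<bar>truncation i x\<bar> \<le> C i" for i x using abs_truncation_le[of i x] by (auto simp: C_def)
  \<comment> \<open>A further subsequence, since the jumps of the truncation rule out
    \<open>wk_conv_kernel_real\<close>.\<close>
  obtain r Y where r: "strict_mono r" and Y: "\<And>i. Y i \<in> borel_measurable M" "\<And>i \<omega>. \<bar>Y i \<omega>\<bar> \<le> C i"
    "\<And>i. wk_conv M (\<lambda>n \<omega>. truncation i (f (k (r n)) \<omega>)) (Y i)"
    using weak_sequential_compactness_functions[where f="\<lambda>n. f (k n)" and u=truncation and C=C, OF f truncation_measurable Cb] by blast
  \<comment> \<open>The n-th term is thus measurable for the n-th future algebra, which makes the
    limits tail measurable.\<close>
  have kr: "n \<le> k (r n)" for n
    using strict_mono_imp_increasing[OF strict_mono_o[OF k r], of n] by simp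
  have "\<exists>D. D \<in> borel_measurable (tail_algebra M f) \<and> (\<forall>\<omega>\<in>space M. \<bar>D \<omega>\<bar> \<le> C i) \<and> (AE \<omega> in M. D \<omega> = Y i \<omega>)" for i
  proof (rule weak_limit_tail_measurable[where f=f and X="\<lambda>n \<omega>. truncation i (f (k (r n)) \<omega>)" and Y="Y i" and C="C i", OF f])
    show "(\<lambda>\<omega>. truncation i (f (k (r n)) \<omega>)) \<in> borel_measurable (future_algebra M f n)" for n
      by (rule measurable_compose[OF measurable_future_algebra[where f=f, OF kr] truncation_measurable])
  qed (use Y Cb in auto)
  then obtain D0 where D0: "\<And>i. D0 i \<in> borel_measurable (tail_algebra M f)" "\<And>i \<omega>. \<omega> \<in> space M \<Longrightarrow> \<bar>D0 i \<omega>\<bar> \<le> C i"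
    "\<And>i. AE \<omega> in M. D0 i \<omega> = Y i \<omega>" by metis
  \<comment> \<open>The value 0 at N = 0 restores the bound
    \<open>\<bar>D N \<omega>\<bar> \<le> real N\<close> there, where the compactness bound is
    1.\<close>
  define D where "D N \<omega> = (if N = 0 then 0 else D0 N \<omega>)" for N \<omega>
  have DT: "D N \<in> borel_measurable (tail_algebra M f)" for N using D0(1)[of N] by (cases "N = 0") (auto simp: D_def[abs_def])
  have DM[measurable]: "D N \<in> borel_measurable M" for N by (rule measurable_from_subalg[OF T DT])
  have Db: "\<bar>D N \<omega>\<bar> \<le> real N" if "\<omega> \<in> space M" for N \<omega>
    using D0(2)[OF that, of N] by (auto simp: D_def C_def)
  have wD0: "wk_conv M (\<lambda>n \<omega>. truncation N (f (k (r n)) \<omega>)) (D N)" if "1 \<le> N" for N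
    unfolding wk_conv_def
  proof
    fix B assume B[measurable]: "B \<in> sets M"
    have [measurable]: "Y N \<in> borel_measurable M" by (rule Y)
    have [measurable]: "D0 N \<in> borel_measurable M" by (rule measurable_from_subalg[OF T D0(1)])
    have "(\<integral>\<omega>\<in>B. D N \<omega> \<partial>M) = (\<integral>\<omega>\<in>B. Y N \<omega> \<partial>M)"
      using D0(3)[of N] that by (intro set_lebesgue_integral_cong_AE) (auto simp: D_def elim: eventually_mono)
    with wk_convD[OF Y(3) B, of N]
    show "(\<lambda>n. \<integral>\<omega>\<in>B. truncation N (f (k (r n)) \<omega>) \<partial>M) \<longlonglongrightarrow> (\<integral>\<omega>\<in>B. D N \<omega> \<partial>M)" by simp
  qed
  \<comment> \<open>The limit \<open>G\<close> is inherited by the subsequence, so that truncations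
    and truncated squares converge along the same indices.\<close>
  have wG: "wk_conv M (\<lambda>n \<omega>. trunc_sq N (f (k (r n)) \<omega>)) (G N)" for N
    by (rule wk_conv_subseq[OF wG0 r])
  have fkr: "f (k (r n)) \<in> borel_measurable M" for n by simp
  obtain s where s: "strict_mono s"
    and law: "\<And>m :: nat \<Rightarrow> nat. strict_mono m \<Longrightarrow> conv_in_prob M (\<lambda>N \<omega>. avg (\<lambda>n. f (k (r n))) (s \<circ> m) N \<omega> - D N \<omega>)"
    using hereditary_weak_law_of_trunc_sq[where g="\<lambda>n. f (k (r n))" and G=G and D=D, OF fkr GM DM Gb Db wG wD0 G0] by blast
  let ?k = "\<lambda>n. k (r (s n))"
  have "cond_i M f ?k D"
    unfolding cond_i_def
  proof (intro conjI allI impI)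
    show "strict_mono ?k" using strict_mono_o[OF k strict_mono_o[OF r s]] by (simp add: o_def)
    show "D N \<in> borel_measurable (tail_algebra M f)" for N by (rule DT)
    show "AE \<omega> in M. \<forall>N\<ge>1. \<bar>D N \<omega>\<bar> \<le> real N" using Db by (intro AE_I2) auto
    fix m :: "nat \<Rightarrow> nat" assume "strict_mono m"
    from law[OF this] show "conv_in_prob M (\<lambda>N \<omega>. avg f (?k \<circ> m) N \<omega> - D N \<omega>)" by (simp add: avg_def o_def)
  qed
  moreover have "weak_L2_limit M (\<lambda>n \<omega>. real_cond_exp M (tail_algebra M f)
          (\<lambda>\<omega>. f (?k n) \<omega> * indicator {\<omega>. \<bar>f (?k n) \<omega>\<bar> \<le> real N} \<omega>) \<omega>) (D N)" if N: "1 \<le> N" for N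
  proof -
    have e: "(\<lambda>\<omega>. f (?k n) \<omega> * indicator {\<omega>. \<bar>f (?k n) \<omega>\<bar> \<le> real N} \<omega>) = (\<lambda>\<omega>. truncation N (f (?k n) \<omega>))" for n
      by (auto simp: truncation_def indicator_def fun_eq_iff)
    show ?thesis unfolding e
      by (rule weak_L2_limit_cond_exp[where X="\<lambda>n \<omega>. truncation N (f (?k n) \<omega>)" and C="real N", OF T _ DT])
        (use abs_truncation_le Db wk_conv_subseq[OF wD0[OF N] s] in auto)
  qed
  moreover have "conv_in_prob M (\<lambda>N \<omega>. D N \<omega> / sqrt (real N))"
  proof (rule conv_in_prob_div_sqrt[OF DM GM _ G0])
    show "AE \<omega> in M. (D N \<omega>)\<^sup>2 \<le> real N * G N \<omega>" if "1 \<le> N" for N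
      by (rule sq_weak_limit_truncation_le[OF fkr that GM DM _ Db wG wD0[OF that]]) (use Gb in auto)
  qed
  ultimately show ?thesis by blast
qed

end

theorem theorem3p1:
  fixes M :: "'a measure" and f :: "nat \<Rightarrow> 'a \<Rightarrow> real"
  assumes "prob_space M"
    and "\<And>n. f n \<in> borel_measurable M"
  shows "((\<exists>k D. cond_i M f k D) \<longleftrightarrow> (\<exists>k D. cond_i' M f k D))
       \<and> ((\<exists>k D. cond_i M f k D) \<longleftrightarrow> cond_ii M f)
       \<and> ((\<exists>k D. cond_i M f k D) \<longrightarrow>
           (\<exists>k D. cond_i M f k D \<and> cond_i' M f k D
              \<and> (\<forall>N\<ge>1. weak_L2_limit M
                    (\<lambda>n \<omega>. real_cond_exp M (tail_algebra M f)
                       (\<lambda>\<omega>. f (k n) \<omega> * indicator {\<omega>. \<bar>f (k n) \<omega>\<bar> \<le> real N} \<omega>) \<omega>)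
                    (D N))
              \<and> conv_in_prob M (\<lambda>N \<omega>. D N \<omega> / sqrt (real N))))"
proof -
  interpret prob_space M by fact
  note f = assms(2)
  have eq: "(\<exists>k D. cond_i M f k D) \<longleftrightarrow> cond_ii M f"
    using cond_i_imp_cond_ii[where f=f, OF f] cond_ii_imp_cond_i[where f=f, OF f] by blast
  \<comment> \<open>The same k and D satisfy both conditions, so one witness serves them jointly in
    the last clause.\<close>
  have eq': "cond_i M f k D \<longleftrightarrow> cond_i' M f k D" for k D
    by (rule cond_i_iff_cond_i'[where f=f, OF f])
  show ?thesis
    unfolding eq'[symmetric] unfolding eq using cond_ii_imp_cond_i[where f=f, OF f] by simp
qed

end
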